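(* For every constant $p\ge 3$, the Connected Feedback Vertex Set problem is NP-complete when restricted to graphs of girth at least $p$.
   Context: All graphs are finite and simple. The girth of a graph is the length of a shortest cycle in it (a forest has infinite girth). A feedback vertex set of a graph $G$ is a set $S\subseteq V(G)$ such that $G-S$ is a forest; it is connected if the induced subgraph $G[S]$ is connected. The Connected Feedback Vertex Set problem: given a graph $G$ and an integer $k$, decide whether $G$ has a connected feedback vertex set $S$ with $|S|\le k$. *)

theory Defs
  imports
    Main
    "HOL-Library.Extended_Nat"
    "HOL-Computational_Algebra.Polynomial"
begin

section \<open>Polynomial time on deterministic multi-tape Turing machines\<close>

datatype direction = Left | Stay | Right

text \<open>
  Tape symbols and states are natural numbers below a bound that belongs to the machine.
  Symbol 0 is the blank; the bits are symbols 1 and 2.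
  A tape is infinite in both directions. It is represented by the cells to the left of the head
  (nearest first), the scanned cell, and the cells to the right of the head (nearest first);
  all cells not represented are blank.
\<close>

type_synonym tape = "nat list \<times> nat \<times> nat list"

abbreviation blank :: nat where "blank \<equiv> 0"

definition bit_symbol :: "bool \<Rightarrow> nat" where
  "bit_symbol b = (if b then 2 else 1)"

fun scanned :: "tape \<Rightarrow> nat" where
  "scanned (l, c, r) = c"

fun write_symbol :: "nat \<Rightarrow> tape \<Rightarrow> tape" where
  "write_symbol s (l, c, r) = (l, s, r)"

fun move_head :: "direction \<Rightarrow> tape \<Rightarrow> tape" where
  "move_head Stay t = t"
| "move_head Left ([], c, r) = ([], blank, c # r)"
| "move_head Left (a # l, c, r) = (l, a, c # r)"
| "move_head Right (l, c, []) = (c # l, blank, [])"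
| "move_head Right (l, c, a # r) = (c # l, a, r)"

fun input_tape :: "bool list \<Rightarrow> tape" where
  "input_tape [] = ([], blank, [])"
| "input_tape (b # bs) = ([], bit_symbol b, map bit_symbol bs)"

text \<open>The word on a tape starts at the head and extends to the right up to the first blank.\<close>

fun tape_word :: "tape \<Rightarrow> nat list" where
  "tape_word (l, c, r) = takeWhile (\<lambda>s. s \<noteq> blank) (c # r)"

record tm =
  num_tapes :: nat
  num_symbols :: nat
  num_states :: nat
  start_state :: nat
  halt_state :: nat
  transition :: "nat \<Rightarrow> nat list \<Rightarrow> nat \<times> (nat \<times> direction) list"

definition wf_tm :: "tm \<Rightarrow> bool" where
  "wf_tm M \<longleftrightarrow>
     1 \<le> num_tapes M \<and> 3 \<le> num_symbols M \<and>
     start_state M < num_states M \<and> halt_state M < num_states M \<and>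
     (\<forall>q ss. q < num_states M \<and> length ss = num_tapes M \<and> set ss \<subseteq> {..<num_symbols M} \<longrightarrow>
        (case transition M q ss of (q', as) \<Rightarrow>
           q' < num_states M \<and> length as = num_tapes M \<and>
           (\<forall>(s, d) \<in> set as. s < num_symbols M)))"

type_synonym config = "nat \<times> tape list"

definition initial_config :: "tm \<Rightarrow> bool list list \<Rightarrow> config" where
  "initial_config M ws =
     (start_state M,
      map input_tape ws @ replicate (num_tapes M - length ws) (input_tape []))"

definition step :: "tm \<Rightarrow> config \<Rightarrow> config" where
  "step M = (\<lambda>(q, ts).
     if q = halt_state M then (q, ts)
     else case transition M q (map scanned ts) of (q', as) \<Rightarrow>
       (q', map2 (\<lambda>(s, d) t. move_head d (write_symbol s t)) as ts))"

text \<open>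
  Each input word is placed on a tape of its own; the output is the word on the last tape.
  Since halting configurations are fixed by \<open>step\<close>, being halted after exactly \<open>t\<close> steps means
  having halted within \<open>t\<close> steps.
\<close>

definition outputs_within :: "tm \<Rightarrow> nat \<Rightarrow> bool list list \<Rightarrow> bool list \<Rightarrow> bool" where
  "outputs_within M t ws v \<longleftrightarrow>
     (case (step M ^^ t) (initial_config M ws) of (q, ts) \<Rightarrow>
        q = halt_state M \<and> tape_word (last ts) = map bit_symbol v)"

definition poly_time_computable :: "nat \<Rightarrow> (bool list list \<Rightarrow> bool list) \<Rightarrow> bool" where
  "poly_time_computable k f \<longleftrightarrow>
     (\<exists>(M :: tm) (p :: nat poly). wf_tm M \<and> k \<le> num_tapes M \<and>
        (\<forall>ws. length ws = k \<longrightarrow>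
           outputs_within M (poly p (sum_list (map length ws))) ws (f ws)))"

definition poly_time_decidable :: "nat \<Rightarrow> (bool list list \<Rightarrow> bool) \<Rightarrow> bool" where
  "poly_time_decidable k R \<longleftrightarrow> poly_time_computable k (\<lambda>ws. [R ws])"


section \<open>NP-completeness\<close>

type_synonym language = "bool list set"

definition in_NP :: "language \<Rightarrow> bool" where
  "in_NP L \<longleftrightarrow>
     (\<exists>(R :: bool list \<Rightarrow> bool list \<Rightarrow> bool) (q :: nat poly).
        poly_time_decidable 2 (\<lambda>ws. R (ws ! 0) (ws ! 1)) \<and>
        (\<forall>x. x \<in> L \<longleftrightarrow> (\<exists>w. length w \<le> poly q (length x) \<and> R x w)))"

definition poly_reducible :: "language \<Rightarrow> language \<Rightarrow> bool" where
  "poly_reducible L L' \<longleftrightarrow>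
     (\<exists>f. poly_time_computable 1 (\<lambda>ws. f (ws ! 0)) \<and> (\<forall>x. x \<in> L \<longleftrightarrow> f x \<in> L'))"

definition NP_hard :: "language \<Rightarrow> bool" where
  "NP_hard L \<longleftrightarrow> (\<forall>L'. in_NP L' \<longrightarrow> poly_reducible L' L)"

definition NP_complete :: "language \<Rightarrow> bool" where
  "NP_complete L \<longleftrightarrow> in_NP L \<and> NP_hard L"


section \<open>Finite simple graphs\<close>

type_synonym 'a graph = "'a set \<times> 'a set set"

abbreviation verts :: "'a graph \<Rightarrow> 'a set" where "verts G \<equiv> fst G"
abbreviation edges :: "'a graph \<Rightarrow> 'a set set" where "edges G \<equiv> snd G"

definition simple_graph :: "'a graph \<Rightarrow> bool" where
  "simple_graph G \<longleftrightarrow> finite (verts G) \<and> (\<forall>e \<in> edges G. e \<subseteq> verts G \<and> card e = 2)"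

definition induced_subgraph :: "'a graph \<Rightarrow> 'a set \<Rightarrow> 'a graph" where
  "induced_subgraph G S = (S, {e \<in> edges G. e \<subseteq> S})"

definition delete_verts :: "'a graph \<Rightarrow> 'a set \<Rightarrow> 'a graph" where
  "delete_verts G S = induced_subgraph G (verts G - S)"

text \<open>A cycle is given by the list of its vertices, without repeating the first one at the end.\<close>

definition is_cycle :: "'a graph \<Rightarrow> 'a list \<Rightarrow> bool" where
  "is_cycle G vs \<longleftrightarrow>
     3 \<le> length vs \<and> distinct vs \<and>
     (\<forall>i < length vs. {vs ! i, vs ! (Suc i mod length vs)} \<in> edges G)"

definition forest :: "'a graph \<Rightarrow> bool" where
  "forest G \<longleftrightarrow> (\<nexists>vs. is_cycle G vs)"

text \<open>In \<^typ>\<open>enat\<close> the infimum of the empty set is \<open>\<infinity>\<close>, so forests have infinite girth.\<close>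

definition girth :: "'a graph \<Rightarrow> enat" where
  "girth G = (INF vs \<in> {vs. is_cycle G vs}. enat (length vs))"

text \<open>The graph without vertices counts as connected.\<close>

definition connected_graph :: "'a graph \<Rightarrow> bool" where
  "connected_graph G \<longleftrightarrow>
     (\<forall>u \<in> verts G. \<forall>v \<in> verts G. (u, v) \<in> {(x, y). {x, y} \<in> edges G}\<^sup>*)"

definition feedback_vertex_set :: "'a graph \<Rightarrow> 'a set \<Rightarrow> bool" where
  "feedback_vertex_set G S \<longleftrightarrow> S \<subseteq> verts G \<and> forest (delete_verts G S)"

definition connected_feedback_vertex_set :: "'a graph \<Rightarrow> 'a set \<Rightarrow> bool" where
  "connected_feedback_vertex_set G S \<longleftrightarrow>
     feedback_vertex_set G S \<and> connected_graph (induced_subgraph G S)"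


section \<open>The decision problem\<close>

text \<open>
  An instance consists of a graph with vertex set \<open>{0..<n}\<close> and a number \<open>k\<close>. It is encoded by
  \<open>n\<close> in unary, a delimiter, the \<open>n \<times> n\<close> adjacency matrix row by row, and \<open>k\<close> in binary
  (least significant bit first, no superfluous zeros).
\<close>

fun binary :: "nat \<Rightarrow> bool list" where
  "binary k = (if k = 0 then [] else odd k # binary (k div 2))"

declare binary.simps [simp del]

definition encode_instance :: "nat graph \<Rightarrow> nat \<Rightarrow> bool list" where
  "encode_instance G k =
     (let n = card (verts G) in
        replicate n True @ [False] @
        map (\<lambda>(i, j). {i, j} \<in> edges G) (List.product [0..<n] [0..<n]) @
        binary k)"

definition nat_graph :: "nat graph \<Rightarrow> bool" where
  "nat_graph G \<longleftrightarrow> simple_graph G \<and> (\<exists>n. verts G = {0..<n})"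

definition connected_fvs_problem :: "(nat graph \<Rightarrow> bool) \<Rightarrow> language" where
  "connected_fvs_problem \<C> =
     {encode_instance G k | G k.
        nat_graph G \<and> \<C> G \<and>
        (\<exists>S. connected_feedback_vertex_set G S \<and> card S \<le> k)}"

lemma binary_inject: "binary k = binary l \<Longrightarrow> k = l"
proof (induction k arbitrary: l rule: less_induct)
  case (less k)
  show ?case
  proof (cases "k = 0 \<or> l = 0")
    case True
    with less.prems show ?thesis
      by (auto simp: binary.simps[of k] binary.simps[of l] split: if_splits)
  next
    case False
    with less.prems have "odd k = odd l" "binary (k div 2) = binary (l div 2)"
      by (auto simp: binary.simps[of k] binary.simps[of l])
    with less.IH[of "k div 2" "l div 2"] False have "k div 2 = l div 2" "odd k = odd l"
      by auto
    then show ?thesis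
      by (metis even_two_times_div_two odd_two_times_div_two_succ)
  qed
qed

lemma encode_instance_inject:
  assumes "nat_graph G" "nat_graph H" and eq: "encode_instance G k = encode_instance H l"
  shows "G = H \<and> k = l"
proof -
  obtain n m where V: "verts G = {0..<n}" "verts H = {0..<m}"
    using assms by (auto simp: nat_graph_def)
  have tw: "takeWhile id (replicate a True @ [False] @ ys) = replicate a True" for a ys
    by (induction a) auto
  from arg_cong[OF eq, of "\<lambda>xs. length (takeWhile id xs)"] have "n = m"
    by (simp only: encode_instance_def Let_def V tw) simp
  with eq V have bits: "\<forall>i<n. \<forall>j<n. {i, j} \<in> edges G \<longleftrightarrow> {i, j} \<in> edges H"
    and "binary k = binary l"
    by (auto simp: encode_instance_def)
  have sub: "edges A \<subseteq> edges B"
    if "simple_graph A" "verts A = {0..<n}"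
      "\<forall>i<n. \<forall>j<n. {i, j} \<in> edges A \<longrightarrow> {i, j} \<in> edges B" for A B :: "nat graph"
  proof
    fix e assume e: "e \<in> edges A"
    with that obtain i j where "e = {i, j}" "i < n" "j < n"
      by (fastforce simp: simple_graph_def card_2_iff)
    with e that show "e \<in> edges B" by blast
  qed
  have "edges G = edges H"
    using sub[of G H] sub[of H G] bits V \<open>n = m\<close> assms by (auto simp: nat_graph_def)
  with V \<open>n = m\<close> \<open>binary k = binary l\<close> show ?thesis
    by (auto intro: prod_eqI binary_inject)
qed

end

theory Submission imports Defs begin

text \<open>
  For membership in NP, a certificate lists the vertex set together with two rankings of the vertices:
  a graph is a forest iff some ranking gives every vertex at most one neighbour of no larger rank,
  and it is connected iff some ranking gives every vertex except a root a neighbour of smaller rank.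
  Cycles of constant length are found by exhaustive search.

  For hardness, the tableau of a verifier becomes a constraint system whose variables are the cells at
  all times. Choosing values for the variables is a hitting set problem. In a graph with one vertex for
  each element and each clause, paths between clauses and their elements, and a root joined to all
  elements, private cycles force the clause vertices and the root into every connected feedback vertex
  set. Since connectedness requires that each clause be joined to the root through one of its elements,
  the minimum size is reached exactly by hitting sets. Making the paths and private cycles long makes
  the girth large.

  Both directions need Turing machines. Programs on stacks are simulated directly by tapes, and
  expressions built from addition, truncated subtraction, bounded sums and access to the input are
  compiled to such programs. All numbers are in unary, so every expression is evaluated in polynomial
  time, and closure under bounded quantifiers makes the remaining predicates immediate.
\<close>

section \<open>Stack programs on Turing machines\<close>

text \<open>Evaluating in unary takes at least as many steps as the value computed, so every
  intermediate value must stay polynomial in the input length. But \<open>k\<close> is encoded in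
  binary, so neither \<open>budget\<close> nor \<open>2 ^ i\<close> may be evaluated as such: a
  power of two is only recognised among numbers below an available bound, and a set size is compared
  with \<open>budget\<close> through the bits whose weights are below that size. Lists of constant
  length (views of a configuration, short cycles) are quantified over as the digits of one number
  below a power with constant exponent. A clause of a hitting set problem can only say that some
  variable takes one of certain values. The implication from a view to the next content thus becomes
  one clause for each possible view: some cell differs from that view, or the next content is the
  right one. Since contents are relative to the head, a view has a constant number of cells. The
  bound \<open>Suc C + C * m + b\<close> on the feedback vertex set counts the root and the
  \<open>C\<close> clause vertices, one path of \<open>m\<close> vertices for each clause, and
  \<open>b\<close> elements.\<close>

text \<open>
  A tape serves as a stack whose top is the scanned cell. Pushing takes two machine steps: the head moves
  left, and \<open>Put\<close> then overwrites whatever it finds there. Between these steps the tape does not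
  represent a stack, so \<open>Put\<close> has no execution rule of its own. The states of the machine are
  the lists of commands that remain to be executed.
\<close>

datatype cmd = Push nat nat | Put nat nat | Pop nat | Skip | Seq cmd cmd (infixr ";;" 60)
  | Cond nat nat cmd cmd | While nat cmd

type_synonym stacks = "nat \<Rightarrow> nat list"

definition top_symbol :: "nat list \<Rightarrow> nat" where
  "top_symbol xs = (if xs = [] then blank else hd xs)"

inductive exec :: "cmd \<Rightarrow> stacks \<Rightarrow> nat \<Rightarrow> stacks \<Rightarrow> bool" where
  exec_Push: "exec (Push r v) s 2 (s(r := v # s r))"
| exec_Pop: "exec (Pop r) s 1 (s(r := tl (s r)))"
| exec_Skip: "exec Skip s 1 s"
| exec_Seq: "exec a s t s' \<Longrightarrow> exec b s' t' s'' \<Longrightarrow> exec (a ;; b) s (Suc (t + t')) s''"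
| exec_Cond: "exec (if top_symbol (s r) = v then a else b) s t s' \<Longrightarrow> exec (Cond r v a b) s (Suc t) s'"
| exec_While_end: "s r = [] \<Longrightarrow> exec (While r c) s 1 s"
| exec_While_step: "s r \<noteq> [] \<Longrightarrow> exec c s t s' \<Longrightarrow> exec (While r c) s' t' s'' \<Longrightarrow>
    exec (While r c) s (Suc (t + t')) s''"

fun next_control :: "nat list \<Rightarrow> cmd list \<Rightarrow> cmd list" where
  "next_control ss [] = []"
| "next_control ss (Push r v # K) = Put r v # K"
| "next_control ss (Put r v # K) = K"
| "next_control ss (Pop r # K) = K"
| "next_control ss (Skip # K) = K"
| "next_control ss ((a ;; b) # K) = a # b # K"
| "next_control ss (Cond r v a b # K) = (if ss ! r = v then a else b) # K"
| "next_control ss (While r c # K) = (if ss ! r \<noteq> blank then c # While r c # K else K)"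

fun tape_action :: "nat list \<Rightarrow> cmd list \<Rightarrow> nat \<Rightarrow> nat \<times> direction" where
  "tape_action ss (Push r v # K) i = (ss ! i, if i = r then Left else Stay)"
| "tape_action ss (Put r v # K) i = (if i = r then v else ss ! i, Stay)"
| "tape_action ss (Pop r # K) i = (ss ! i, if i = r then Right else Stay)"
| "tape_action ss _ i = (ss ! i, Stay)"

text \<open>Contains the states met while \<open>c\<close> is executed with \<open>K\<close> still
  to come. A loop returns to its own first state, so this set depends on the syntax only and is
  finite. \<open>K\<close> itself is left out: it belongs to whatever follows.\<close>

fun control_states :: "cmd \<Rightarrow> cmd list \<Rightarrow> cmd list set" where
  "control_states (Push r v) K = {Push r v # K, Put r v # K}"
| "control_states (Put r v) K = {Put r v # K}"
| "control_states (Pop r) K = {Pop r # K}"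
| "control_states Skip K = {Skip # K}"
| "control_states (a ;; b) K = {(a ;; b) # K} \<union> control_states a (b # K) \<union> control_states b K"
| "control_states (Cond r v a b) K = {Cond r v a b # K} \<union> control_states a K \<union> control_states b K"
| "control_states (While r c) K = {While r c # K} \<union> control_states c (While r c # K)"

lemma finite_control_states: "finite (control_states c K)"
  by (induction c K rule: control_states.induct) auto

lemma start_in_control_states: "c # K \<in> control_states c K"
  by (cases c) auto

lemma next_control_closed:
  "S \<in> control_states c K \<Longrightarrow> next_control ss S \<in> insert K (control_states c K)"
proof (induction c arbitrary: K)
  case (Seq a b)
  then show ?case using start_in_control_states[of a "b # K"] start_in_control_states[of b K]
    by fastforce
next
  case (Cond r v a b)
  from Cond.prems consider "S = Cond r v a b # K" | "S \<in> control_states a K" | "S \<in> control_states b K"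
    by auto
  then show ?case using start_in_control_states[of a K] start_in_control_states[of b K]
    Cond.IH(1)[of K] Cond.IH(2)[of K] by cases auto
next
  case (While r c)
  from While.prems consider "S = While r c # K" | "S \<in> control_states c (While r c # K)" by auto
  then show ?case using start_in_control_states[of c "While r c # K"]
    While.IH[of "While r c # K"] by cases auto
qed auto

fun symbols_ok :: "cmd \<Rightarrow> bool" where
  "symbols_ok (Push r v) \<longleftrightarrow> v \<in> {1, 2}"
| "symbols_ok (Put r v) \<longleftrightarrow> v \<in> {1, 2}"
| "symbols_ok (a ;; b) \<longleftrightarrow> symbols_ok a \<and> symbols_ok b"
| "symbols_ok (Cond r v a b) \<longleftrightarrow> symbols_ok a \<and> symbols_ok b"
| "symbols_ok (While r c) \<longleftrightarrow> symbols_ok c"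
| "symbols_ok _ \<longleftrightarrow> True"

fun max_reg :: "cmd \<Rightarrow> nat" where
  "max_reg (Push r v) = r"
| "max_reg (Put r v) = r"
| "max_reg (Pop r) = r"
| "max_reg Skip = 0"
| "max_reg (a ;; b) = max (max_reg a) (max_reg b)"
| "max_reg (Cond r v a b) = max r (max (max_reg a) (max_reg b))"
| "max_reg (While r c) = max r (max_reg c)"

fun right_part :: "tape \<Rightarrow> nat list" where
  "right_part (l, c, r) = c # r"

text \<open>Nothing is required of the cells to the left of the head, because pushing overwrites the
  cell it moves onto. Trailing blanks arise when the last symbol, or an empty stack, is popped.
  Stacks contain no blank, so emptiness can be seen from the scanned cell.\<close>

definition represents :: "nat \<Rightarrow> tape list \<Rightarrow> stacks \<Rightarrow> bool" where
  "represents m ts s \<longleftrightarrow> length ts = m \<and>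
     (\<forall>r<m. blank \<notin> set (s r) \<and> (\<exists>n. right_part (ts ! r) = s r @ replicate n blank))"

lemma write_scanned [simp]: "write_symbol (scanned t) t = t"
  by (cases t) auto

lemma scanned_top:
  assumes "represents m ts s" "r < m"
  shows "scanned (ts ! r) = top_symbol (s r)" "top_symbol (s r) = blank \<longleftrightarrow> s r = []"
proof -
  obtain n where n: "right_part (ts ! r) = s r @ replicate n blank" and b: "blank \<notin> set (s r)"
    using assms unfolding represents_def by blast
  obtain l c r' where t: "ts ! r = (l, c, r')" by (cases "ts ! r") auto
  show "scanned (ts ! r) = top_symbol (s r)" using n t by (cases "s r"; cases n) (auto simp: top_symbol_def)
  show "top_symbol (s r) = blank \<longleftrightarrow> s r = []" using b by (cases "s r") (auto simp: top_symbol_def)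
qed

lemma right_part_pop:
  assumes "right_part t = xs @ replicate n blank"
  shows "\<exists>n. right_part (move_head Right t) = tl xs @ replicate n blank"
proof -
  obtain l c r where t: "t = (l, c, r)" by (cases t) auto
  show ?thesis
  proof (cases xs)
    case Nil
    with assms t have "r = replicate (n - 1) blank" by (cases n) auto
    then show ?thesis using t Nil
      by (cases "n - 1") (auto intro: exI[of _ "Suc 0"] exI[of _ "Suc _"])
  next
    case (Cons x ys)
    with assms t have r: "r = ys @ replicate n blank" by auto
    show ?thesis
    proof (cases r)
      case Nil
      then show ?thesis using r t Cons by (auto intro: exI[of _ "Suc 0"])
    next
      case (Cons y zs)
      then show ?thesis using r t \<open>xs = x # ys\<close> by (intro exI[of _ n]) simp
    qed
  qed
qed

lemma right_part_left: "\<exists>y. right_part (move_head Left t) = y # right_part t"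
proof -
  obtain l c r where t: "t = (l, c, r)" by (cases t) auto
  then show ?thesis by (cases l) auto
qed

lemma right_part_write: "right_part (write_symbol v t) = v # tl (right_part t)"
  by (cases t) auto

definition stack_tm :: "nat \<Rightarrow> (cmd list \<Rightarrow> nat) \<Rightarrow> cmd \<Rightarrow> tm" where
  "stack_tm m enc c =
     (let Q = insert [] (control_states c []) in
      \<lparr>num_tapes = m, num_symbols = 3, num_states = card Q,
       start_state = enc [c], halt_state = enc [],
       transition = \<lambda>q ss. (let S = inv_into Q enc q in
         (enc (next_control ss S), map (tape_action ss S) [0..<m]))\<rparr>)"

locale stack_machine =
  fixes m :: nat and enc :: "cmd list \<Rightarrow> nat" and c0 :: cmd
  assumes enc: "bij_betw enc (insert [] (control_states c0 [])) {0..<card (insert [] (control_states c0 []))}"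
    and regs: "max_reg c0 < m" and syms: "symbols_ok c0"
begin

definition "Q = insert [] (control_states c0 [])"
definition "M = stack_tm m enc c0"

lemma inj: "inj_on enc Q" using enc by (auto simp: bij_betw_def Q_def)

lemma Q_closed: "S \<in> Q \<Longrightarrow> next_control ss S \<in> Q"
  using next_control_closed[of S c0 "[]" ss] by (auto simp: Q_def)

lemma Q_syms: "S \<in> control_states c K \<Longrightarrow> symbols_ok c \<Longrightarrow> (\<forall>d\<in>set K. symbols_ok d) \<Longrightarrow>
   d \<in> set S \<Longrightarrow> symbols_ok d"
proof (induction c arbitrary: K)
  case (Seq a b) then show ?case
    by (metis (no_types, lifting) UnE control_states.simps(5) set_ConsD singletonD symbols_ok.simps(3))
next
  case (Cond r v a b) then show ?case
    by (metis (no_types, lifting) UnE control_states.simps(6) set_ConsD singletonD symbols_ok.simps(4))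
next
  case (While r c) then show ?case
    by (metis (no_types, lifting) UnE control_states.simps(7) set_ConsD singletonD symbols_ok.simps(5))
qed auto

lemma wf: "wf_tm M"
proof -
  have encQ: "S \<in> Q \<Longrightarrow> enc S < card Q" for S
    using enc by (auto simp: bij_betw_def Q_def)
  have inQ: "q < card Q \<Longrightarrow> inv_into Q enc q \<in> Q" for q
    using enc inv_into_into[of q enc Q] by (auto simp: bij_betw_def Q_def)
  have sy: "fst (tape_action ss S i) < 3"
    if "S \<in> Q" "i < m" "length ss = m" "set ss \<subseteq> {..<3}" for S ss i
  proof -
    have "ss ! i < 3" using that nth_mem[of i ss] by blast
    moreover have "\<forall>d\<in>set S. symbols_ok d"
      using Q_syms[of S c0 "[]"] that syms by (auto simp: Q_def)
    ultimately show ?thesis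
      by (induction ss S i rule: tape_action.induct) auto
  qed
  have "[c0] \<in> Q" "[] \<in> Q" using start_in_control_states by (auto simp: Q_def)
  then show ?thesis using regs encQ inQ sy Q_closed
    unfolding wf_tm_def M_def stack_tm_def Let_def Q_def[symmetric]
    by (auto simp: case_prod_beta)
qed

lemma step_M:
  assumes "S \<in> Q" "S \<noteq> []" "length ts = m"
  shows "step M (enc S, ts) = (enc (next_control (map scanned ts) S),
    map (\<lambda>i. case tape_action (map scanned ts) S i of (s, d) \<Rightarrow> move_head d (write_symbol s (ts ! i))) [0..<m])"
proof -
  have ne: "enc S \<noteq> enc []" using assms inj by (auto simp: inj_on_def Q_def)
  have inv: "inv_into Q enc (enc S) = S" using inj assms by simp
  have "map2 (\<lambda>(s, d) t. move_head d (write_symbol s t)) (map (tape_action (map scanned ts) S) [0..<m]) ts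
    = map (\<lambda>i. case tape_action (map scanned ts) S i of (s, d) \<Rightarrow> move_head d (write_symbol s (ts ! i))) [0..<m]"
    using assms by (intro nth_equalityI) (auto split: prod.splits)
  then show ?thesis using ne inv
    unfolding step_def M_def stack_tm_def Let_def Q_def[symmetric] by simp
qed

lemma step_control:
  assumes "S \<in> Q" "S \<noteq> []" "length ts = m"
    and "\<And>i. tape_action (map scanned ts) S i = (map scanned ts ! i, Stay)"
  shows "step M (enc S, ts) = (enc (next_control (map scanned ts) S), ts)"
  using step_M[OF assms(1-3)] assms(3,4) by (auto intro!: nth_equalityI)

text \<open>Each execution rule charges exactly the machine steps of its control transitions, so no
  slack in the time is needed. That \<open>K\<close> is again a state lets the induction go on with
  the next command of a sequence.\<close>

lemma exec_simulation:
  assumes "exec c s t s'" "c # K \<in> Q" "max_reg c < m" "symbols_ok c" "represents m ts s"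
  shows "\<exists>ts'. represents m ts' s' \<and> K \<in> Q \<and> (step M ^^ t) (enc (c # K), ts) = (enc K, ts')"
  using assms
proof (induction arbitrary: K ts rule: exec.induct)
  case (exec_Push r v s)
  let ?ts1 = "map (\<lambda>i. move_head (if i = r then Left else Stay) (ts ! i)) [0..<m]"
  let ?ts2 = "map (\<lambda>i. if i = r then write_symbol v (?ts1 ! i) else ?ts1 ! i) [0..<m]"
  have len: "length ts = m" "r < m" using exec_Push by (auto simp: represents_def)
  have Q1: "Put r v # K \<in> Q" using Q_closed[of "Push r v # K" "[]"] exec_Push by simp
  have Q2: "K \<in> Q" using Q_closed[of "Put r v # K" "[]"] Q1 by simp
  have 1: "step M (enc (Push r v # K), ts) = (enc (Put r v # K), ?ts1)"
    using step_M[of "Push r v # K" ts] exec_Push.prems(1) len by (auto intro!: map_cong)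
  have 2: "step M (enc (Put r v # K), ?ts1) = (enc K, ?ts2)"
    by (subst step_M[OF Q1]) (auto intro!: map_cong)
  have "represents m ?ts2 (s(r := v # s r))"
    unfolding represents_def
  proof (intro conjI allI impI)
    fix i assume i: "i < m"
    obtain n where n: "blank \<notin> set (s i)" "right_part (ts ! i) = s i @ replicate n blank"
      using exec_Push.prems(4) i unfolding represents_def by blast
    show "blank \<notin> set ((s(r := v # s r)) i)" using n exec_Push.prems by auto
    show "\<exists>n. right_part (?ts2 ! i) = (s(r := v # s r)) i @ replicate n blank"
      using i n right_part_left[of "ts ! i"] by (auto simp: right_part_write)
  qed simp
  moreover have "(step M ^^ 2) (enc (Push r v # K), ts) = (enc K, ?ts2)"
    by (simp add: numeral_2_eq_2 1 2 del: map_eq_conv)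
  ultimately show ?case using Q2 by blast
next
  case (exec_Pop r s)
  let ?ts1 = "map (\<lambda>i. move_head (if i = r then Right else Stay) (ts ! i)) [0..<m]"
  have len: "length ts = m" "r < m" using exec_Pop by (auto simp: represents_def)
  have Q1: "K \<in> Q" using Q_closed[of "Pop r # K" "[]"] exec_Pop by simp
  have 1: "step M (enc (Pop r # K), ts) = (enc K, ?ts1)"
    using step_M[of "Pop r # K" ts] exec_Pop.prems(1) len by (auto intro!: map_cong)
  have "represents m ?ts1 (s(r := tl (s r)))"
    unfolding represents_def
  proof (intro conjI allI impI)
    fix i assume i: "i < m"
    obtain n where n: "blank \<notin> set (s i)" "right_part (ts ! i) = s i @ replicate n blank"
      using exec_Pop.prems(4) i unfolding represents_def by blast
    show "blank \<notin> set ((s(r := tl (s r))) i)" using n by (cases "s r") auto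
    show "\<exists>n. right_part (?ts1 ! i) = (s(r := tl (s r))) i @ replicate n blank"
      using i n right_part_pop[OF n(2)] by auto
  qed simp
  moreover have "(step M ^^ 1) (enc (Pop r # K), ts) = (enc K, ?ts1)" using 1 by simp
  ultimately show ?case using Q1 by blast
next
  case (exec_Skip s)
  have Q1: "K \<in> Q" using Q_closed[of "Skip # K" "[]"] exec_Skip by simp
  have "length ts = m" using exec_Skip by (auto simp: represents_def)
  then have "step M (enc (Skip # K), ts) = (enc K, ts)"
    using step_control[of "Skip # K" ts] exec_Skip.prems(1) by simp
  then show ?case using Q1 exec_Skip by auto
next
  case (exec_Seq a s t s' b t' s'')
  have Q1: "a # b # K \<in> Q" using Q_closed[of "(a ;; b) # K" "[]"] exec_Seq by simp
  have "length ts = m" using exec_Seq by (auto simp: represents_def)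
  then have 1: "step M (enc ((a ;; b) # K), ts) = (enc (a # b # K), ts)"
    using step_control[of "(a ;; b) # K" ts] exec_Seq.prems(1) by simp
  obtain ts1 where 2: "represents m ts1 s'" "b # K \<in> Q" "(step M ^^ t) (enc (a # b # K), ts) = (enc (b # K), ts1)"
    using exec_Seq.IH(1)[OF Q1] exec_Seq.prems by auto
  obtain ts2 where 3: "represents m ts2 s''" "K \<in> Q" "(step M ^^ t') (enc (b # K), ts1) = (enc K, ts2)"
    using exec_Seq.IH(2)[OF 2(2) _ _ 2(1)] exec_Seq.prems by auto
  have "(step M ^^ (t + t')) (enc (a # b # K), ts) = (enc K, ts2)"
    using 2 3 by (subst add.commute) (simp add: funpow_add)
  then show ?case using 3 1 by (auto simp: funpow_Suc_right simp del: funpow.simps)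
next
  case (exec_Cond s r v a b t s')
  let ?c = "if top_symbol (s r) = v then a else b"
  have len: "length ts = m" "r < m" using exec_Cond.prems by (auto simp: represents_def)
  have sc: "map scanned ts ! r = top_symbol (s r)" using scanned_top(1)[OF exec_Cond.prems(4) len(2)] len by simp
  have Q1: "?c # K \<in> Q"
    using Q_closed[of "Cond r v a b # K" "map scanned ts"] exec_Cond.prems(1) by (simp only: next_control.simps sc)
  have 1: "step M (enc (Cond r v a b # K), ts) = (enc (?c # K), ts)"
    using step_control[of "Cond r v a b # K" ts] exec_Cond.prems(1) len sc by simp
  have "max_reg ?c < m" "symbols_ok ?c" using exec_Cond.prems by auto
  from exec_Cond.IH[OF Q1 this exec_Cond.prems(4)] show ?case
    using 1 by (auto simp: funpow_Suc_right simp del: funpow.simps)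
next
  case (exec_While_end s r c)
  have len: "length ts = m" "r < m" using exec_While_end by (auto simp: represents_def)
  have sc: "map scanned ts ! r = blank"
    using scanned_top[OF exec_While_end.prems(4) len(2)] exec_While_end.hyps len by simp
  have Q1: "K \<in> Q" using Q_closed[of "While r c # K" "map scanned ts"] exec_While_end.prems(1) sc by simp
  have 1: "step M (enc (While r c # K), ts) = (enc K, ts)"
    using step_control[of "While r c # K" ts] exec_While_end.prems(1) len sc by simp
  then show ?case using Q1 exec_While_end by auto
next
  case (exec_While_step s r c t s' t' s'')
  have len: "length ts = m" "r < m" using exec_While_step by (auto simp: represents_def)
  have sc: "map scanned ts ! r \<noteq> blank"
    using scanned_top[OF exec_While_step.prems(4) len(2)] exec_While_step.hyps len by simp
  have Q1: "c # While r c # K \<in> Q"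
    using Q_closed[of "While r c # K" "map scanned ts"] exec_While_step.prems(1) sc by simp
  have 1: "step M (enc (While r c # K), ts) = (enc (c # While r c # K), ts)"
    using step_control[of "While r c # K" ts] exec_While_step.prems(1) len sc by simp
  obtain ts1 where 2: "represents m ts1 s'" "While r c # K \<in> Q"
    "(step M ^^ t) (enc (c # While r c # K), ts) = (enc (While r c # K), ts1)"
    using exec_While_step.IH(1)[OF Q1] exec_While_step.prems by auto
  obtain ts2 where 3: "represents m ts2 s''" "K \<in> Q" "(step M ^^ t') (enc (While r c # K), ts1) = (enc K, ts2)"
    using exec_While_step.IH(2)[OF 2(2) _ _ 2(1)] exec_While_step.prems by auto
  have "(step M ^^ (t + t')) (enc (c # While r c # K), ts) = (enc K, ts2)"
    using 2 3 by (subst add.commute) (simp add: funpow_add)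
  then show ?case using 3 1 by (auto simp: funpow_Suc_right simp del: funpow.simps)
qed

end

definition input_stacks :: "bool list list \<Rightarrow> stacks" where
  "input_stacks ws r = (if r < length ws then map bit_symbol (ws ! r) else [])"

lemma represents_initial:
  assumes "length ws \<le> m"
  shows "represents m (map input_tape ws @ replicate (m - length ws) (input_tape [])) (input_stacks ws)"
proof -

  have inp: "\<exists>n. right_part (input_tape w) = map bit_symbol w @ replicate n blank" for w
    by (cases w) (auto intro: exI[of _ "Suc 0"] exI[of _ 0])
  show ?thesis unfolding represents_def
  proof (intro conjI allI impI)
    fix r assume "r < m"
    show "blank \<notin> set (input_stacks ws r)" by (auto simp: input_stacks_def bit_symbol_def split: if_splits)
    show "\<exists>n. right_part ((map input_tape ws @ replicate (m - length ws) (input_tape [])) ! r)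
      = input_stacks ws r @ replicate n blank"
      using \<open>r < m\<close> inp[of "[]"] inp[of "ws ! r"] by (auto simp: input_stacks_def nth_append)
  qed (use assms in simp)
qed

lemma step_halted: "q = halt_state M \<Longrightarrow> (step M ^^ n) (q, ts) = (q, ts)"
  by (induction n) (auto simp: step_def)

text \<open>The output is read from the last tape, hence the result must be in the register with the
  largest number. A run that ends before the time bound stays in its halting configuration.\<close>

lemma poly_time_computable_exec:
  assumes "symbols_ok c" "max_reg c = d" "k \<le> d"
    and run: "\<And>ws. length ws = k \<Longrightarrow> \<exists>t \<le> poly p (sum_list (map length ws)). \<exists>s.
      exec c (input_stacks ws) t s \<and> s d = map bit_symbol (f ws)"
  shows "poly_time_computable k f"
proof -
  let ?Q = "insert [] (control_states c [])"
  have "finite ?Q" using finite_control_states by auto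
  then obtain enc where "bij_betw enc ?Q {0..<card ?Q}" using ex_bij_betw_finite_nat by blast
  then interpret stack_machine "Suc d" enc c using assms by unfold_locales auto
  have "outputs_within M (poly p (sum_list (map length ws))) ws (f ws)" if len: "length ws = k" for ws
  proof -
    obtain t s where t: "t \<le> poly p (sum_list (map length ws))" "exec c (input_stacks ws) t s"
      "s d = map bit_symbol (f ws)" using run[OF len] by blast
    let ?ts = "map input_tape ws @ replicate (Suc d - length ws) (input_tape [])"
    have "represents (Suc d) ?ts (input_stacks ws)" using represents_initial[of ws "Suc d"] assms len by simp
    then obtain ts' where ts': "represents (Suc d) ts' s" "(step M ^^ t) (enc [c], ?ts) = (enc [], ts')"
      using exec_simulation[OF t(2), of "[]" ?ts] assms start_in_control_states[of c "[]"] by (auto simp: Q_def)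
    have ini: "initial_config M ws = (enc [c], ?ts)"
      by (simp add: initial_config_def M_def stack_tm_def Let_def)
    have h: "halt_state M = enc []" by (simp add: M_def stack_tm_def Let_def)
    have "(step M ^^ (poly p (sum_list (map length ws)))) (initial_config M ws) = (enc [], ts')"
    proof -
      obtain n where "poly p (sum_list (map length ws)) = n + t" using t(1) by (metis le_add_diff_inverse2)
      then show ?thesis using ts' step_halted[of "enc []" M n] h ini by (simp add: funpow_add)
    qed
    moreover have "tape_word (last ts') = map bit_symbol (f ws)"
    proof -
      obtain n where n: "right_part (ts' ! d) = s d @ replicate n blank" "blank \<notin> set (s d)" "length ts' = Suc d"
        using ts'(1) unfolding represents_def by blast
      have "last ts' = ts' ! d" using n(3) by (metis diff_Suc_1 last_conv_nth list.size(3) nat.distinct(1))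
      moreover have "tape_word t = takeWhile (\<lambda>s. s \<noteq> blank) (right_part t)" for t by (cases t) auto
      moreover have "takeWhile (\<lambda>s. s \<noteq> blank) (s d @ replicate n blank) = s d"
        using n(2) by (subst takeWhile_append2) (auto simp: takeWhile_replicate intro!: gr0I)
      ultimately show ?thesis using n t(3) by metis
    qed
    ultimately show ?thesis using h by (simp add: outputs_within_def)
  qed
  moreover have "k \<le> num_tapes M" using assms by (simp add: M_def stack_tm_def Let_def)
  ultimately show ?thesis using wf unfolding poly_time_computable_def by blast
qed

section \<open>Polynomial time for unary arithmetic\<close>

definition runs :: "cmd \<Rightarrow> stacks \<Rightarrow> nat \<Rightarrow> stacks \<Rightarrow> bool" where
  "runs c s B s' \<longleftrightarrow> (\<exists>t\<le>B. exec c s t s')"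

lemma runs_mono: "runs c s B s' \<Longrightarrow> B \<le> B' \<Longrightarrow> runs c s B' s'"
  unfolding runs_def using le_trans by blast

lemma runs_Push: "2 \<le> B \<Longrightarrow> s(r := v # s r) = s' \<Longrightarrow> runs (Push r v) s B s'"
  using exec_Push[of r v s] unfolding runs_def by (intro exI[of _ 2]) simp

lemma runs_Pop: "1 \<le> B \<Longrightarrow> s(r := tl (s r)) = s' \<Longrightarrow> runs (Pop r) s B s'"
  using exec_Pop[of r s] unfolding runs_def by (intro exI[of _ 1]) simp

lemma runs_Skip: "1 \<le> B \<Longrightarrow> s = s' \<Longrightarrow> runs Skip s B s'"
  using exec_Skip[of s] unfolding runs_def by (intro exI[of _ 1]) simp

lemma runs_Seq: "runs a s A s' \<Longrightarrow> runs b s' B s'' \<Longrightarrow> A + B < C \<Longrightarrow> runs (a ;; b) s C s''"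
proof -
  assume r: "runs a s A s'" "runs b s' B s''" "A + B < C"
  obtain t where t: "t \<le> A" "exec a s t s'" using r(1) unfolding runs_def by blast
  obtain t' where t': "t' \<le> B" "exec b s' t' s''" using r(2) unfolding runs_def by blast
  have "exec (a ;; b) s (Suc (t + t')) s''" using t(2) t'(2) by (rule exec_Seq)
  moreover have "Suc (t + t') \<le> C" using t(1) t'(1) r(3) by simp
  ultimately show "runs (a ;; b) s C s''" unfolding runs_def by blast
qed

lemma runs_Cond:
  assumes "top_symbol (s r) = v \<Longrightarrow> runs a s B s'" "top_symbol (s r) \<noteq> v \<Longrightarrow> runs b s B s'"
  shows "runs (Cond r v a b) s (Suc B) s'"
proof -
  have "runs (if top_symbol (s r) = v then a else b) s B s'" using assms by simp
  then obtain t where "t \<le> B" "exec (if top_symbol (s r) = v then a else b) s t s'" unfolding runs_def by blast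
  then show ?thesis unfolding runs_def using exec_Cond[of s r v a b t s'] by (intro exI[of _ "Suc t"]) simp
qed

text \<open>The invariant is an explicit sequence \<open>f\<close> of stack contents, one for each
  number of completed rounds; the induction is on the number of rounds still to come.\<close>

lemma runs_While:
  assumes "\<And>i. i < n \<Longrightarrow> f i r \<noteq> []" "\<And>i. i < n \<Longrightarrow> runs c (f i) B (f (Suc i))" "f n r = []"
    and "f 0 = s" "f n = s'" "n * Suc B < C"
  shows "runs (While r c) s C s'"
proof -
  have "runs (While r c) (f (n - j)) (Suc (j * Suc B)) (f n)" if "j \<le> n" for j
    using that
  proof (induction j)
    case 0
    then show ?case using assms(3) exec_While_end[of "f n" r c] unfolding runs_def by (intro exI[of _ 1]) simp
  next
    case (Suc j)
    have eq: "Suc (n - Suc j) = n - j" using Suc by simp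
    obtain t where t: "t \<le> Suc (j * Suc B)" "exec (While r c) (f (n - j)) t (f n)"
      using Suc unfolding runs_def by auto
    obtain t' where t': "t' \<le> B" "exec c (f (n - Suc j)) t' (f (n - j))"
      using assms(2)[of "n - Suc j"] Suc.prems unfolding runs_def eq by auto
    have "exec (While r c) (f (n - Suc j)) (Suc (t' + t)) (f n)"
      using exec_While_step[of "f (n - Suc j)" r c t' "f (n - j)" t "f n"] t(2) t'(2) assms(1)[of "n - Suc j"] Suc.prems by auto
    moreover have "Suc (t' + t) \<le> Suc (Suc j * Suc B)" using t(1) t'(1) by simp
    ultimately show ?case unfolding runs_def by blast
  qed
  from this[of n] show ?thesis using assms(4-6) by (auto elim: runs_mono)
qed

section \<open>Moving unary numbers and words between stacks\<close>

abbreviation unary :: "nat \<Rightarrow> nat list" where "unary n \<equiv> replicate n 1"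

definition clear :: "nat \<Rightarrow> cmd" where "clear a = While a (Pop a)"

definition drain :: "nat \<Rightarrow> nat \<Rightarrow> cmd" where "drain a b = While a (Pop a ;; Push b 1)"

text \<open>Moving symbol by symbol reverses the word, so transfers that must preserve the order
  come in pairs.\<close>

definition transfer :: "nat \<Rightarrow> nat \<Rightarrow> cmd" where
  "transfer a b = While a (Cond a 2 (Pop a ;; Push b 2) (Pop a ;; Push b 1))"

lemma tl_unary: "tl (replicate (x - i) v) = replicate (x - Suc i) v"
  by (simp add: tl_replicate)

lemma runs_clear:
  assumes "s a = unary x" "2 * x < C" shows "runs (clear a) s C (s(a := []))"
  unfolding clear_def
proof (rule runs_While[where f = "\<lambda>i. s(a := unary (x - i))" and n = x and B = 1], goal_cases)
  case (2 i)
  then show ?case by (intro runs_Pop) (simp_all only: fun_upd_same fun_upd_upd tl_unary)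
qed (use assms in auto)

lemma runs_drain:
  assumes "s a = unary x" "a \<noteq> b" "5 * x < C" "s(a := [], b := unary x @ s b) = s'"
  shows "runs (drain a b) s C s'"
  unfolding drain_def
proof (rule runs_While[where f = "\<lambda>i. s(a := unary (x - i), b := unary i @ s b)" and n = x and B = 4], goal_cases)
  case (2 i)
  show ?case
    by (rule runs_Seq[OF runs_Pop[OF order_refl refl] runs_Push[OF order_refl]])
      (use assms(2) in \<open>auto simp: fun_eq_iff tl_unary simp del: tl_replicate\<close>)
qed (use assms in auto)

lemma bit_symbol_simps [simp]: "bit_symbol True = 2" "bit_symbol False = 1"
  by (auto simp: bit_symbol_def)

lemma bit_symbol_eq_2: "bit_symbol b = 2 \<longleftrightarrow> b"
  by (auto simp: bit_symbol_def)

lemma runs_pop_push: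
  assumes "s a = v # ys" "a \<noteq> b" "4 \<le> C" "s(a := ys, b := v # s b) = s'"
  shows "runs (Pop a ;; Push b v) s C s'"
  by (rule runs_Seq[OF runs_Pop[OF order_refl refl] runs_Push[OF order_refl]])
    (use assms in auto)

lemma runs_move_bit:
  assumes "s a = bit_symbol x # ys" "a \<noteq> b" "5 \<le> C" "s(a := ys, b := bit_symbol x # s b) = s'"
  shows "runs (Cond a 2 (Pop a ;; Push b 2) (Pop a ;; Push b 1)) s C s'"
proof -
  have "runs (Cond a 2 (Pop a ;; Push b 2) (Pop a ;; Push b 1)) s (Suc 4) s'"
  proof (rule runs_Cond)
    assume "top_symbol (s a) = 2"
    then show "runs (Pop a ;; Push b 2) s 4 s'"
      by (intro runs_pop_push[of s a 2 ys]) (use assms in \<open>auto simp: top_symbol_def\<close>)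
  next
    assume "top_symbol (s a) \<noteq> 2"
    then have "bit_symbol x = 1" using assms by (cases x) (auto simp: top_symbol_def)
    then show "runs (Pop a ;; Push b 1) s 4 s'"
      by (intro runs_pop_push[of s a 1 ys]) (use assms in \<open>auto simp: top_symbol_def\<close>)
  qed
  then show ?thesis using assms(3) by (auto elim: runs_mono)
qed

lemma runs_transfer:
  assumes "s a = map bit_symbol w" "a \<noteq> b" "6 * length w < C"
    "s(a := [], b := rev (map bit_symbol w) @ s b) = s'"
  shows "runs (transfer a b) s C s'"
  unfolding transfer_def
proof (rule runs_While[where n = "length w" and B = 5 and
    f = "\<lambda>i. s(a := map bit_symbol (drop i w), b := rev (map bit_symbol (take i w)) @ s b)"], goal_cases)
  case (2 i)
  then have d: "drop i w = w ! i # drop (Suc i) w" by (simp add: Cons_nth_drop_Suc)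
  show ?case
    by (rule runs_move_bit[where x = "w ! i" and ys = "map bit_symbol (drop (Suc i) w)"])
      (use assms 2 d in \<open>auto simp: fun_eq_iff take_Suc_conv_app_nth\<close>)
qed (use assms in auto)

text \<open>Every constructor keeps values polynomially bounded. Products, quotients and bounded
  quantifiers are all obtained from \<open>Sum\<close>, conditions from
  \<open>Monus\<close>.\<close>

datatype ex = Var nat | One | Plus ex ex | Monus ex ex | Sum nat ex ex | Bit nat ex | Len nat

primrec eval :: "bool list list \<Rightarrow> (nat \<Rightarrow> nat) \<Rightarrow> ex \<Rightarrow> nat" where
  "eval ws \<sigma> (Var x) = \<sigma> x"
| "eval ws \<sigma> One = 1"
| "eval ws \<sigma> (Plus a b) = eval ws \<sigma> a + eval ws \<sigma> b"
| "eval ws \<sigma> (Monus a b) = eval ws \<sigma> a - eval ws \<sigma> b"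
| "eval ws \<sigma> (Sum x n a) = (\<Sum>i<eval ws \<sigma> n. eval ws (\<sigma>(x := i)) a)"
| "eval ws \<sigma> (Bit j a) = of_bool (eval ws \<sigma> a < length (ws ! j) \<and> ws ! j ! eval ws \<sigma> a)"
| "eval ws \<sigma> (Len j) = length (ws ! j)"

primrec words_below :: "nat \<Rightarrow> ex \<Rightarrow> bool" where
  "words_below k (Var x) \<longleftrightarrow> True"
| "words_below k One \<longleftrightarrow> True"
| "words_below k (Plus a b) \<longleftrightarrow> words_below k a \<and> words_below k b"
| "words_below k (Monus a b) \<longleftrightarrow> words_below k a \<and> words_below k b"
| "words_below k (Sum x n a) \<longleftrightarrow> words_below k n \<and> words_below k a"
| "words_below k (Bit j a) \<longleftrightarrow> j < k \<and> words_below k a"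
| "words_below k (Len j) \<longleftrightarrow> j < k"

text \<open>
  \<open>compile e \<rho> b\<close> leaves the value of \<open>e\<close> in register \<open>b\<close> in unary; the variable \<open>x\<close> is read from
  register \<open>\<rho> x\<close>, and the registers from \<open>b\<close> on are scratch space.
\<close>

primrec compile :: "ex \<Rightarrow> (nat \<Rightarrow> nat) \<Rightarrow> nat \<Rightarrow> cmd" where
  "compile (Var x) \<rho> b = While (\<rho> x) (Pop (\<rho> x) ;; Push b 1 ;; Push (Suc b) 1) ;; drain (Suc b) (\<rho> x)"
| "compile One \<rho> b = Push b 1"
| "compile (Plus e1 e2) \<rho> b = compile e1 \<rho> b ;; compile e2 \<rho> (Suc b) ;; drain (Suc b) b"
| "compile (Monus e1 e2) \<rho> b = compile e1 \<rho> b ;; compile e2 \<rho> (Suc b) ;; While (Suc b) (Pop (Suc b) ;; Pop b)"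
| "compile (Sum x n e) \<rho> b = compile n \<rho> (Suc b) ;;
     While (Suc b) (Pop (Suc b) ;; compile e (\<rho>(x := b + 2)) (b + 3) ;; drain (b + 3) b ;; Push (b + 2) 1) ;;
     clear (b + 2)"
| "compile (Bit j e) \<rho> b = compile e \<rho> (Suc b) ;;
     While (Suc b) (Pop (Suc b) ;; Cond j 2 (Pop j ;; Push (b + 2) 2) (Cond j 1 (Pop j ;; Push (b + 2) 1) Skip)) ;;
     Cond j 2 (Push b 1) Skip ;; transfer (b + 2) j"
| "compile (Len j) \<rho> b =
     While j (Push b 1 ;; Cond j 2 (Pop j ;; Push (Suc b) 2) (Pop j ;; Push (Suc b) 1)) ;; transfer (Suc b) j"

text \<open>\<open>M\<close> bounds word lengths and variables alike, so one polynomial in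
  \<open>M\<close> also covers a body evaluated under a binder. The map \<open>\<rho>\<close> need
  not be injective: variables with equal values may share a register.\<close>

definition env_ok ::
  "nat \<Rightarrow> bool list list \<Rightarrow> (nat \<Rightarrow> nat) \<Rightarrow> (nat \<Rightarrow> nat) \<Rightarrow> nat \<Rightarrow> stacks \<Rightarrow> nat \<Rightarrow> bool" where
  "env_ok k ws \<sigma> \<rho> b s M \<longleftrightarrow> length ws = k \<and> k \<le> b \<and>
     (\<forall>j<k. s j = map bit_symbol (ws ! j) \<and> length (ws ! j) \<le> M) \<and>
     (\<forall>x. \<rho> x < b \<and> s (\<rho> x) = unary (\<sigma> x) \<and> \<sigma> x \<le> M) \<and>
     (\<forall>r\<ge>b. s r = [])"

definition compiled :: "nat \<Rightarrow> ex \<Rightarrow> nat poly \<Rightarrow> bool" where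
  "compiled k e p \<longleftrightarrow> (\<forall>ws \<sigma> \<rho> b s M. env_ok k ws \<sigma> \<rho> b s M \<longrightarrow>
     eval ws \<sigma> e \<le> poly p M \<and> runs (compile e \<rho> b) s (poly p M) (s(b := unary (eval ws \<sigma> e))))"

lemma poly_nat_mono: "x \<le> y \<Longrightarrow> poly p x \<le> poly p (y :: nat)"
  by (induction p) (auto intro!: add_mono mult_mono)

lemma env_ok_Suc:
  "env_ok k ws \<sigma> \<rho> b s M \<Longrightarrow> env_ok k ws \<sigma> \<rho> (Suc b) (s(b := xs)) M"
  by (auto simp: env_ok_def le_Suc_eq less_Suc_eq Suc_le_eq)

lemma env_ok_Suc_same:
  "env_ok k ws \<sigma> \<rho> b s M \<Longrightarrow> env_ok k ws \<sigma> \<rho> (Suc b) s M"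
  by (auto simp: env_ok_def intro: less_SucI)

lemma compiledI:
  assumes "\<And>ws \<sigma> \<rho> b s M. env_ok k ws \<sigma> \<rho> b s M \<Longrightarrow>
     eval ws \<sigma> e \<le> poly p M \<and> runs (compile e \<rho> b) s (poly p M) (s(b := unary (eval ws \<sigma> e)))"
  shows "\<exists>p. compiled k e p"
  using assms unfolding compiled_def by blast

text \<open>Reading a register empties it, so the value is copied to two registers and one copy is
  drained back.\<close>

lemma compiled_Var: "\<exists>p. compiled k (Var x) p"
proof (rule compiledI[where p = "[:3, 13:]"], goal_cases)
  case ok: (1 ws \<sigma> \<rho> b s M)
  let ?r = "\<rho> x" and ?n = "\<sigma> x"
  have r: "?r < b" "s ?r = unary ?n" "?n \<le> M" "s b = []" "s (Suc b) = []" using ok by (auto simp: env_ok_def)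
  let ?f = "\<lambda>i. s(?r := unary (?n - i), b := unary i, Suc b := unary i)"
  have "runs (While ?r (Pop ?r ;; Push b 1 ;; Push (Suc b) 1)) s (8 * ?n + 1) (?f ?n)"
  proof (rule runs_While[where f = ?f and n = ?n and B = 7], goal_cases)
    case (2 i)
    show ?case
      by (rule runs_Seq[OF runs_Pop[OF order_refl refl] runs_Seq[OF runs_Push[OF order_refl refl]
          runs_Push[OF order_refl] lessI]])
        (use r in \<open>auto simp: fun_eq_iff tl_unary simp del: tl_replicate\<close>)
  qed (use r in \<open>auto simp: fun_eq_iff\<close>)
  moreover have "runs (drain (Suc b) ?r) (?f ?n) (5 * ?n + 1) (s(b := unary ?n))"
    by (rule runs_drain[where x = ?n]) (use r in \<open>auto simp: fun_eq_iff\<close>)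
  ultimately have "runs (compile (Var x) \<rho> b) s (poly [:3, 13:] M) (s(b := unary ?n))"
    unfolding compile.simps by (rule runs_Seq) (use r in simp)
  then show ?case
    using r by simp
qed

lemma compiled_One: "\<exists>p. compiled k One p"
  by (rule compiledI[where p = "[:2:]"]) (auto simp: env_ok_def intro!: runs_Push)

lemma compiled_two:
  assumes "compiled k e1 p1" "compiled k e2 p2" "env_ok k ws \<sigma> \<rho> b s M"
  shows "runs (compile e1 \<rho> b) s (poly p1 M) (s(b := unary (eval ws \<sigma> e1)))"
    "runs (compile e2 \<rho> (Suc b)) (s(b := unary (eval ws \<sigma> e1))) (poly p2 M)
       (s(b := unary (eval ws \<sigma> e1), Suc b := unary (eval ws \<sigma> e2)))"
    "eval ws \<sigma> e1 \<le> poly p1 M" "eval ws \<sigma> e2 \<le> poly p2 M"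
  using assms env_ok_Suc[OF assms(3)] unfolding compiled_def by blast+

lemma compiled_Plus:
  assumes "compiled k e1 p1" "compiled k e2 p2"
  shows "\<exists>p. compiled k (Plus e1 e2) p"
proof (rule compiledI[where p = "p1 + 6 * p2 + [:3:]"], goal_cases)
  case ok: (1 ws \<sigma> \<rho> b s M)
  note c = compiled_two[OF assms ok]
  let ?v1 = "eval ws \<sigma> e1" and ?v2 = "eval ws \<sigma> e2"
  have sb: "s (Suc b) = []" using ok by (auto simp: env_ok_def)
  have "runs (drain (Suc b) b) (s(b := unary ?v1, Suc b := unary ?v2)) (5 * ?v2 + 1) (s(b := unary (?v1 + ?v2)))"
    by (rule runs_drain[where x = ?v2])
      (use sb in \<open>auto simp: fun_eq_iff replicate_add[symmetric] add.commute\<close>)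
  from runs_Seq[OF c(2) this lessI]
  show ?case
    using c(3,4) unfolding compile.simps eval.simps by (intro conjI runs_Seq[OF c(1)]) auto
qed

lemma compiled_Monus:
  assumes "compiled k e1 p1" "compiled k e2 p2"
  shows "\<exists>p. compiled k (Monus e1 e2) p"
proof (rule compiledI[where p = "p1 + 6 * p2 + [:3:]"], goal_cases)
  case ok: (1 ws \<sigma> \<rho> b s M)
  note c = compiled_two[OF assms ok]
  let ?v1 = "eval ws \<sigma> e1" and ?v2 = "eval ws \<sigma> e2"
  let ?f = "\<lambda>i. s(b := unary (?v1 - i), Suc b := unary (?v2 - i))"
  have sb: "s (Suc b) = []" using ok by (auto simp: env_ok_def)
  have "runs (While (Suc b) (Pop (Suc b) ;; Pop b)) (s(b := unary ?v1, Suc b := unary ?v2)) (5 * ?v2 + 1)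
     (s(b := unary (?v1 - ?v2)))"
  proof (rule runs_While[where f = ?f and n = ?v2 and B = 3], goal_cases)
    case (2 i)
    show ?case
      by (rule runs_Seq[OF runs_Pop[OF order_refl refl] runs_Pop[OF order_refl]])
        (auto simp: fun_eq_iff tl_unary simp del: tl_replicate)
  qed (use sb in \<open>auto simp: fun_eq_iff\<close>)
  from runs_Seq[OF c(2) this lessI]
  show ?case
    using c(3,4) unfolding compile.simps eval.simps by (intro conjI runs_Seq[OF c(1)]) auto
qed

text \<open>Register \<open>b\<close> accumulates the sum, \<open>Suc b\<close> counts the remaining
  rounds down, and \<open>b + 2\<close> counts up and serves as the bound variable.\<close>

lemma compiled_Sum:
  assumes "compiled k n pn" "compiled k e pe"
  shows "\<exists>p. compiled k (Sum x n e) p"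
proof -
  \<comment> \<open>The bound variable can be as large as \<open>poly pn M\<close>, so the body runs
    with \<open>M + poly pn M\<close> in place of \<open>M\<close>.\<close>
  define q where "q = pcompose pe ([:0, 1:] + pn)"
  let ?p = "4 * pn + pn * (6 * q + [:12:]) + [:10:]"
  show ?thesis
  proof (rule compiledI[where p = ?p], goal_cases)
    case ok: (1 ws \<sigma> \<rho> b s M)
    let ?n = "eval ws \<sigma> n" and ?e = "\<lambda>i. eval ws (\<sigma>(x := i)) e"
    let ?B = "poly q M"
    have z: "s b = []" "s (Suc b) = []" "s (b + 2) = []" "s (b + 3) = []"
      "s (Suc (Suc b)) = []" "s (Suc (Suc (Suc b))) = []" using ok by (auto simp: env_ok_def)
    have n: "?n \<le> poly pn M" "runs (compile n \<rho> (Suc b)) s (poly pn M) (s(Suc b := unary ?n))"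
      using assms(1) env_ok_Suc_same[OF ok] unfolding compiled_def by blast+
    let ?f = "\<lambda>i. s(b := unary (\<Sum>j<i. ?e j), Suc b := unary (?n - i), b + 2 := unary i)"
    have body: "?e i \<le> ?B \<and> runs (compile e (\<rho>(x := b + 2)) (b + 3)) ((?f i)(Suc b := unary (?n - Suc i))) ?B
       ((?f i)(Suc b := unary (?n - Suc i), b + 3 := unary (?e i)))" if "i < ?n" for i
    proof -
      have "env_ok k ws (\<sigma>(x := i)) (\<rho>(x := b + 2)) (b + 3) ((?f i)(Suc b := unary (?n - Suc i))) (M + poly pn M)"
        unfolding env_ok_def
      proof (intro conjI allI impI, goal_cases)
        case (3 j) then show ?case using ok by (auto simp: env_ok_def)
      next
        case (4 j) then show ?case using ok by (auto simp: env_ok_def intro: trans_le_add1)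
      next
        case (5 y)
        have "\<rho> y < b" using ok by (auto simp: env_ok_def)
        then show ?case by simp
      next
        case (6 y)
        have "\<rho> y < b" "s (\<rho> y) = unary (\<sigma> y)" "k \<le> b" using ok by (auto simp: env_ok_def)
        moreover from this have "\<rho> y \<noteq> b + 2" "\<rho> y \<noteq> Suc b" by auto
        ultimately show ?case using z by auto
      next
        case (7 y) then show ?case using ok that n(1) by (auto simp: env_ok_def intro: trans_le_add1)
      next
        case (8 r) then show ?case using ok by (auto simp: env_ok_def)
      qed (use ok in \<open>auto simp: env_ok_def\<close>)
      moreover have "poly pe (M + poly pn M) = ?B" by (simp add: q_def poly_pcompose)
      ultimately show ?thesis using assms(2) unfolding compiled_def by metis
    qed
    let ?c = "Pop (Suc b) ;; compile e (\<rho>(x := b + 2)) (b + 3) ;; drain (b + 3) b ;; Push (b + 2) 1"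
    have loop: "runs (While (Suc b) ?c) (s(Suc b := unary ?n)) (?n * Suc (6 * ?B + 9) + 1) (?f ?n)"
    proof (rule runs_While[where f = ?f and n = ?n and B = "6 * ?B + 9"], goal_cases)
      case (2 i)
      let ?s2 = "(?f i)(Suc b := unary (?n - Suc i), b + 3 := unary (?e i))"
      have 1: "runs (Pop (Suc b)) (?f i) 1 ((?f i)(Suc b := unary (?n - Suc i)))"
        by (rule runs_Pop) (auto simp: fun_eq_iff tl_unary simp del: tl_replicate)
      have 3: "runs (drain (b + 3) b) ?s2 (5 * ?B + 1) (?s2(b + 3 := [], b := unary (?e i) @ ?s2 b))"
        by (rule runs_drain[where x = "?e i"]) (use body[OF 2] in auto)
      have 4: "runs (Push (b + 2) 1) (?s2(b + 3 := [], b := unary (?e i) @ ?s2 b)) 2 (?f (Suc i))"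
        by (rule runs_Push) (use z in \<open>auto simp: fun_eq_iff replicate_add[symmetric] add.commute\<close>)
      show ?case
        by (rule runs_Seq[OF 1 runs_Seq[OF conjunct2[OF body[OF 2]] runs_Seq[OF 3 4 lessI] lessI]]) simp
    qed (use z in \<open>auto simp: fun_eq_iff\<close>)
    have cl: "runs (clear (b + 2)) (?f ?n) (2 * ?n + 1) ((?f ?n)(b + 2 := []))"
      by (rule runs_clear[where x = ?n]) auto
    have fin: "(?f ?n)(b + 2 := []) = s(b := unary (\<Sum>j<?n. ?e j))" using z by (auto simp: fun_eq_iff)
    have m: "?n * (6 * ?B + 10) \<le> poly pn M * (6 * ?B + 10)" using n(1) by simp
    have "runs (compile (Sum x n e) \<rho> b) s (poly ?p M) (s(b := unary (eval ws \<sigma> (Sum x n e))))"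
      unfolding compile.simps eval.simps
      by (rule runs_Seq[OF n(2) runs_Seq[OF loop cl[unfolded fin] lessI]])
        (use n(1) m in \<open>simp add: algebra_simps\<close>)
    moreover have "(\<Sum>j<?n. ?e j) \<le> poly ?p M"
    proof -
      have "(\<Sum>j<?n. ?e j) \<le> ?n * ?B" using sum_bounded_above[of "{..<?n}" ?e ?B] body by simp
      also have "\<dots> \<le> poly pn M * ?B" using n(1) by simp
      finally show ?thesis by (simp add: algebra_simps)
    qed
    ultimately show ?case
      by simp
  qed
qed

lemma compiled_Len:
  assumes "j < k"
  shows "\<exists>p. compiled k (Len j) p"
proof (rule compiledI[where p = "[:3, 15:]"], goal_cases)
  case ok: (1 ws \<sigma> \<rho> b s M)
  let ?w = "ws ! j"
  let ?n = "length ?w"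
  have z: "s b = []" "s (Suc b) = []" "s j = map bit_symbol ?w" "?n \<le> M" "j < b"
    using ok assms by (auto simp: env_ok_def)
  let ?f = "\<lambda>i. s(j := map bit_symbol (drop i ?w), b := unary i, Suc b := rev (map bit_symbol (take i ?w)))"
  let ?c = "Push b 1 ;; Cond j 2 (Pop j ;; Push (Suc b) 2) (Pop j ;; Push (Suc b) 1)"
  have loop: "runs (While j ?c) s (9 * ?n + 1) (?f ?n)"
  proof (rule runs_While[where f = ?f and n = ?n and B = 8], goal_cases)
    case (2 i)
    then have d: "drop i ?w = ?w ! i # drop (Suc i) ?w" by (simp add: Cons_nth_drop_Suc)
    have "runs (Cond j 2 (Pop j ;; Push (Suc b) 2) (Pop j ;; Push (Suc b) 1)) ((?f i)(b := 1 # ?f i b)) 5 (?f (Suc i))"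
      by (rule runs_move_bit[where x = "?w ! i" and ys = "map bit_symbol (drop (Suc i) ?w)"])
        (use z 2 d in \<open>auto simp: fun_eq_iff take_Suc_conv_app_nth\<close>)
    then show ?case by (rule runs_Seq[OF runs_Push[OF order_refl refl]]) simp
  qed (use z in \<open>auto simp: fun_eq_iff\<close>)
  have tr: "runs (transfer (Suc b) j) (?f ?n) (6 * ?n + 1) (s(b := unary ?n))"
    by (rule runs_transfer[where w = "rev ?w"]) (use z in \<open>auto simp: rev_map fun_eq_iff\<close>)
  have "runs (compile (Len j) \<rho> b) s (poly [:3, 15:] M) (s(b := unary ?n))"
    unfolding compile.simps by (rule runs_Seq[OF loop tr]) (use z in simp)
  then show ?case
    using z by simp
qed

text \<open>Shifting as many symbols as the index says to a spare register brings the requested bit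
  to the top. Beyond the end of the word the stack is empty, its top reads as blank, and the result
  is 0. A transfer then restores the word.\<close>

lemma compiled_Bit:
  assumes "j < k" "compiled k e pe"
  shows "\<exists>p. compiled k (Bit j e) p"
proof (rule compiledI[where p = "[:20, 6:] + 10 * pe"], goal_cases)
  case ok: (1 ws \<sigma> \<rho> b s M)
  let ?p = "[:20, 6:] + 10 * pe"
  let ?w = "ws ! j" and ?v = "eval ws \<sigma> e"
  let ?n = "length ?w"
  have z: "s b = []" "s (Suc b) = []" "s (b + 2) = []" "s (Suc (Suc b)) = []" "s j = map bit_symbol ?w" "?n \<le> M" "j < b"
    using ok assms by (auto simp: env_ok_def)
  have e: "?v \<le> poly pe M" "runs (compile e \<rho> (Suc b)) s (poly pe M) (s(Suc b := unary ?v))"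
    using assms(2) env_ok_Suc_same[OF ok] unfolding compiled_def by blast+
  let ?f = "\<lambda>i. s(j := map bit_symbol (drop i ?w), Suc b := unary (?v - i), b + 2 := rev (map bit_symbol (take i ?w)))"
  let ?c = "Cond j 2 (Pop j ;; Push (b + 2) 2) (Cond j 1 (Pop j ;; Push (b + 2) 1) Skip)"
  have loop: "runs (While (Suc b) (Pop (Suc b) ;; ?c)) (s(Suc b := unary ?v)) (9 * ?v + 1) (?f ?v)"
  proof (rule runs_While[where f = ?f and n = ?v and B = 8], goal_cases)
    case (2 i)
    let ?s1 = "(?f i)(Suc b := unary (?v - Suc i))"
    have 1: "runs (Pop (Suc b)) (?f i) 1 ?s1"
      by (rule runs_Pop) (auto simp: fun_eq_iff tl_unary simp del: tl_replicate)
    have "runs ?c ?s1 (Suc (Suc 4)) (?f (Suc i))"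
    proof (cases "i < ?n")
      case True
      then have d: "drop i ?w = ?w ! i # drop (Suc i) ?w" by (simp add: Cons_nth_drop_Suc)
      have r: "runs (Pop j ;; Push (b + 2) (bit_symbol (?w ! i))) ?s1 4 (?f (Suc i))"
        by (rule runs_pop_push[where ys = "map bit_symbol (drop (Suc i) ?w)"])
          (use z True d in \<open>auto simp: fun_eq_iff take_Suc_conv_app_nth\<close>)
      have tp: "top_symbol (?s1 j) = bit_symbol (?w ! i)" using d z by (simp add: top_symbol_def)
      show ?thesis
      proof (rule runs_Cond)
        assume "top_symbol (?s1 j) = 2"
        then show "runs (Pop j ;; Push (b + 2) 2) ?s1 (Suc 4) (?f (Suc i))"
          using r runs_mono[of _ _ 4 _ "Suc 4"] unfolding tp by simp
      next
        assume "top_symbol (?s1 j) \<noteq> 2"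
        then have 3: "bit_symbol (?w ! i) = 1" unfolding tp by (cases "?w ! i") auto
        show "runs (Cond j 1 (Pop j ;; Push (b + 2) 1) Skip) ?s1 (Suc 4) (?f (Suc i))"
          by (rule runs_Cond) (use r tp 3 in auto)
      qed
    next
      case False
      then have eq: "?s1 = ?f (Suc i)" and "?s1 j = []" using z by (auto simp: fun_eq_iff)
      then have tp: "top_symbol (?s1 j) = blank" unfolding top_symbol_def by (subst if_P) simp_all
      show ?thesis
      proof (rule runs_Cond)
        assume "top_symbol (?s1 j) = 2"
        with tp show "runs (Pop j ;; Push (b + 2) 2) ?s1 (Suc 4) (?f (Suc i))"
          by (simp only: zero_neq_numeral)
      next
        show "runs (Cond j 1 (Pop j ;; Push (b + 2) 1) Skip) ?s1 (Suc 4) (?f (Suc i))"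
        proof (rule runs_Cond)
          assume "top_symbol (?s1 j) = 1"
          with tp show "runs (Pop j ;; Push (b + 2) 1) ?s1 4 (?f (Suc i))"
            by (simp only: zero_neq_one)
        qed (rule runs_Skip, use eq in auto)
      qed
    qed
    then show ?case by (rule runs_Seq[OF 1]) simp
  qed (use z in \<open>auto simp: fun_eq_iff\<close>)
  let ?r = "of_bool (?v < ?n \<and> ?w ! ?v) :: nat"
  let ?s3 = "(?f ?v)(b := unary ?r)"
  have cond: "runs (Cond j 2 (Push b 1) Skip) (?f ?v) (Suc 2) ?s3"
  proof (rule runs_Cond)
    assume "top_symbol (?f ?v j) = 2"
    then have "?v < ?n \<and> ?w ! ?v" using z
      by (cases "?v < ?n") (auto simp: top_symbol_def hd_map hd_drop_conv_nth bit_symbol_eq_2 split: if_splits)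
    then show "runs (Push b 1) (?f ?v) 2 ?s3" by (intro runs_Push) (use z in \<open>auto simp: fun_eq_iff\<close>)
  next
    assume "top_symbol (?f ?v j) \<noteq> 2"
    then have "\<not> (?v < ?n \<and> ?w ! ?v)" using z
      by (auto simp: top_symbol_def hd_map hd_drop_conv_nth bit_symbol_eq_2 split: if_splits)
    then show "runs Skip (?f ?v) 2 ?s3" by (intro runs_Skip) (use z in \<open>auto simp: fun_eq_iff\<close>)
  qed
  have tr: "runs (transfer (b + 2) j) ?s3 (6 * M + 1) (s(b := unary ?r))"
    by (rule runs_transfer[where w = "rev (take ?v ?w)"])
      (use z in \<open>auto simp: fun_eq_iff rev_map map_append[symmetric] simp del: map_append\<close>)
  have "runs (compile (Bit j e) \<rho> b) s (poly ?p M) (s(b := unary ?r))"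
    unfolding compile.simps
    by (rule runs_Seq[OF e(2) runs_Seq[OF loop runs_Seq[OF cond tr lessI] lessI]]) (use e(1) in simp)
  then show ?case
    by simp
qed

lemma compile_correct: "words_below k e \<Longrightarrow> \<exists>p. compiled k e p"
  by (induction e)
    (auto intro: compiled_Var compiled_One compiled_Plus compiled_Monus compiled_Sum compiled_Len compiled_Bit)

lemma symbols_ok_compile: "symbols_ok (compile e \<rho> b)"
  by (induction e arbitrary: \<rho> b) (auto simp: drain_def clear_def transfer_def)

text \<open>
  The bits are produced from the last one to the first one: the loop counter \<open>k\<close> doubles as the
  argument of the bit expression.
\<close>

definition write_bits :: "nat \<Rightarrow> ex \<Rightarrow> ex \<Rightarrow> nat \<Rightarrow> cmd" where
  "write_bits k eL eB d =
     compile eL (\<lambda>_. k) (k + 2) ;; drain (k + 2) k ;;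
     While k (Pop k ;; compile eB (\<lambda>_. k) (k + 2) ;;
       Cond (k + 2) 1 (Push (k + 1) 2) (Push (k + 1) 1) ;; clear (k + 2)) ;;
     transfer (k + 1) (k + 2) ;; transfer (k + 2) d"

lemma poly_time_computable_eval:
  assumes wL: "words_below k eL" and wB: "words_below k eB"
    and f: "\<And>ws. length ws = k \<Longrightarrow> f ws = map (\<lambda>i. eval ws (\<lambda>_. i) eB \<noteq> 0) [0..<eval ws (\<lambda>_. 0) eL]"
    and bin: "\<And>ws i. eval ws (\<lambda>_. i) eB \<le> 1"
  shows "poly_time_computable k f"
proof -
  obtain pL where pL: "compiled k eL pL" using compile_correct wL by blast
  obtain pB where pB: "compiled k eB pB" using compile_correct wB by blast
  define q where "q = pcompose pB ([:0, 1:] + pL)"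
  \<comment> \<open>The registers used do not depend on the destination, so \<open>d\<close> exceeds
    all of them: the output register is fresh and has the largest number.\<close>
  define d where "d = Suc (max_reg (write_bits k eL eB 0))"
  let ?c = "write_bits k eL eB d"
  have mr: "max_reg ?c = d" "k + 3 \<le> d"
    unfolding d_def write_bits_def by (auto simp: transfer_def drain_def clear_def)
  have sy: "symbols_ok ?c"
    by (auto simp: write_bits_def symbols_ok_compile drain_def clear_def transfer_def)
  let ?p = "pL + 5 * pL + pL * (q + [:20:]) + 12 * pL + [:20:]"
  have "\<exists>t \<le> poly ?p (sum_list (map length ws)). \<exists>s. exec ?c (input_stacks ws) t s \<and> s d = map bit_symbol (f ws)"
    if len: "length ws = k" for ws
  proof -
    let ?M = "sum_list (map length ws)" and ?s = "input_stacks ws"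
    let ?n = "eval ws (\<lambda>_. 0) eL" and ?B = "poly q (sum_list (map length ws))"
    have lM: "length (ws ! j) \<le> ?M" if "j < k" for j
      using len that by (intro member_le_sum_list) auto
    have "env_ok k ws (\<lambda>_. 0) (\<lambda>_. k) (k + 2) ?s ?M"
      using len lM by (auto simp: env_ok_def input_stacks_def)
    then have L: "?n \<le> poly pL ?M" "runs (compile eL (\<lambda>_. k) (k + 2)) ?s (poly pL ?M) (?s(k + 2 := unary ?n))"
      using pL unfolding compiled_def by blast+
    have z: "?s r = []" if "r \<ge> k" for r using len that by (simp add: input_stacks_def)
    let ?g = "\<lambda>m. map (\<lambda>i. eval ws (\<lambda>_. i) eB \<noteq> 0) [m..<?n]"
    let ?f = "\<lambda>i. ?s(k := unary (?n - i), k + 1 := map bit_symbol (?g (?n - i)))"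
    have dr: "runs (drain (k + 2) k) (?s(k + 2 := unary ?n)) (5 * ?n + 1) (?f 0)"
      by (rule runs_drain[where x = ?n]) (use z in \<open>auto simp: fun_eq_iff\<close>)
    let ?c' = "Pop k ;; compile eB (\<lambda>_. k) (k + 2) ;; Cond (k + 2) 1 (Push (k + 1) 2) (Push (k + 1) 1) ;; clear (k + 2)"
    have loop: "runs (While k ?c') (?f 0) (?n * Suc (?B + 10) + 1) (?f ?n)"
    proof (rule runs_While[where f = ?f and n = ?n and B = "?B + 10"], goal_cases)
      case (2 i)
      let ?m = "?n - Suc i"
      let ?v = "eval ws (\<lambda>_. ?m) eB"
      let ?s1 = "(?f i)(k := unary ?m)"
      have v: "?v = 0 \<or> ?v = 1" using bin[of ws ?m] by linarith
      have 1: "runs (Pop k) (?f i) 1 ?s1"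
        by (rule runs_Pop) (auto simp: fun_eq_iff tl_unary simp del: tl_replicate)
      \<comment> \<open>All variables are mapped to register \<open>k\<close>, which holds the
        position of the bit being computed.\<close>
      have "env_ok k ws (\<lambda>_. ?m) (\<lambda>_. k) (k + 2) ?s1 (?M + poly pL ?M)"
        using len lM L(1) z unfolding env_ok_def by (auto simp: input_stacks_def intro: trans_le_add1)
      moreover have "poly pB (?M + poly pL ?M) = ?B" by (simp add: q_def poly_pcompose)
      ultimately have 2: "runs (compile eB (\<lambda>_. k) (k + 2)) ?s1 ?B (?s1(k + 2 := unary ?v))"
        using pB unfolding compiled_def by metis
      let ?s2 = "?s1(k + 2 := unary ?v)"
      let ?s3 = "?s2(k + 1 := bit_symbol (?v \<noteq> 0) # ?s2 (k + 1))"
      have 3: "runs (Cond (k + 2) 1 (Push (k + 1) 2) (Push (k + 1) 1)) ?s2 (Suc 2) ?s3"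
        using v by (intro runs_Cond runs_Push) (auto simp: top_symbol_def)
      have 4: "runs (clear (k + 2)) ?s3 3 (?s3(k + 2 := []))"
        by (rule runs_clear[where x = ?v]) (use v in auto)
      have "[?n - i..<?n] = [Suc ?m..<?n]" "[?m..<?n] = ?m # [Suc ?m..<?n]"
        using \<open>i < ?n\<close> by (auto simp: upt_conv_Cons Suc_diff_Suc)
      then have 5: "?s3(k + 2 := []) = ?f (Suc i)" using z[of "k + 2"] by (auto simp: fun_eq_iff)
      show ?case
        by (rule runs_Seq[OF 1 runs_Seq[OF 2 runs_Seq[OF 3 4[unfolded 5] lessI] lessI]]) simp
    qed auto
    have fn: "?f ?n (k + 1) = map bit_symbol (f ws)" "length (f ws) = ?n" using f[OF len] by auto
    let ?s4 = "(?f ?n)(k + 1 := [], k + 2 := rev (map bit_symbol (f ws)) @ ?f ?n (k + 2))"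
    have t1: "runs (transfer (k + 1) (k + 2)) (?f ?n) (6 * ?n + 1) ?s4"
      by (rule runs_transfer[where w = "f ws"]) (use fn in auto)
    let ?s5 = "?s4(k + 2 := [], d := rev (map bit_symbol (rev (f ws))) @ ?s4 d)"
    have t2: "runs (transfer (k + 2) d) ?s4 (6 * ?n + 1) ?s5"
      by (rule runs_transfer[where w = "rev (f ws)"]) (use mr fn(2) z[of "k + 2"] in \<open>auto simp: rev_map\<close>)
    have "?n * (?B + 11) \<le> poly pL ?M * (?B + 11)" using L(1) by simp
    then have "runs ?c ?s (poly ?p ?M) ?s5"
      unfolding write_bits_def
      by (intro runs_Seq[OF L(2) runs_Seq[OF dr runs_Seq[OF loop runs_Seq[OF t1 t2 lessI] lessI] lessI]])
        (use L(1) in \<open>simp add: algebra_simps\<close>)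
    moreover have "?s5 d = map bit_symbol (f ws)" using mr z[of d] by (auto simp: rev_map)
    ultimately show ?thesis unfolding runs_def by blast
  qed
  then show ?thesis using poly_time_computable_exec[OF sy mr(1), of k ?p f] mr by simp
qed

section \<open>Arithmetical functions and predicates\<close>

text \<open>
  A context describes how the arguments of a function on \<open>'a\<close> are supplied: the number of input
  words, the number of bound variables (numbered from 0), the words, and the values of the variables.
\<close>

type_synonym 'a ctx = "nat \<times> nat \<times> ('a \<Rightarrow> bool list list) \<times> ('a \<Rightarrow> nat \<Rightarrow> nat)"

text \<open>One expression must serve all arguments. Only the first \<open>d\<close> variables are
  prescribed, so the expression remains valid when further variables are bound.\<close>

definition arith :: "'a ctx \<Rightarrow> ('a \<Rightarrow> nat) \<Rightarrow> bool" where
  "arith c f \<longleftrightarrow> (case c of (k, d, W, E) \<Rightarrow>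
     \<exists>e. words_below k e \<and> (\<forall>a \<sigma>. (\<forall>x<d. \<sigma> x = E a x) \<longrightarrow> eval (W a) \<sigma> e = f a))"

definition decid :: "'a ctx \<Rightarrow> ('a \<Rightarrow> bool) \<Rightarrow> bool" where
  "decid c P \<longleftrightarrow> arith c (\<lambda>a. of_bool (P a))"

definition is_word :: "'a ctx \<Rightarrow> ('a \<Rightarrow> bool list) \<Rightarrow> bool" where
  "is_word c w \<longleftrightarrow> (case c of (k, d, W, E) \<Rightarrow> \<exists>j<k. \<forall>a. w a = W a ! j)"

text \<open>Variables are numbered by binding level: the new one gets number \<open>d\<close> and
  the outer ones keep theirs, so that weakening needs no renaming.\<close>

definition ext :: "'a ctx \<Rightarrow> ('a \<times> nat) ctx" where
  "ext c = (case c of (k, d, W, E) \<Rightarrow> (k, Suc d, \<lambda>z. W (fst z), \<lambda>z. (E (fst z))(d := snd z)))"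

lemma arithI:
  assumes "words_below k e" "\<And>a \<sigma>. (\<And>x. x < d \<Longrightarrow> \<sigma> x = E a x) \<Longrightarrow> eval (W a) \<sigma> e = f a"
  shows "arith (k, d, W, E) f"
  using assms unfolding arith_def by auto

lemma arith_weaken:
  assumes "arith c f" shows "arith (ext c) (\<lambda>z. f (fst z))"
proof -
  obtain k d W E where c: "c = (k, d, W, E)" by (cases c) auto
  obtain e where "words_below k e" "\<forall>a \<sigma>. (\<forall>x<d. \<sigma> x = E a x) \<longrightarrow> eval (W a) \<sigma> e = f a"
    using assms unfolding c arith_def by auto
  then show ?thesis unfolding ext_def c prod.case by (intro arithI[of _ e]) auto
qed

lemma arith_var: "arith (ext c) (\<lambda>z. snd z)"
proof -
  obtain k d W E where c: "c = (k, d, W, E)" by (cases c) auto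
  then show ?thesis unfolding ext_def c prod.case by (intro arithI[of _ "Var d"]) auto
qed

lemma arith_one: "arith c (\<lambda>a. 1)"
  by (cases c) (auto intro: arithI[of _ One])

lemma arith_binary_operation:
  assumes "arith c f" "arith c g"
    and "\<And>k e e'. words_below k (op e e') \<longleftrightarrow> words_below k e \<and> words_below k e'"
    and "\<And>ws \<sigma> e e'. eval ws \<sigma> (op e e') = F (eval ws \<sigma> e) (eval ws \<sigma> e')"
  shows "arith c (\<lambda>a. F (f a) (g a))"
proof -
  obtain k d W E where c: "c = (k, d, W, E)" by (cases c) auto
  obtain e where e: "words_below k e" "\<forall>a \<sigma>. (\<forall>x<d. \<sigma> x = E a x) \<longrightarrow> eval (W a) \<sigma> e = f a"
    using assms(1) unfolding c arith_def by auto
  obtain e' where "words_below k e'" "\<forall>a \<sigma>. (\<forall>x<d. \<sigma> x = E a x) \<longrightarrow> eval (W a) \<sigma> e' = g a"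
    using assms(2) unfolding c arith_def by auto
  with e show ?thesis unfolding c by (intro arithI[of _ "op e e'"]) (auto simp: assms(3,4))
qed

lemma arith_add: "arith c f \<Longrightarrow> arith c g \<Longrightarrow> arith c (\<lambda>a. f a + g a)"
  by (rule arith_binary_operation[where op = Plus]) auto

lemma arith_diff: "arith c f \<Longrightarrow> arith c g \<Longrightarrow> arith c (\<lambda>a. f a - g a)"
  by (rule arith_binary_operation[where op = Monus]) auto

lemma arith_sum:
  assumes "arith c n" "arith (ext c) (\<lambda>z. g (fst z) (snd z))"
  shows "arith c (\<lambda>a. \<Sum>i<n a. g a i)"
proof -
  obtain k d W E where c: "c = (k, d, W, E)" by (cases c) auto
  obtain e where e: "words_below k e" "\<forall>a \<sigma>. (\<forall>x<d. \<sigma> x = E a x) \<longrightarrow> eval (W a) \<sigma> e = n a"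
    using assms(1) unfolding c arith_def by auto
  obtain e' where "words_below k e'" "\<forall>z \<sigma>. (\<forall>x<Suc d. \<sigma> x = ((E (fst z))(d := snd z)) x) \<longrightarrow>
      eval (W (fst z)) \<sigma> e' = g (fst z) (snd z)"
    using assms(2) unfolding c ext_def prod.case arith_def by auto
  moreover from this(2) have "eval (W a) \<sigma> e' = g a i" if "\<forall>x<d. \<sigma> x = E a x" "\<sigma> d = i" for a i \<sigma>
    using that by (auto simp: less_Suc_eq dest!: spec[of _ "(a, i)"] spec[of _ \<sigma>])
  ultimately show ?thesis using e unfolding c by (intro arithI[of _ "Sum d e e'"]) auto
qed

lemma is_word_weaken: "is_word c w \<Longrightarrow> is_word (ext c) (\<lambda>z. w (fst z))"
  by (cases c) (auto simp: is_word_def ext_def)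

lemma arith_length:
  assumes "is_word c w" shows "arith c (\<lambda>a. length (w a))"
proof -
  obtain k d W E where c: "c = (k, d, W, E)" by (cases c) auto
  then obtain j where "j < k" "\<And>a. w a = W a ! j" using assms by (auto simp: is_word_def)
  then show ?thesis unfolding c by (intro arithI[of _ "Len j"]) auto
qed

text \<open>Access is total, with \<open>False\<close> beyond the end as for \<open>Bit\<close>;
  short certificates thus need no separate treatment.\<close>

definition get :: "bool list \<Rightarrow> nat \<Rightarrow> bool" where
  "get w i \<longleftrightarrow> i < length w \<and> w ! i"

lemma decid_get:
  assumes "is_word c w" "arith c f" shows "decid c (\<lambda>a. get (w a) (f a))"
proof -
  obtain k d W E where c: "c = (k, d, W, E)" by (cases c) auto
  then obtain j where j: "j < k" "\<And>a. w a = W a ! j" using assms by (auto simp: is_word_def)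
  obtain e where "words_below k e" "\<forall>a \<sigma>. (\<forall>x<d. \<sigma> x = E a x) \<longrightarrow> eval (W a) \<sigma> e = f a"
    using assms(2) unfolding c arith_def by auto
  with j show ?thesis unfolding c decid_def by (intro arithI[of _ "Bit j e"]) (auto simp: get_def)
qed

lemma arith_zero: "arith c (\<lambda>a. 0)"
  using arith_diff[OF arith_one arith_one, of c] by simp

lemma arith_const: "arith c (\<lambda>a. n)"
proof (induction n)
  case (Suc n)
  show ?case using arith_add[OF Suc arith_one] by simp
qed (rule arith_zero)

lemma arith_Suc: "arith c f \<Longrightarrow> arith c (\<lambda>a. Suc (f a))"
  using arith_add[OF _ arith_one, of c f] by simp

lemma arith_mult:
  assumes "arith c f" "arith c g" shows "arith c (\<lambda>a. f a * g a)"
  using arith_sum[OF assms(1) arith_weaken[OF assms(2)]] by simp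

lemma arith_power: "arith c f \<Longrightarrow> arith c (\<lambda>a. f a ^ n)"
  by (induction n) (simp_all add: arith_const arith_mult)

lemma arith_poly: "arith c f \<Longrightarrow> arith c (\<lambda>a. poly p (f a))"
  by (induction p) (simp_all add: arith_const arith_mult arith_add)

lemma arith_of_bool: "decid c P \<Longrightarrow> arith c (\<lambda>a. of_bool (P a))"
  by (simp add: decid_def)

lemma decid_const: "decid c (\<lambda>a. b)"
  unfolding decid_def by (rule arith_const)

lemma decid_weaken: "decid c P \<Longrightarrow> decid (ext c) (\<lambda>z. P (fst z))"
  unfolding decid_def by (rule arith_weaken)

lemma decid_le:
  assumes "arith c f" "arith c g" shows "decid c (\<lambda>a. f a \<le> g a)"
proof -
  have "arith c (\<lambda>a. 1 - (f a - g a))" using assms by (intro arith_diff arith_const)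
  moreover have "(\<lambda>a. 1 - (f a - g a)) = (\<lambda>a. of_bool (f a \<le> g a))" by (auto simp: fun_eq_iff)
  ultimately show ?thesis by (simp add: decid_def)
qed

lemma decid_not:
  assumes "decid c P" shows "decid c (\<lambda>a. \<not> P a)"
proof -
  have "arith c (\<lambda>a. 1 - of_bool (P a))" using assms by (intro arith_diff arith_const arith_of_bool)
  moreover have "(\<lambda>a. 1 - of_bool (P a)) = (\<lambda>a. of_bool (\<not> P a) :: nat)" by (auto simp: fun_eq_iff)
  ultimately show ?thesis by (simp add: decid_def)
qed

lemma decid_conj:
  assumes "decid c P" "decid c Q" shows "decid c (\<lambda>a. P a \<and> Q a)"
proof -
  have "arith c (\<lambda>a. of_bool (P a) * of_bool (Q a))" using assms by (intro arith_mult arith_of_bool)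
  moreover have "(\<lambda>a. of_bool (P a) * of_bool (Q a)) = (\<lambda>a. of_bool (P a \<and> Q a) :: nat)"
    by (auto simp: fun_eq_iff)
  ultimately show ?thesis by (simp add: decid_def)
qed

lemma decid_disj: "decid c P \<Longrightarrow> decid c Q \<Longrightarrow> decid c (\<lambda>a. P a \<or> Q a)"
  using decid_not[OF decid_conj[OF decid_not decid_not], of c P Q] by simp

lemma decid_imp: "decid c P \<Longrightarrow> decid c Q \<Longrightarrow> decid c (\<lambda>a. P a \<longrightarrow> Q a)"
  unfolding imp_conv_disj by (intro decid_disj decid_not)

lemma decid_less: "arith c f \<Longrightarrow> arith c g \<Longrightarrow> decid c (\<lambda>a. f a < g a)"
  using decid_not[OF decid_le, of c g f] by (simp add: not_le)

lemma decid_eq: "arith c f \<Longrightarrow> arith c g \<Longrightarrow> decid c (\<lambda>a. f a = g a)"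
  unfolding order_eq_iff by (intro decid_conj decid_le)

lemma decid_ex:
  assumes "arith c n" "decid (ext c) (\<lambda>z. P (fst z) (snd z))"
  shows "decid c (\<lambda>a. \<exists>i<n a. P a i)"
proof -
  have "decid c (\<lambda>a. 0 < (\<Sum>i<n a. of_bool (P a i) :: nat))"
    using assms by (intro decid_less arith_const arith_sum arith_of_bool)
  moreover have "0 < (\<Sum>i<n a. of_bool (P a i) :: nat) \<longleftrightarrow> (\<exists>i<n a. P a i)" for a
    by (auto simp: zero_less_iff_neq_zero)
  ultimately show ?thesis by simp
qed

lemma decid_all:
  assumes "arith c n" "decid (ext c) (\<lambda>z. P (fst z) (snd z))"
  shows "decid c (\<lambda>a. \<forall>i<n a. P a i)"
  using decid_not[OF decid_ex[OF assms(1) decid_not[OF assms(2)]]] by simp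

lemma arith_if:
  assumes "decid c P" "arith c f" "arith c g" shows "arith c (\<lambda>a. if P a then f a else g a)"
proof -
  have "arith c (\<lambda>a. of_bool (P a) * f a + of_bool (\<not> P a) * g a)"
    using assms by (intro arith_add arith_mult arith_of_bool decid_not)
  moreover have "(\<lambda>a. of_bool (P a) * f a + of_bool (\<not> P a) * g a) = (\<lambda>a. if P a then f a else g a)"
    by (auto simp: fun_eq_iff)
  ultimately show ?thesis by simp
qed

lemma decid_if:
  assumes "decid c P" "decid c Q" "decid c R" shows "decid c (\<lambda>a. if P a then Q a else R a)"
  using decid_conj[OF decid_imp[OF assms(1,2)] decid_imp[OF decid_not[OF assms(1)] assms(3)]]
  by (simp add: if_bool_eq_conj)

text \<open>The quotient is the number of positive multiples of \<open>y\<close> up to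
  \<open>x\<close>, and there are at most \<open>x\<close> of them when \<open>y\<close> is not 0.
  Division thereby becomes a bounded sum.\<close>

lemma div_eq_count:
  "x div y = (if y = 0 then 0 else (\<Sum>i<x. of_bool (Suc i * y \<le> x)))" for x y :: nat
proof (cases "y = 0")
  case False
  have "i < x \<and> Suc i * y \<le> x \<longleftrightarrow> i < x div y" for i
  proof -
    have "Suc i * y \<le> x \<longleftrightarrow> Suc i \<le> x div y" using False by (simp add: less_eq_div_iff_mult_less_eq)
    then show ?thesis using div_le_dividend[of x y] by linarith
  qed
  then have "{i. i < x \<and> Suc i * y \<le> x} = {..<x div y}" by auto
  then show ?thesis using False by (simp add: sum_of_bool_eq Int_def)
qed simp

lemma arith_div:
  assumes "arith c f" "arith c g" shows "arith c (\<lambda>a. f a div g a)"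
  unfolding div_eq_count
  by (intro arith_if decid_eq arith_const arith_sum arith_of_bool decid_le arith_mult arith_Suc
    arith_var arith_weaken assms)

lemma arith_mod:
  assumes "arith c f" "arith c g" shows "arith c (\<lambda>a. f a mod g a)"
  unfolding modulo_nat_def by (intro arith_diff arith_mult arith_div assms)

lemma decid_dvd:
  assumes "arith c f" "arith c g" shows "decid c (\<lambda>a. f a dvd g a)"
  unfolding dvd_eq_mod_eq_0 by (intro decid_eq arith_mod arith_const assms)

text \<open>The bound is fixed outside the expression, so the quantifier unfolds into a conjunction
  whose members may use different expressions. This admits \<open>i\<close> as an exponent or as an
  index into a fixed table.\<close>

lemma decid_all_const:
  fixes n :: nat
  assumes "\<And>i. i < n \<Longrightarrow> decid c (P i)" shows "decid c (\<lambda>a. \<forall>i<n. P i a)"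
  using assms by (induction n) (auto simp: All_less_Suc intro: decid_const decid_conj)

lemma decid_ex_const:
  fixes n :: nat
  assumes "\<And>i. i < n \<Longrightarrow> decid c (P i)" shows "decid c (\<lambda>a. \<exists>i<n. P i a)"
  using decid_not[OF decid_all_const[OF decid_not[OF assms]]] by simp

text \<open>A dependence on \<open>f a\<close> for which no single expression is at hand, such as
  looking up the transition table, is resolved by distinguishing the constantly many values of
  \<open>f a\<close>.\<close>

lemma decid_case_const:
  assumes "arith c f" "\<And>i. i < n \<Longrightarrow> decid c (P i)"
  shows "decid c (\<lambda>a. f a < n \<and> P (f a) a)"
proof -
  have "decid c (\<lambda>a. \<exists>i<n. f a = i \<and> P i a)"
    using assms by (intro decid_ex_const decid_conj decid_eq arith_const)
  then show ?thesis by simp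
qed

lemmas arith_rules =
  arith_const decid_const arith_var arith_add arith_diff arith_mult arith_div arith_mod arith_power arith_poly
  arith_sum arith_of_bool arith_if arith_Suc arith_length
  decid_get decid_conj decid_disj decid_imp decid_not decid_if decid_le decid_less decid_eq
  decid_dvd decid_ex decid_all

lemmas weaken_rules = arith_weaken decid_weaken is_word_weaken

text \<open>Powers of two are recognised by their divisors, and exponents by counting smaller powers.\<close>

definition is_pow2 :: "nat \<Rightarrow> bool" where
  "is_pow2 z \<longleftrightarrow> 0 < z \<and> (\<forall>d<Suc z. d dvd z \<longrightarrow> d = 1 \<or> even d)"

lemma is_pow2_iff: "is_pow2 z \<longleftrightarrow> (\<exists>i. z = 2 ^ i)"
proof
  show "is_pow2 z \<Longrightarrow> \<exists>i. z = 2 ^ i"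
  proof (induction z rule: less_induct)
    case (less z)
    show ?case
    proof (cases "z = 1")
      case True then show ?thesis by (intro exI[of _ 0]) simp
    next
      case False
      then have "even z" using less.prems by (auto simp: is_pow2_def)
      then obtain y where y: "z = 2 * y" by (elim evenE)
      have pos: "0 < y" using less.prems y unfolding is_pow2_def by simp
      have "d = 1 \<or> even d" if "d dvd y" for d
      proof -
        have "d dvd z" "d < Suc z" using that y pos dvd_imp_le[of d y] by simp_all
        then show ?thesis using less.prems unfolding is_pow2_def by blast
      qed
      then have "is_pow2 y" using pos unfolding is_pow2_def by blast
      moreover have "y < z" using pos y by simp
      ultimately obtain i where "y = 2 ^ i" using less.IH by blast
      then have "z = 2 ^ Suc i" using y by simp
      then show ?thesis by blast
    qed
  qed
next
  assume "\<exists>i. z = 2 ^ i"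
  then obtain i where "z = 2 ^ i" by blast
  then show "is_pow2 z"
    by (auto simp: is_pow2_def divides_primepow_nat)
qed

lemma count_pow2: "(\<Sum>y<2 ^ i. of_bool (is_pow2 y)) = (i :: nat)"
proof -
  have "{y. y < 2 ^ i \<and> is_pow2 y} = (\<lambda>j. 2 ^ j) ` {..<i}"
    by (auto simp: is_pow2_iff)
  moreover have "card ((\<lambda>j. 2 ^ j :: nat) ` {..<i}) = i"
    by (subst card_image) (auto simp: inj_on_def)
  ultimately show ?thesis by (simp add: sum_of_bool_eq Int_def)
qed

lemma eq_pow2_iff: "z = 2 ^ i \<longleftrightarrow> is_pow2 z \<and> (\<Sum>y<z. of_bool (is_pow2 y)) = (i :: nat)"
  using count_pow2 is_pow2_iff by metis

lemma decid_is_pow2: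
  assumes "arith c f" shows "decid c (\<lambda>a. is_pow2 (f a))"
  unfolding is_pow2_def by (rule arith_rules | rule weaken_rules | rule assms)+

text \<open>The power is never computed, since it may be exponentially large; the test inspects only
  \<open>f a\<close> and the numbers up to it.\<close>

lemma decid_eq_pow2:
  assumes "arith c f" "arith c g" shows "decid c (\<lambda>a. f a = 2 ^ g a)"
  unfolding eq_pow2_iff by (rule arith_rules decid_is_pow2 | rule weaken_rules | rule assms)+

definition words_ctx :: "nat \<Rightarrow> bool list list ctx" where
  "words_ctx k = (k, 0, id, \<lambda>_ _. 0)"

lemma is_word_words_ctx: "j < k \<Longrightarrow> is_word (words_ctx k) (\<lambda>ws. ws ! j)"
  by (auto simp: is_word_def words_ctx_def)

lemma poly_time_computable_arith:
  assumes len: "arith (words_ctx k) l" and bit: "decid (ext (words_ctx k)) (\<lambda>z. b (fst z) (snd z))"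
    and f: "\<And>ws. length ws = k \<Longrightarrow> f ws = map (b ws) [0..<l ws]"
  shows "poly_time_computable k f"
proof -
  obtain eL where eL: "words_below k eL" "\<forall>ws \<sigma>. eval ws \<sigma> eL = l ws"
    using len unfolding words_ctx_def arith_def by auto
  obtain eB where "words_below k eB" "\<forall>z \<sigma>. (\<forall>x<Suc 0. \<sigma> x = snd z) \<longrightarrow>
      eval (fst z) \<sigma> eB = of_bool (b (fst z) (snd z))"
    using bit unfolding words_ctx_def ext_def prod.case decid_def arith_def by auto
  moreover from this(2) have "eval ws (\<lambda>_. i) eB = of_bool (b ws i)" for ws i
    by (auto dest!: spec[of _ "(ws, i)"])
  ultimately have eB: "words_below k eB" "\<And>ws i. eval ws (\<lambda>_. i) eB = of_bool (b ws i)" by auto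
  show ?thesis
    by (rule poly_time_computable_eval[OF eL(1) eB(1)]) (auto simp: eL eB f)
qed

lemma poly_time_decidable_decid:
  assumes "decid (words_ctx k) P" shows "poly_time_decidable k P"
  unfolding poly_time_decidable_def
  by (rule poly_time_computable_arith[of k "\<lambda>_. 1" "\<lambda>ws i. P ws"])
    (auto intro: arith_const decid_weaken assms)

section \<open>Cycles and rankings\<close>

lemmas cfvs_defs = connected_feedback_vertex_set_def feedback_vertex_set_def

text \<open>A vertex of maximal rank on the cycle has two different cycle neighbours, both of no
  larger rank. The condition is restricted to vertices of the cycle so that ranks may exploit what
  the cycle is known to avoid.\<close>

lemma ranked_cycle_False:
  fixes rank :: "'a \<Rightarrow> nat"
  assumes cyc: "is_cycle G vs"
    and rank: "\<And>v x y. \<lbrakk>{v, x, y} \<subseteq> set vs; {v, x} \<in> edges G; {v, y} \<in> edges G;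
      rank x \<le> rank v; rank y \<le> rank v\<rbrakk> \<Longrightarrow> x = y"
  shows False
proof -
  let ?l = "length vs"
  have l: "3 \<le> ?l" "distinct vs" and e: "\<And>i. i < ?l \<Longrightarrow> {vs ! i, vs ! (Suc i mod ?l)} \<in> edges G"
    using cyc by (auto simp: is_cycle_def)
  obtain i where i: "i < ?l" and mx: "\<And>j. j < ?l \<Longrightarrow> rank (vs ! j) \<le> rank (vs ! i)"
  proof -
    have "finite ((\<lambda>j. rank (vs ! j)) ` {..<?l})" "(\<lambda>j. rank (vs ! j)) ` {..<?l} \<noteq> {}"
      using l(1) by (auto simp: lessThan_empty_iff)
    from Max_in[OF this] obtain i where "i < ?l" "rank (vs ! i) = Max ((\<lambda>j. rank (vs ! j)) ` {..<?l})" by auto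
    then show ?thesis using that[of i] by simp
  qed
  \<comment> \<open>Positions of the successor and the predecessor of the maximal vertex; adding
    \<open>?l - 1\<close> is going back by one without leaving the natural numbers.\<close>
  let ?a = "Suc i mod ?l" and ?b = "(i + (?l - 1)) mod ?l"
  have "0 < ?l" using l(1) by linarith
  then have ab: "?a < ?l" "?b < ?l" using mod_less_divisor by blast+
  have "Suc (i + (?l - 1)) = i + ?l" using \<open>0 < ?l\<close> by simp
  then have sb: "Suc ?b mod ?l = i" using i mod_Suc_eq[of "i + (?l - 1)" ?l] by simp
  have "?a = (if Suc i = ?l then 0 else Suc i)" using i by auto
  moreover have "?b = (if i = 0 then ?l - 1 else i - 1)"
  proof (cases i)
    case (Suc i')
    then have "i + (?l - 1) = i' + ?l" using l by simp
    then show ?thesis using Suc i by simp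
  qed (use l in simp)
  ultimately have ne: "?a \<noteq> ?b" using l(1) i by (auto split: if_splits)
  have "vs ! ?a = vs ! ?b"
  proof (rule rank[of "vs ! i"])
    show "{vs ! i, vs ! ?a, vs ! ?b} \<subseteq> set vs" using i ab by simp
    show "{vs ! i, vs ! ?a} \<in> edges G" using e i by blast
    show "{vs ! i, vs ! ?b} \<in> edges G" using e[OF ab(2)] sb by (simp add: insert_commute)
  qed (use mx ab in auto)
  then show False using ne ab l(2) nth_eq_iff_index_eq by blast
qed

lemma cycle_subset_verts:
  assumes "simple_graph G" "is_cycle G vs" shows "set vs \<subseteq> verts G"
proof
  fix v assume "v \<in> set vs"
  then obtain i where "i < length vs" "v = vs ! i" by (auto simp: in_set_conv_nth)
  then have "{v, vs ! (Suc i mod length vs)} \<in> edges G" using assms(2) by (auto simp: is_cycle_def)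
  then show "v \<in> verts G" using assms(1) unfolding simple_graph_def by blast
qed

lemma girth_ge_iff: "enat p \<le> girth G \<longleftrightarrow> (\<forall>vs. is_cycle G vs \<longrightarrow> p \<le> length vs)"
  unfolding girth_def by (auto simp: le_INF_iff)

lemma is_cycle_delete_verts:
  assumes "is_cycle G vs" "set vs \<inter> S = {}" "simple_graph G"
  shows "is_cycle (delete_verts G S) vs"
proof -
  have "set vs \<subseteq> verts G" using assms cycle_subset_verts by blast
  moreover have "Suc i mod length vs < length vs" if "i < length vs" for i
    using that by (intro mod_less_divisor) linarith
  ultimately show ?thesis using assms(1,2)
    unfolding is_cycle_def delete_verts_def induced_subgraph_def by (auto dest: nth_mem)
qed

lemma is_cycle_induced_subgraph:
  assumes "is_cycle (induced_subgraph G S) vs"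
  shows "is_cycle G vs" "set vs \<subseteq> S"
proof -
  show "is_cycle G vs" using assms unfolding is_cycle_def induced_subgraph_def by auto
  show "set vs \<subseteq> S"
  proof
    fix v assume "v \<in> set vs"
    then obtain i where "i < length vs" "v = vs ! i" by (auto simp: in_set_conv_nth)
    then show "v \<in> S" using assms unfolding is_cycle_def induced_subgraph_def by fastforce
  qed
qed

section \<open>Isomorphic graphs\<close>

text \<open>Serves to replace the triples of the construction by the numbers that instances require
  as vertices.\<close>

definition graph_iso :: "('a \<Rightarrow> 'b) \<Rightarrow> 'a graph \<Rightarrow> 'b graph \<Rightarrow> bool" where
  "graph_iso f G H \<longleftrightarrow> simple_graph G \<and> simple_graph H \<and> bij_betw f (verts G) (verts H) \<and>
     (\<forall>u\<in>verts G. \<forall>v\<in>verts G. {f u, f v} \<in> edges H \<longleftrightarrow> {u, v} \<in> edges G)"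

lemma graph_iso_inv:
  assumes "graph_iso f G H" shows "graph_iso (inv_into (verts G) f) H G"
proof -
  have b: "bij_betw f (verts G) (verts H)" using assms by (simp add: graph_iso_def)
  then have "bij_betw (inv_into (verts G) f) (verts H) (verts G)" by (rule bij_betw_inv_into)
  moreover have "f (inv_into (verts G) f v) = v" "inv_into (verts G) f v \<in> verts G" if "v \<in> verts H" for v
    using b that by (auto simp: bij_betw_def f_inv_into_f inv_into_into)
  ultimately show ?thesis using assms unfolding graph_iso_def by metis
qed

lemma graph_iso_cycle:
  assumes "graph_iso f G H" "is_cycle G vs" shows "is_cycle H (map f vs)"
proof -
  have s: "set vs \<subseteq> verts G" using assms cycle_subset_verts[of G vs] by (auto simp: graph_iso_def)
  then have "distinct (map f vs)"
    using assms by (auto simp: is_cycle_def graph_iso_def distinct_map bij_betw_def intro: inj_on_subset)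
  moreover have "{map f vs ! i, map f vs ! (Suc i mod length vs)} \<in> edges H" if "i < length vs" for i
  proof -
    have "Suc i mod length vs < length vs" using that by (intro mod_less_divisor) linarith
    then have "vs ! i \<in> verts G" "vs ! (Suc i mod length vs) \<in> verts G" using that s by auto
    moreover have "{vs ! i, vs ! (Suc i mod length vs)} \<in> edges G" using assms(2) that by (auto simp: is_cycle_def)
    ultimately show ?thesis using assms(1) that \<open>Suc i mod length vs < length vs\<close>
      by (simp add: graph_iso_def)
  qed
  ultimately show ?thesis using assms(2) by (simp add: is_cycle_def)
qed

lemma graph_iso_girth:
  assumes "graph_iso f G H" "enat p \<le> girth G" shows "enat p \<le> girth H"
  unfolding girth_ge_iff
proof (intro allI impI)
  fix vs assume "is_cycle H vs"
  from graph_iso_cycle[OF graph_iso_inv[OF assms(1)] this] show "p \<le> length vs"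
    using assms(2) unfolding girth_ge_iff by fastforce
qed

lemma graph_iso_cfvs:
  assumes iso: "graph_iso f G H" and S: "connected_feedback_vertex_set G S"
  shows "connected_feedback_vertex_set H (f ` S) \<and> card (f ` S) = card S"
proof -
  have inj: "inj_on f (verts G)" and im: "f ` verts G = verts H" and sH: "simple_graph H"
    using iso by (auto simp: graph_iso_def bij_betw_def)
  have SV: "S \<subseteq> verts G" using S by (auto simp: cfvs_defs)
  have e: "{f u, f v} \<in> edges H \<longleftrightarrow> {u, v} \<in> edges G" if "u \<in> verts G" "v \<in> verts G" for u v
    using iso that by (simp add: graph_iso_def)
  have "forest (delete_verts H (f ` S))"
    unfolding forest_def
  proof
    assume "\<exists>vs. is_cycle (delete_verts H (f ` S)) vs"
    then obtain vs where "is_cycle H vs" and sub: "set vs \<subseteq> verts H - f ` S"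
      unfolding delete_verts_def by (auto dest: is_cycle_induced_subgraph)
    let ?g = "inv_into (verts G) f"
    have "is_cycle G (map ?g vs)"
      using graph_iso_cycle[OF graph_iso_inv[OF iso] \<open>is_cycle H vs\<close>] .
    moreover have "set (map ?g vs) \<inter> S = {}"
    proof -
      have "?g x \<notin> S" if "x \<in> set vs" for x
      proof
        assume "?g x \<in> S"
        then have "f (?g x) \<in> f ` S" by blast
        moreover have "x \<in> f ` verts G" using that sub im by auto
        ultimately have "x \<in> f ` S" using f_inv_into_f[of x f "verts G"] by simp
        then show False using that sub by auto
      qed
      then show ?thesis by auto
    qed
    ultimately have "is_cycle (delete_verts G S) (map ?g vs)"
      using is_cycle_delete_verts[of G] iso by (auto simp: graph_iso_def)
    then show False using S
      by (auto simp: cfvs_defs forest_def)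
  qed
  moreover have "connected_graph (induced_subgraph H (f ` S))"
    unfolding connected_graph_def
  proof (intro ballI)
    fix x y assume "x \<in> verts (induced_subgraph H (f ` S))" "y \<in> verts (induced_subgraph H (f ` S))"
    then obtain u v where uv: "u \<in> S" "v \<in> S" "x = f u" "y = f v" by (auto simp: induced_subgraph_def)
    have "(u, v) \<in> {(x, y). {x, y} \<in> edges (induced_subgraph G S)}\<^sup>*"
      using S uv by (auto simp: connected_feedback_vertex_set_def connected_graph_def induced_subgraph_def)
    then have "(f u, f v) \<in> {(x, y). {x, y} \<in> edges (induced_subgraph H (f ` S))}\<^sup>*"
    proof (induction rule: rtrancl_induct)
      case (step y z)
      then have "y \<in> S" "z \<in> S" "{y, z} \<in> edges G" by (auto simp: induced_subgraph_def)
      then have "{f y, f z} \<in> edges (induced_subgraph H (f ` S))"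
        using e[of y z] SV by (auto simp: induced_subgraph_def)
      then show ?case using step.IH by (auto intro: rtrancl_into_rtrancl)
    qed simp
    then show "(x, y) \<in> {(x, y). {x, y} \<in> edges (induced_subgraph H (f ` S))}\<^sup>*" using uv by simp
  qed
  moreover have "card (f ` S) = card S" using inj SV by (meson card_image inj_on_subset)
  ultimately show ?thesis using SV im
    by (auto simp: cfvs_defs)
qed

section \<open>From hitting sets to connected feedback vertex sets\<close>

text \<open>
  The triple \<open>(c, N, m)\<close> is the vertex of clause \<open>c\<close>; the vertex of the extra clause \<open>C\<close> is the root.
  Each of these lies on a private cycle through the vertices \<open>(c, N, i)\<close> with \<open>i < m\<close>. The triple
  \<open>(0, u, m)\<close> with \<open>u < N\<close> is element \<open>u\<close>, which is joined to the root and to each clause \<open>c\<close>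
  containing it, the latter by the path \<open>(c, u, 0), \<dots>, (c, u, m - 1)\<close>. The first edge of that path
  is missing if \<open>c\<close> does not contain \<open>u\<close>.
\<close>

definition link :: "nat \<Rightarrow> nat \<Rightarrow> nat \<Rightarrow> (nat \<Rightarrow> nat \<Rightarrow> bool) \<Rightarrow> nat \<times> nat \<times> nat \<Rightarrow> nat \<times> nat \<times> nat \<Rightarrow> bool" where
  "link C N m mem = (\<lambda>(c, u, i) (c', u', i').
     (c' = c \<and> u' = u \<and> i' = Suc i \<and> i' < m) \<or>
     (u = N \<and> i = m \<and> c' = c \<and> i' = 0 \<and> (u' = N \<or> c < C \<and> u' < N \<and> mem c u')) \<or>
     (Suc i = m \<and> i' = m \<and> u' = u \<and> c' = (if u = N then c else 0)) \<or>
     (c = C \<and> u = N \<and> i = m \<and> c' = 0 \<and> u' < N \<and> i' = m))"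

text \<open>The vertex set is a full product so that vertices can be numbered arithmetically.
  Triples \<open>(c, u, m)\<close> with \<open>0 < c\<close> and \<open>u < N\<close> are
  isolated.\<close>

definition hit_graph :: "nat \<Rightarrow> nat \<Rightarrow> nat \<Rightarrow> (nat \<Rightarrow> nat \<Rightarrow> bool) \<Rightarrow> (nat \<times> nat \<times> nat) graph" where
  "hit_graph C N m mem = ({..C} \<times> {..N} \<times> {..m},
     {{a, b} | a b. a \<in> {..C} \<times> {..N} \<times> {..m} \<and> b \<in> {..C} \<times> {..N} \<times> {..m} \<and> link C N m mem a b})"

context
  fixes C N m :: nat and mem :: "nat \<Rightarrow> nat \<Rightarrow> bool"
  assumes m: "3 \<le> m"
begin

private abbreviation "G \<equiv> hit_graph C N m mem"

lemma link_irrefl: "\<not> link C N m mem a a"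
  using m by (auto simp: link_def split: if_splits)

lemma edge_iff: "{a, b} \<in> edges G \<longleftrightarrow> a \<in> {..C} \<times> {..N} \<times> {..m} \<and> b \<in> {..C} \<times> {..N} \<times> {..m} \<and>
   (link C N m mem a b \<or> link C N m mem b a)"
  unfolding hit_graph_def snd_conv mem_Collect_eq doubleton_eq_iff by blast

lemma simple_hit_graph: "simple_graph G"
proof -
  have "card {a, b} = 2" if "link C N m mem a b" for a b
    using that link_irrefl by (cases "a = b") auto
  then show ?thesis unfolding simple_graph_def hit_graph_def by auto
qed

text \<open>A cycle with fewer than \<open>m\<close> vertices misses some level \<open>l < m\<close>
  of the third component. Cutting every path and private cycle at level \<open>l\<close> leaves a
  forest: pieces below \<open>l\<close> hang from clause vertices, pieces above \<open>l\<close>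
  from elements or clause vertices, and the elements form a star around the root.
  \<open>rank\<close> grows away from the root and the clause vertices.\<close>

lemma girth_hit_graph:
  assumes "p \<le> m" shows "enat p \<le> girth G"
  unfolding girth_ge_iff
proof (intro allI impI)
  fix vs assume cyc: "is_cycle G vs"
  show "p \<le> length vs"
  proof (rule ccontr)
    assume "\<not> p \<le> length vs"
    then have "card ((\<lambda>(c, u, i). i) ` set vs) < m"
      using card_image_le[of "set vs" "\<lambda>(c, u, i). i"] card_length[of vs] assms by simp
    then have "\<not> {..<m} \<subseteq> (\<lambda>(c, u, i). i) ` set vs"
      using card_mono[of "(\<lambda>(c, u, i). i) ` set vs" "{..<m}"] by auto
    then obtain l where l: "l < m" "\<And>c u. (c, u, l) \<notin> set vs" by force
    define rank :: "nat \<times> nat \<times> nat \<Rightarrow> nat" where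
      "rank = (\<lambda>(c, u, i). if i < m then (if i < l then 2 + i else 2 + m - i) else if u = N then 0 else 1)"
    show False
    proof (rule ranked_cycle_False[OF cyc, of rank])
      fix v x y
      assume "{v, x, y} \<subseteq> set vs" and e: "{v, x} \<in> edges G" "{v, y} \<in> edges G"
        and r: "rank x \<le> rank v" "rank y \<le> rank v"
      then have mem: "v \<in> set vs" "x \<in> set vs" "y \<in> set vs" by auto
      obtain c u i where v: "v = (c, u, i)" by (cases v)
      have i: "i \<noteq> l" using l mem v by auto
      \<comment> \<open>The parent of \<open>v\<close> in the cut graph is its only possible
        neighbour of no larger rank.\<close>
      have low: "(i < l \<longrightarrow> x = (if i = 0 then (c, N, m) else (c, u, i - 1))) \<and>
         (l < i \<and> i < m \<longrightarrow> x = (if Suc i < m then (c, u, Suc i) else if u = N then (c, N, m) else (0, u, m))) \<and>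
         (\<not> i < m \<longrightarrow> u \<noteq> N \<and> x = (C, N, m))"
        if "x \<in> set vs" "{v, x} \<in> edges G" "rank x \<le> rank v" for x
      proof -
        obtain c' u' i' where x: "x = (c', u', i')" by (cases x)
        have i': "i' \<noteq> l" using l that x by auto
        have "link C N m mem v x \<or> link C N m mem x v" using that(2) edge_iff by blast
        then show ?thesis
        proof
          assume "link C N m mem v x"
          then show ?thesis using that(3) i i' l(1) m unfolding v x link_def rank_def
            by (auto split: if_splits)
        next
          assume "link C N m mem x v"
          then show ?thesis using that(3) i i' l(1) m unfolding v x link_def rank_def
            by (auto split: if_splits)
        qed
      qed
      show "x = y" using low[OF mem(2) e(1) r(1)] low[OF mem(3) e(2) r(2)] i
        by (metis linorder_neqE_nat)
    qed
  qed
qed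

private abbreviation "clause_vertex c \<equiv> (c :: nat, N, m)"

lemma clause_vertex_edge:
  assumes "c \<le> C" "i < m" "{(c, N, i), x} \<in> edges G" shows "x \<in> insert (clause_vertex c) ({c} \<times> {N} \<times> {..<m})"
  using assms m unfolding edge_iff by (cases x) (auto simp: link_def split: if_splits)

lemma private_cycle:
  assumes "c \<le> C" shows "is_cycle G (map (\<lambda>i. (c, N, i)) [0..<Suc m])"
  unfolding is_cycle_def
proof (intro conjI allI impI)
  show "distinct (map (\<lambda>i. (c, N, i)) [0..<Suc m])" by (auto simp: distinct_map inj_on_def)
  fix i assume i: "i < length (map (\<lambda>i. (c, N, i)) [0..<Suc m])"
  have "link C N m mem (c, N, m) (c, N, 0)" "link C N m mem (c, N, m - 1) (c, N, m)"
    "Suc i < m \<Longrightarrow> link C N m mem (c, N, i) (c, N, Suc i)" using m by (auto simp: link_def)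
  moreover have "i = m \<or> i = m - 1 \<or> Suc i < m" using i by auto
  ultimately have "{(c, N, i), (c, N, Suc i mod Suc m)} \<in> edges G"
    using assms m i unfolding edge_iff by auto
  moreover have "Suc i mod Suc m < Suc m" by simp
  ultimately show "{map (\<lambda>i. (c, N, i)) [0..<Suc m] ! i, map (\<lambda>i. (c, N, i)) [0..<Suc m] !
        (Suc i mod length (map (\<lambda>i. (c, N, i)) [0..<Suc m]))} \<in> edges G"
    using i by (simp del: upt_Suc mod_Suc_le_divisor)
qed (use m in simp)

private abbreviation "reach S \<equiv> {(x, y). {x, y} \<in> edges (induced_subgraph G S)}\<^sup>*"

lemma reach_induced:
  assumes "(x, y) \<in> reach S" "x \<in> X" "\<And>y z. y \<in> X \<Longrightarrow> z \<in> S \<Longrightarrow> {y, z} \<in> edges G \<Longrightarrow> z \<in> X"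
  shows "y \<in> X"
  using assms(1,2)
proof (induction rule: rtrancl_induct)
  case (step y z)
  then show ?case using assms(3)[of y z] by (auto simp: induced_subgraph_def)
qed

text \<open>\<open>S\<close> meets every private cycle, and by \<open>1 \<le> C\<close> there are at
  least two. Without the clause vertex, the part of \<open>S\<close> on its private cycle would be
  cut off from the part on another one.\<close>

lemma clause_vertex_in_cfvs:
  assumes S: "connected_feedback_vertex_set G S" and c: "c \<le> C" and "1 \<le> C"
  shows "clause_vertex c \<in> S"
proof (rule ccontr)
  assume n: "clause_vertex c \<notin> S"
  have hit: "\<exists>x\<in>S. x \<in> {d} \<times> {N} \<times> {..m}" if "d \<le> C" for d
  proof (rule ccontr)
    assume "\<not> (\<exists>x\<in>S. x \<in> {d} \<times> {N} \<times> {..m})"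
    then have "set (map (\<lambda>i. (d, N, i)) [0..<Suc m]) \<inter> S = {}" by auto
    from is_cycle_delete_verts[OF private_cycle[OF that] this simple_hit_graph] show False
      using S by (auto simp: cfvs_defs forest_def)
  qed
  obtain i where i: "(c, N, i) \<in> S" "i \<le> m" using hit[OF c] by auto
  obtain d where d: "d \<le> C" "d \<noteq> c" using assms(3) by (metis le0 le_numeral_extra(4) not_one_le_zero)
  obtain j where j: "(d, N, j) \<in> S" using hit[OF d(1)] by auto
  have "((c, N, i), (d, N, j)) \<in> reach S"
    using S i j by (auto simp: connected_feedback_vertex_set_def connected_graph_def induced_subgraph_def)
  then have "(d, N, j) \<in> {c} \<times> {N} \<times> {..<m}"
  proof (rule reach_induced)
    show "(c, N, i) \<in> {c} \<times> {N} \<times> {..<m}" using i n by (cases "i = m") auto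
    fix y z assume "y \<in> {c} \<times> {N} \<times> {..<m}" "z \<in> S" "{y, z} \<in> edges G"
    then show "z \<in> {c} \<times> {N} \<times> {..<m}" using clause_vertex_edge[OF c, of _ z] n by auto
  qed
  then show False using d by simp
qed

text \<open>\<open>S\<close> connects the clause vertex to the root. If no path to an element of the
  clause lay in \<open>S\<close> together with that element, everything reachable within
  \<open>S\<close> would stay in the set \<open>X\<close> of the private cycle and the initial path
  segments contained in \<open>S\<close>.\<close>

lemma clause_path_in_cfvs:
  assumes S: "connected_feedback_vertex_set G S" and c: "c < C"
  shows "\<exists>u<N. mem c u \<and> (0, u, m) \<in> S \<and> (\<forall>i<m. (c, u, i) \<in> S)"
proof (rule ccontr)
  assume no: "\<not> ?thesis"
  define X where "X = {clause_vertex c} \<union> {c} \<times> {N} \<times> {..<m} \<union>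
    {(c, u, i) | u i. u < N \<and> mem c u \<and> i < m \<and> (\<forall>i'\<le>i. (c, u, i') \<in> S)}"
  have "clause_vertex c \<in> S" "clause_vertex C \<in> S"
    using clause_vertex_in_cfvs[OF S] c by auto
  then have "(clause_vertex c, clause_vertex C) \<in> reach S"
    using S by (auto simp: connected_feedback_vertex_set_def connected_graph_def induced_subgraph_def)
  then have "clause_vertex C \<in> X"
  proof (rule reach_induced)
    show "clause_vertex c \<in> X" by (simp add: X_def)
    fix y z assume y: "y \<in> X" and z: "z \<in> S" and "{y, z} \<in> edges G"
    then have l: "link C N m mem y z \<or> link C N m mem z y" unfolding edge_iff by blast
    obtain d v j where zz: "z = (d, v, j)" by (cases z)
    from y consider "y = clause_vertex c" | i where "y = (c, N, i)" "i < m"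
      | u i where "y = (c, u, i)" "u < N" "mem c u" "i < m" "\<forall>i'\<le>i. (c, u, i') \<in> S"
      unfolding X_def by auto
    then show "z \<in> X"
    proof cases
      case 1
      then show ?thesis using l c z m unfolding zz X_def by (auto simp: link_def split: if_splits)
    next
      case 2
      then show ?thesis using clause_vertex_edge[of c i z] c \<open>{y, z} \<in> edges G\<close> unfolding X_def by auto
    next
      case 3
      have full: "(0, u, m) \<in> S \<longrightarrow> \<not> (\<forall>i<m. (c, u, i) \<in> S)" using no 3 by blast
      from l show ?thesis
      proof
        assume "link C N m mem y z"
        then consider "z = (c, u, Suc i)" "Suc i < m" | "Suc i = m" "z = (0, u, m)"
          using 3 unfolding zz by (auto simp: link_def split: if_splits)
        then show ?thesis
        proof cases
          case 1
          then have "\<forall>i'\<le>Suc i. (c, u, i') \<in> S" using 3 z by (auto simp: le_Suc_eq)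
          then show ?thesis using 1 3 unfolding X_def by blast
        next
          case 2
          then show ?thesis using full 3 z by (auto simp: less_Suc_eq_le)
        qed
      next
        assume "link C N m mem z y"
        then consider "z = (c, u, i - 1)" "0 < i" | "z = clause_vertex c"
          using 3 unfolding zz by (auto simp: link_def split: if_splits)
        then show ?thesis using 3 unfolding X_def by cases auto
      qed
    qed
  qed
  then show False using c by (auto simp: X_def)
qed

text \<open>Clause vertices with the root, one path per clause, and the elements in \<open>S\<close>
  are disjoint parts of \<open>S\<close>. The first two take up \<open>Suc C + C * m\<close>, which
  leaves at most \<open>b\<close> elements.\<close>

lemma cfvs_imp_hitting_set:
  assumes S: "connected_feedback_vertex_set G S" and C: "1 \<le> C" and le: "card S \<le> Suc C + C * m + b"
  shows "\<exists>H \<subseteq> {..<N}. card H \<le> b \<and> (\<forall>c<C. \<exists>u\<in>H. mem c u)"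
proof -
  obtain g where g: "\<And>c. c < C \<Longrightarrow> g c < N \<and> mem c (g c) \<and> (0, g c, m) \<in> S \<and> (\<forall>i<m. (c, g c, i) \<in> S)"
    using clause_path_in_cfvs[OF S] by metis
  let ?H = "{u. u < N \<and> (0, u, m) \<in> S}"
  let ?F = "(\<lambda>c. (c, N, m)) ` {..C}" and ?P = "(\<lambda>(c, i). (c, g c, i)) ` ({..<C} \<times> {..<m})"
    and ?E = "(\<lambda>u. (0 :: nat, u, m)) ` ?H"
  have "S \<subseteq> verts G" using S by (auto simp: cfvs_defs)
  then have fin: "finite S" using simple_hit_graph by (auto simp: simple_graph_def intro: finite_subset)
  have sub: "?F \<union> ?P \<union> ?E \<subseteq> S" using g clause_vertex_in_cfvs[OF S _ C] by auto
  have "card ?F = Suc C" "card ?P = C * m" "card ?E = card ?H"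
    by (subst card_image; auto simp: inj_on_def)+
  moreover have "card (?F \<union> ?P \<union> ?E) = card ?F + card ?P + card ?E"
  proof -
    have "(?F \<union> ?P) \<inter> ?E = {}" "?F \<inter> ?P = {}" using g by auto
    then show ?thesis by (subst card_Un_disjoint; simp)+
  qed
  moreover have "card (?F \<union> ?P \<union> ?E) \<le> card S" using sub fin by (rule card_mono[rotated])
  ultimately have "card ?H \<le> b" using le by linarith
  moreover have "\<forall>c<C. \<exists>u\<in>?H. mem c u" using g by blast
  ultimately show ?thesis by (intro exI[of _ ?H]) auto
qed

text \<open>\<open>S\<close> consists of the clause vertices with the root, the elements of
  \<open>H\<close>, and for each clause the path to one element \<open>g c\<close> hitting it.
  Without clause vertices and root, the private cycles are opened and all other paths merely hang
  from their elements.\<close>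

lemma hitting_set_imp_cfvs:
  assumes H: "H \<subseteq> {..<N}" "card H \<le> b" "\<forall>c<C. \<exists>u\<in>H. mem c u"
  shows "\<exists>S. connected_feedback_vertex_set G S \<and> card S \<le> Suc C + C * m + b"
proof -
  obtain g where g: "\<And>c. c < C \<Longrightarrow> g c \<in> H \<and> mem c (g c)" using H(3) by metis
  let ?F = "(\<lambda>c. (c, N, m)) ` {..C}" and ?P = "(\<lambda>(c, i). (c, g c, i)) ` ({..<C} \<times> {..<m})"
    and ?E = "(\<lambda>u. (0 :: nat, u, m)) ` H"
  define S where "S = ?F \<union> ?P \<union> ?E"
  have finH: "finite H" using H(1) finite_subset by blast
  have "card S \<le> Suc C + C * m + b"
  proof -
    have "card ?F \<le> Suc C" using card_image_le[of "{..C}"] by simp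
    moreover have "card ?P \<le> C * m" using card_image_le[of "{..<C} \<times> {..<m}" "\<lambda>(c, i). (c, g c, i)"] by simp
    moreover have "card ?E \<le> b" using card_image_le[OF finH, of "\<lambda>u. (0 :: nat, u, m)"] H(2) by linarith
    ultimately show ?thesis
      unfolding S_def using card_Un_le[of "?F \<union> ?P" ?E] card_Un_le[of ?F ?P] by linarith
  qed
  moreover have gN: "g c < N" if "c < C" for c using g[OF that] H(1) by auto
  then have SV: "S \<subseteq> verts G" using H(1) by (force simp: S_def hit_graph_def)
  moreover have "forest (delete_verts G S)"
    unfolding forest_def
  proof
    assume "\<exists>vs. is_cycle (delete_verts G S) vs"
    then obtain vs where cyc: "is_cycle G vs" and sub: "set vs \<subseteq> verts G - S"
      unfolding delete_verts_def by (auto dest: is_cycle_induced_subgraph)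
    \<comment> \<open>Every edge avoiding clause vertices and root joins consecutive levels, and the
      neighbour on the higher level is unique.\<close>
    define rank :: "nat \<times> nat \<times> nat \<Rightarrow> nat" where "rank = (\<lambda>(c, u, i). m - i)"
    show False
    proof (rule ranked_cycle_False[OF cyc, of rank])
      fix v x y
      assume vxy: "{v, x, y} \<subseteq> set vs" and e: "{v, x} \<in> edges G" "{v, y} \<in> edges G"
        and r: "rank x \<le> rank v" "rank y \<le> rank v"
      obtain c u i where v: "v = (c, u, i)" by (cases v)
      have notF: "(c', N, m) \<notin> set vs" if "c' \<le> C" for c' using sub that by (auto simp: S_def)
      have low: "i < m \<and> x = (if Suc i < m then (c, u, Suc i) else (0, u, m))"
        if "x \<in> set vs" "{v, x} \<in> edges G" "rank x \<le> rank v" for x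
      proof -
        obtain c' u' i' where x: "x = (c', u', i')" by (cases x)
        have b: "c \<le> C" "c' \<le> C" "i \<le> m" "i' \<le> m" and l: "link C N m mem v x \<or> link C N m mem x v"
          using that(2) unfolding edge_iff v x by auto
        have "x \<noteq> (c', N, m)" "v \<noteq> (c, N, m)" using notF b that(1) vxy by auto
        then show ?thesis using l b that(3) m unfolding v x link_def rank_def
          by (auto split: if_splits)
      qed
      show "x = y" using low[of x] low[of y] e r vxy by simp
    qed
  qed
  moreover have "connected_graph (induced_subgraph G S)"
  proof -
    let ?R = "{(x, y). {x, y} \<in> edges (induced_subgraph G S)}"
    have edge: "(x, y) \<in> ?R" if "x \<in> S" "y \<in> S" "link C N m mem x y" for x y
    proof -
      have "{x, y} \<in> edges G" using that SV unfolding edge_iff by (auto simp: hit_graph_def)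
      then show ?thesis using that by (simp add: induced_subgraph_def)
    qed
    have "sym ?R" by (auto simp: sym_def insert_commute)
    then have sym: "sym (reach S)" by (rule sym_rtrancl)
    let ?r = "clause_vertex C"
    have rS: "?r \<in> S" by (simp add: S_def)
    have elem: "((0, u, m), ?r) \<in> reach S" if "u \<in> H" for u
    proof -
      have "link C N m mem ?r (0, u, m)" "(0, u, m) \<in> S" using that H(1) by (auto simp: link_def S_def)
      then show ?thesis using edge[OF rS, of "(0, u, m)"] sym by (meson r_into_rtrancl symD)
    qed
    have pS: "(c, g c, i) \<in> S" if "c < C" "i < m" for c i using that by (force simp: S_def)
    \<comment> \<open>Induction from the element end of the path back to its start.\<close>
    have path: "((c, g c, m - Suc j), ?r) \<in> reach S" if c: "c < C" and "j < m" for c j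
      using that(2)
    proof (induction j)
      case 0
      have "link C N m mem (c, g c, m - 1) (0, g c, m)" using m gN[OF c] by (auto simp: link_def)
      then have "((c, g c, m - 1), (0, g c, m)) \<in> ?R"
        using g[OF c] pS[OF c, of "m - 1"] m by (intro edge) (auto simp: S_def)
      then show ?case using elem g[OF c] by (auto intro: converse_rtrancl_into_rtrancl)
    next
      case (Suc j)
      have "link C N m mem (c, g c, m - Suc (Suc j)) (c, g c, m - Suc j)" using Suc.prems by (auto simp: link_def)
      then have "((c, g c, m - Suc (Suc j)), (c, g c, m - Suc j)) \<in> ?R"
        using pS[OF c] Suc.prems by (intro edge) auto
      then show ?case using Suc by (auto intro: converse_rtrancl_into_rtrancl)
    qed
    have clause: "(clause_vertex c, ?r) \<in> reach S" if c: "c \<le> C" for c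
    proof (cases "c = C")
      case False
      then have "link C N m mem (clause_vertex c) (c, g c, 0)" using c g[of c] gN by (auto simp: link_def)
      then have "(clause_vertex c, (c, g c, 0)) \<in> ?R"
        using pS[of c 0] m c False by (intro edge) (auto simp: S_def)
      moreover have "((c, g c, 0), ?r) \<in> reach S" using path[of c "m - 1"] c False m by auto
      ultimately show ?thesis by (rule converse_rtrancl_into_rtrancl)
    qed simp
    have all: "(x, ?r) \<in> reach S" if "x \<in> S" for x
    proof -
      have "((c, g c, i), ?r) \<in> reach S" if "c < C" "i < m" for c i
        using path[of c "m - Suc i"] that by (simp add: Suc_diff_Suc)
      then show ?thesis using that elem clause unfolding S_def by auto
    qed
    show ?thesis unfolding connected_graph_def
    proof (intro ballI)
      fix x y assume "x \<in> verts (induced_subgraph G S)" "y \<in> verts (induced_subgraph G S)"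
      then have "x \<in> S" "y \<in> S" by (auto simp: induced_subgraph_def)
      from all[OF this(1)] symD[OF sym all[OF this(2)]] show "(x, y) \<in> reach S" by (rule rtrancl_trans)
    qed
  qed
  ultimately show ?thesis unfolding cfvs_defs by blast
qed

end

text \<open>Mixed radix notation with digits \<open>u \<le> N\<close> and \<open>i \<le> m\<close>.
  It numbers the vertices of the graph as well as the cells of the tableau.\<close>

definition triple_code :: "nat \<Rightarrow> nat \<Rightarrow> nat \<times> nat \<times> nat \<Rightarrow> nat" where
  "triple_code N m = (\<lambda>(c, u, i). (c * Suc N + u) * Suc m + i)"

definition triple_of :: "nat \<Rightarrow> nat \<Rightarrow> nat \<Rightarrow> nat \<times> nat \<times> nat" where
  "triple_of N m v = (v div Suc m div Suc N, v div Suc m mod Suc N, v mod Suc m)"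

lemma triple_of_code: "u \<le> N \<Longrightarrow> i \<le> m \<Longrightarrow> triple_of N m (triple_code N m (c, u, i)) = (c, u, i)"
  unfolding triple_of_def triple_code_def
  by (simp add: div_mult_self3 less_Suc_eq_le del: mult_Suc mult_Suc_right)

lemma triple_code_of: "triple_code N m (triple_of N m v) = v"
  unfolding triple_of_def triple_code_def by (simp del: mult_Suc mult_Suc_right)

lemma triple_code_less:
  assumes "c \<le> C" "u \<le> N" "i \<le> m"
  shows "triple_code N m (c, u, i) < Suc C * Suc N * Suc m"
proof -
  have "c * Suc N + u < Suc C * Suc N"
    using mult_le_mono1[OF assms(1), of "Suc N"] assms(2) by simp
  then have "(c * Suc N + u + 1) * Suc m \<le> Suc C * Suc N * Suc m" by (intro mult_le_mono1) simp
  moreover have "(c * Suc N + u) * Suc m + i < (c * Suc N + u + 1) * Suc m" using assms(3) by simp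
  ultimately show ?thesis unfolding triple_code_def prod.case by (rule less_le_trans[rotated])
qed

lemma triple_of_range:
  assumes "v < Suc C * Suc N * Suc m"
  shows "triple_of N m v \<in> {..C} \<times> {..N} \<times> {..m}"
proof -
  have "v div Suc m < Suc C * Suc N" using assms by (simp add: less_mult_imp_div_less del: mult_Suc mult_Suc_right)
  then have "v div Suc m div Suc N < Suc C" by (simp add: less_mult_imp_div_less del: mult_Suc mult_Suc_right)
  then show ?thesis unfolding triple_of_def using mod_less_divisor[of "Suc N"] mod_less_divisor[of "Suc m"]
    by (auto simp: less_Suc_eq_le simp del: mod_less_divisor)
qed

definition nat_hit_graph :: "nat \<Rightarrow> nat \<Rightarrow> nat \<Rightarrow> (nat \<Rightarrow> nat \<Rightarrow> bool) \<Rightarrow> nat graph" where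
  "nat_hit_graph C N m mem = (let n = Suc C * Suc N * Suc m in ({0..<n},
     {{v, w} | v w. v < n \<and> w < n \<and> link C N m mem (triple_of N m v) (triple_of N m w)}))"

lemma nat_hit_graph_iso:
  assumes m: "3 \<le> m"
  shows "graph_iso (triple_code N m) (hit_graph C N m mem) (nat_hit_graph C N m mem)"
proof -
  let ?n = "Suc C * Suc N * Suc m"
  let ?G = "hit_graph C N m mem" and ?H = "nat_hit_graph C N m mem"
  have V: "verts ?G = {..C} \<times> {..N} \<times> {..m}" "verts ?H = {0..<?n}"
    by (simp_all add: hit_graph_def nat_hit_graph_def Let_def)
  have range: "triple_of N m ` {0..<?n} \<subseteq> {..C} \<times> {..N} \<times> {..m}"
    by (intro image_subsetI triple_of_range) simp
  have bij: "bij_betw (triple_code N m) ({..C} \<times> {..N} \<times> {..m}) {0..<?n}"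
    by (rule bij_betw_byWitness[where f' = "triple_of N m"])
      (use triple_code_less[of _ C _ N _ m] triple_of_code triple_code_of range
        in \<open>auto simp del: mult_Suc mult_Suc_right\<close>)
  have eH: "{v, w} \<in> edges ?H \<longleftrightarrow> v < ?n \<and> w < ?n \<and>
     (link C N m mem (triple_of N m v) (triple_of N m w) \<or> link C N m mem (triple_of N m w) (triple_of N m v))" for v w
    unfolding nat_hit_graph_def Let_def by (auto simp: doubleton_eq_iff simp del: mult_Suc mult_Suc_right)
  have "simple_graph ?H"
  proof -
    have "card {a, b} = 2" if "link C N m mem (triple_of N m a) (triple_of N m b)" for a b
      using that link_irrefl[OF m] by (cases "a = b") auto
    then show ?thesis unfolding simple_graph_def nat_hit_graph_def Let_def
      by (auto simp del: mult_Suc mult_Suc_right)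
  qed
  moreover have "{triple_code N m u, triple_code N m v} \<in> edges ?H \<longleftrightarrow> {u, v} \<in> edges ?G"
    if "u \<in> {..C} \<times> {..N} \<times> {..m}" "v \<in> {..C} \<times> {..N} \<times> {..m}" for u v
    unfolding eH edge_iff[OF m] using that triple_code_less triple_of_code by auto
  ultimately show ?thesis
    unfolding graph_iso_def V using bij simple_hit_graph[OF m] by blast
qed

lemma nat_hit_graph_correct:
  assumes m: "3 \<le> m" and "p \<le> m" and C: "1 \<le> C"
  shows "nat_graph (nat_hit_graph C N m mem)" "enat p \<le> girth (nat_hit_graph C N m mem)"
    "(\<exists>S. connected_feedback_vertex_set (nat_hit_graph C N m mem) S \<and> card S \<le> Suc C + C * m + b) \<longleftrightarrow>
     (\<exists>H \<subseteq> {..<N}. card H \<le> b \<and> (\<forall>c<C. \<exists>u\<in>H. mem c u))"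
proof -
  note iso = nat_hit_graph_iso[OF m, of N C mem]
  show "nat_graph (nat_hit_graph C N m mem)"
    using iso unfolding nat_graph_def graph_iso_def by (auto simp: nat_hit_graph_def Let_def)
  show "enat p \<le> girth (nat_hit_graph C N m mem)"
    using graph_iso_girth[OF iso girth_hit_graph[OF m \<open>p \<le> m\<close>]] .
  show "(\<exists>S. connected_feedback_vertex_set (nat_hit_graph C N m mem) S \<and> card S \<le> Suc C + C * m + b) \<longleftrightarrow>
     (\<exists>H \<subseteq> {..<N}. card H \<le> b \<and> (\<forall>c<C. \<exists>u\<in>H. mem c u))" (is "?L \<longleftrightarrow> ?R")
  proof
    assume ?L
    then show ?R using graph_iso_cfvs[OF graph_iso_inv[OF iso]] cfvs_imp_hitting_set[OF m _ C] by metis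
  next
    assume ?R
    then show ?L using graph_iso_cfvs[OF iso] hitting_set_imp_cfvs[OF m] by metis
  qed
qed

section \<open>Constraint systems as hitting set problems\<close>

text \<open>Element \<open>u\<close> stands for giving the value \<open>u mod V\<close> to the
  variable \<open>u div V\<close>.\<close>

definition csp_hit :: "nat \<Rightarrow> nat \<Rightarrow> (nat \<Rightarrow> nat \<Rightarrow> nat \<Rightarrow> bool) \<Rightarrow> nat \<Rightarrow> nat \<Rightarrow> bool" where
  "csp_hit n V mem c u =
     (if c < n then u div V = c else mem (c - n) (u div V) (u mod V))"

text \<open>The clauses \<open>c < n\<close> and the bound \<open>n\<close> make a hitting set select one value for each variable.\<close>

lemma csp_hit_iff:
  assumes V: "0 < V"
  shows "(\<exists>H \<subseteq> {..<n * V}. card H \<le> n \<and> (\<forall>c<n + k. \<exists>u\<in>H. csp_hit n V mem c u)) \<longleftrightarrow>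
    (\<exists>val. (\<forall>g<n. val g < V) \<and> (\<forall>c<k. \<exists>g<n. mem c g (val g)))" (is "?L \<longleftrightarrow> ?R")
proof
  assume ?L
  then obtain H where H: "H \<subseteq> {..<n * V}" "card H \<le> n" "\<And>c. c < n + k \<Longrightarrow> \<exists>u\<in>H. csp_hit n V mem c u" by blast
  have fin: "finite H" using H(1) finite_subset by blast
  have ge: "\<exists>u\<in>H. u div V = g" if "g < n" for g using H(3)[of g] that by (auto simp: csp_hit_def)
  have lt: "u div V < n" if "u \<in> H" for u using H(1) that V by (auto simp: less_mult_imp_div_less)
  have im: "(\<lambda>u. u div V) ` H = {..<n}" using ge lt by blast
  \<comment> \<open>At most \<open>n\<close> elements cover all \<open>n\<close> variables, so no
    variable receives two values.\<close>
  then have inj: "inj_on (\<lambda>u. u div V) H"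
    using H(2) card_image_le[OF fin, of "\<lambda>u. u div V"] fin by (intro eq_card_imp_inj_on) auto
  define val where "val g = (SOME u. u \<in> H \<and> u div V = g) mod V" for g
  have val: "val (u div V) = u mod V" if "u \<in> H" for u
  proof -
    have "(SOME v. v \<in> H \<and> v div V = u div V) = u"
      using that inj by (intro some_equality) (auto simp: inj_on_def)
    then show ?thesis by (simp add: val_def)
  qed
  have "\<exists>g<n. mem c g (val g)" if c: "c < k" for c
  proof -
    obtain u where u: "u \<in> H" "csp_hit n V mem (n + c) u" using H(3)[of "n + c"] c by auto
    then show ?thesis using lt val by (intro exI[of _ "u div V"]) (auto simp: csp_hit_def)
  qed
  then show ?R using V by (intro exI[of _ val]) (auto simp: val_def)
next
  assume ?R
  then obtain val where val: "\<And>g. g < n \<Longrightarrow> val g < V" "\<And>c. c < k \<Longrightarrow> \<exists>g<n. mem c g (val g)" by blast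
  let ?H = "(\<lambda>g. g * V + val g) ` {..<n}"
  have "g * V + val g < n * V" if "g < n" for g
  proof -
    have "Suc g * V \<le> n * V" using that by (intro mult_le_mono1) simp
    then show ?thesis using val(1)[OF that] by simp
  qed
  moreover have "card ?H \<le> n" using card_image_le[of "{..<n}" "\<lambda>g. g * V + val g"] by simp
  moreover have "\<exists>u\<in>?H. csp_hit n V mem c u" if c: "c < n + k" for c
  proof -
    have d: "(g * V + val g) div V = g" "(g * V + val g) mod V = val g" if "g < n" for g
      using val(1)[OF that] by simp_all
    show ?thesis
    proof (cases "c < n")
      case True
      then show ?thesis using d by (intro bexI[of _ "c * V + val c"]) (auto simp: csp_hit_def)
    next
      case False
      then have "c - n < k" using c by linarith
      then obtain g where "g < n" "mem (c - n) g (val g)" using val(2) by blast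
      then show ?thesis using d False by (intro bexI[of _ "g * V + val g"]) (auto simp: csp_hit_def)
    qed
  qed
  ultimately show ?L by (intro exI[of _ ?H]) auto
qed

section \<open>Computations as constraint systems\<close>

text \<open>
  Tape contents are described relative to the head, which is always at position \<open>h\<close>; moving the head
  shifts the contents.
\<close>

definition nth_or_blank :: "nat list \<Rightarrow> nat \<Rightarrow> nat" where
  "nth_or_blank xs i = (if i < length xs then xs ! i else blank)"

fun tape_cell :: "tape \<Rightarrow> nat \<Rightarrow> nat \<Rightarrow> nat" where
  "tape_cell (l, c, r) h j =
     (if j = h then c else if h < j then nth_or_blank r (j - Suc h) else nth_or_blank l (h - Suc j))"

lemma nth_or_blank_simps [simp]:
  "nth_or_blank [] i = blank"
  "nth_or_blank (x # xs) 0 = x"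
  "nth_or_blank (x # xs) (Suc i) = nth_or_blank xs i"
  by (auto simp: nth_or_blank_def)

lemma nth_or_blank_pos: "0 < i \<Longrightarrow> nth_or_blank (x # xs) i = nth_or_blank xs (i - 1)"
  by (cases i) auto

lemma tape_cell_write: "tape_cell (write_symbol s t) h j = (if j = h then s else tape_cell t h j)"
  by (cases t) auto

lemma tape_cell_head: "tape_cell t h h = scanned t"
  by (cases t) auto

lemma tape_cell_Right: "tape_cell (move_head Right t) h j = tape_cell t h (Suc j)"
proof -
  obtain l c r where t: "t = (l, c, r)" by (cases t)
  consider "j = h" | "h < j" | "Suc j = h" | "Suc j < h" by linarith
  then show ?thesis unfolding t
    by cases (cases r; auto simp: nth_or_blank_pos)+
qed

text \<open>Positions are natural numbers, so what enters position 0 from the left has no number.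
  Cells at the borders of the tableau hence cannot be determined by a view.\<close>

lemma tape_cell_Left:
  assumes "0 < j" shows "tape_cell (move_head Left t) h j = tape_cell t h (j - 1)"
proof -
  obtain l c r where t: "t = (l, c, r)" by (cases t)
  consider "j = h" | "j < h" | "j = Suc h" | "Suc h < j" by linarith
  then show ?thesis unfolding t using assms
    by cases (cases l; auto simp: nth_or_blank_pos Suc_diff_Suc numeral_2_eq_2)+
qed

lemma tape_cell_input:
  "tape_cell (input_tape w) h j = (if h \<le> j \<and> j < h + length w then bit_symbol (w ! (j - h)) else blank)"
proof (cases w)
  case (Cons b bs)
  consider "j < h" | "j = h" | k where "j = Suc (h + k)" by (metis less_imp_Suc_add linorder_neqE_nat)
  then show ?thesis using Cons by cases (auto simp: nth_or_blank_def)
qed auto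

definition contents :: "config \<Rightarrow> nat \<Rightarrow> nat \<Rightarrow> nat \<Rightarrow> nat" where
  "contents cfg h i j = (if i < length (snd cfg) then tape_cell (snd cfg ! i) h j else fst cfg)"

text \<open>
  The view of a configuration from position \<open>j\<close> of tape \<open>i\<close>: the scanned symbols, the state, and the
  contents of the positions \<open>j - 1\<close>, \<open>j\<close> and \<open>j + 1\<close>. It determines the next contents of
  position \<open>j\<close>. The state is treated as a further tape with constant contents.
\<close>

definition view :: "nat \<Rightarrow> nat \<Rightarrow> (nat \<Rightarrow> nat \<Rightarrow> nat) \<Rightarrow> nat \<Rightarrow> nat \<Rightarrow> nat list" where
  "view K h f i j = map (\<lambda>l. if l \<le> K then f l h else f i (j - 1 + (l - Suc K))) [0..<K + 4]"

text \<open>After the move, position \<open>j\<close> shows what was at \<open>j - 1 + b\<close>,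
  which is entry \<open>K + 1 + b\<close> of the view. If that is the head position
  \<open>h\<close>, it is the symbol just written instead.\<close>

definition next_content :: "tm \<Rightarrow> nat \<Rightarrow> nat list \<Rightarrow> nat \<Rightarrow> nat \<Rightarrow> nat" where
  "next_content M i vw h j = (let K = num_tapes M; q = vw ! K in
     if q = halt_state M then (if i = K then q else vw ! (K + 2))
     else case transition M q (take K vw) of (q', as) \<Rightarrow>
       if i = K then q' else case as ! i of (s, d) \<Rightarrow>
         let b = (case d of Left \<Rightarrow> 0 | Stay \<Rightarrow> 1 | Right \<Rightarrow> 2) in
           if j + b = Suc h then s else vw ! (K + 1 + b))"

lemma next_content_step:
  assumes wf: "wf_tm M" and len: "length ts = num_tapes M" and q: "q < num_states M"
    and sym: "\<forall>t\<in>set ts. scanned t < num_symbols M"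
    and i: "i \<le> num_tapes M" and j: "0 < j"
  shows "contents (step M (q, ts)) h i j =
    next_content M i (view (num_tapes M) h (contents (q, ts) h) i j) h j"
proof -
  let ?K = "num_tapes M" and ?f = "contents (q, ts) h"
  let ?v = "view ?K h ?f i j"
  have vK: "?v ! ?K = q" using len by (simp add: view_def contents_def)
  have v: "?v ! (?K + 1 + b) = ?f i (j - 1 + b)" if "b < 3" for b
    using that by (simp add: view_def del: upt_Suc)
  have tk: "take ?K ?v = map scanned ts"
    by (rule nth_equalityI) (use len in \<open>auto simp: view_def contents_def tape_cell_head nth_append simp del: upt_Suc\<close>)
  obtain q' as where tr: "transition M q (map scanned ts) = (q', as)" by (cases "transition M q (map scanned ts)")
  have las: "length as = ?K"
    using wf q len sym tr unfolding wf_tm_def by (auto 0 3 dest!: spec[of _ q] spec[of _ "map scanned ts"])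
  show ?thesis
  proof (cases "q = halt_state M")
    case True
    have "?v ! (?K + 2) = ?f i j" using v[of 1] j by simp
    then show ?thesis using True vK i len by (auto simp: step_def next_content_def Let_def contents_def)
  next
    case False
    show ?thesis
    proof (cases "i = ?K")
      case True
      then show ?thesis using False vK tk tr len las
        by (simp add: step_def next_content_def Let_def contents_def)
    next
      case iK: False
      then have iK: "i < ?K" using i by simp
      obtain s d where sd: "as ! i = (s, d)" by (cases "as ! i")
      have "contents (step M (q, ts)) h i j = tape_cell (move_head d (write_symbol s (ts ! i))) h j"
        using False tr las len iK sd by (simp add: step_def contents_def)
      moreover have "?f i k = tape_cell (ts ! i) h k" for k using iK len by (simp add: contents_def)
      ultimately show ?thesis
        using False vK tk tr iK sd j v[of 0] v[of 1] v[of 2]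
        by (cases d) (auto simp: next_content_def Let_def tape_cell_Left tape_cell_Right tape_cell_write
            simp del: One_nat_def)
    qed
  qed
qed

section \<open>Ranges of symbols and states along a run\<close>

definition tape_ok :: "tm \<Rightarrow> tape \<Rightarrow> bool" where
  "tape_ok M t \<longleftrightarrow> (case t of (l, c, r) \<Rightarrow> set (c # l @ r) \<subseteq> {..<num_symbols M})"

definition config_ok :: "tm \<Rightarrow> config \<Rightarrow> bool" where
  "config_ok M cfg \<longleftrightarrow> fst cfg < num_states M \<and> length (snd cfg) = num_tapes M \<and>
     (\<forall>t \<in> set (snd cfg). tape_ok M t)"

lemma tape_ok_action:
  assumes "tape_ok M t" "s < num_symbols M" shows "tape_ok M (move_head d (write_symbol s t))"
proof -
  obtain l c r where "t = (l, c, r)" by (cases t)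
  then show ?thesis using assms by (cases d; cases l; cases r) (auto simp: tape_ok_def)
qed

lemma tape_ok_cell: "tape_ok M t \<Longrightarrow> tape_cell t h j < num_symbols M"
  by (cases t) (force simp: tape_ok_def nth_or_blank_def dest: nth_mem)

lemma tape_ok_scanned: "tape_ok M t \<Longrightarrow> scanned t < num_symbols M"
  by (cases t) (auto simp: tape_ok_def)

lemma config_ok_step:
  assumes wf: "wf_tm M" and ok: "config_ok M cfg" shows "config_ok M (step M cfg)"
proof -
  obtain q ts where cfg: "cfg = (q, ts)" by (cases cfg)
  have len: "length ts = num_tapes M" and q: "q < num_states M" and t: "\<And>t. t \<in> set ts \<Longrightarrow> tape_ok M t"
    using ok by (auto simp: config_ok_def cfg)
  obtain q' as where tr: "transition M q (map scanned ts) = (q', as)" by (cases "transition M q (map scanned ts)")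
  have "\<forall>t\<in>set ts. scanned t < num_symbols M" using t tape_ok_scanned by blast
  then have "set (map scanned ts) \<subseteq> {..<num_symbols M}" by auto
  then have a: "q' < num_states M" "length as = num_tapes M" "\<And>s d. (s, d) \<in> set as \<Longrightarrow> s < num_symbols M"
    using wf q len tr unfolding wf_tm_def by (auto 0 3 dest!: spec[of _ q] spec[of _ "map scanned ts"])
  have "tape_ok M (move_head d (write_symbol s t))" if "((s, d), t) \<in> set (zip as ts)" for s d t
    using a(3) t tape_ok_action that by (meson set_zip_leftD set_zip_rightD)
  then show ?thesis using ok a len tr by (auto simp: cfg config_ok_def step_def)
qed

lemma config_ok_initial:
  assumes wf: "wf_tm M" and "length ws \<le> num_tapes M" shows "config_ok M (initial_config M ws)"
proof -
  have "3 \<le> num_symbols M" "start_state M < num_states M" using wf by (auto simp: wf_tm_def)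
  then have "tape_ok M (input_tape w)" for w
    by (cases w) (auto simp: tape_ok_def bit_symbol_def)
  from this this[of "[]"] show ?thesis using assms \<open>start_state M < num_states M\<close>
    by (auto simp: config_ok_def initial_config_def)
qed

definition cell_code :: "nat \<Rightarrow> nat \<Rightarrow> nat \<Rightarrow> nat \<Rightarrow> nat \<Rightarrow> nat" where
  "cell_code K h t i j = triple_code K (2 * h) (t, i, j)"

text \<open>Least significant digit first. It lets one number below \<open>V ^ k\<close> run through
  all lists of length \<open>k\<close> over \<open>{..<V}\<close>.\<close>

definition digits :: "nat \<Rightarrow> nat \<Rightarrow> nat \<Rightarrow> nat list" where
  "digits V k z = map (\<lambda>l. z div V ^ l mod V) [0..<k]"

lemma digits_surj:
  "set ds \<subseteq> {..<V} \<Longrightarrow> \<exists>z < V ^ length ds. digits V (length ds) z = ds"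
proof (induction ds)
  case (Cons d ds)
  then obtain z where z: "z < V ^ length ds" "digits V (length ds) z = ds" by auto
  have d: "d < V" using Cons by simp
  have "(d + V * z) div V ^ Suc l mod V = z div V ^ l mod V" for l
    using d by (simp add: div_mult2_eq)
  moreover have "(d + V * z) mod V = d" using d by simp
  ultimately have "digits V (length (d # ds)) (d + V * z) = d # digits V (length ds) z"
    by (simp add: digits_def upt_conv_Cons map_Suc_upt[symmetric] del: upt_Suc)
  moreover have "d + V * z < V ^ length (d # ds)"
  proof -
    have "V * Suc z \<le> V * V ^ length ds" using z by (intro mult_le_mono2) simp
    then show ?thesis using d by simp
  qed
  ultimately show ?case using z by metis
qed (simp add: digits_def)

text \<open>On tape 1 the certificate is left open: each of its \<open>Q\<close> positions may hold
  a bit or a blank. That no blank precedes a bit has to be required separately, since it relates two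
  cells.\<close>

definition initial_ok :: "tm \<Rightarrow> bool list \<Rightarrow> nat \<Rightarrow> nat \<Rightarrow> nat \<Rightarrow> nat \<Rightarrow> nat \<Rightarrow> bool" where
  "initial_ok M x Q h i j a \<longleftrightarrow>
     (if i = num_tapes M then a = start_state M
      else if i = 0 then a = (if h \<le> j \<and> j < h + length x then (if get x (j - h) then 2 else 1) else 0)
      else if i = 1 \<and> h \<le> j \<and> j < h + Q then a < 3
      else a = 0)"

text \<open>
  The \<open>z\<close>-th constraint for position \<open>j\<close> of tape \<open>i\<close> at time \<open>t\<close>, as the set of pairs of a cell \<open>g\<close> and
  a contents \<open>a\<close> satisfying it. At time 0 the constraint 1 ensures that the certificate, which
  occupies tape 1, contains no blank. At later times, \<open>z\<close> ranges over the codes of all views of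
  the preceding configuration, and the last constraint concerns acceptance.
\<close>

definition constraint ::
  "tm \<Rightarrow> nat \<Rightarrow> bool list \<Rightarrow> nat \<Rightarrow> nat \<Rightarrow> nat \<Rightarrow> nat \<Rightarrow> nat \<Rightarrow> nat \<Rightarrow> nat \<Rightarrow> nat \<Rightarrow> nat \<Rightarrow> bool" where
  "constraint M V x Q T h z i t j g a \<longleftrightarrow> (let K = num_tapes M in
     if t = 0 then
       (if z = 1 then
          (if i = 1 \<and> h < j then g = cell_code K h 0 1 (j - 1) \<and> a \<noteq> 0 \<or> g = cell_code K h t i j \<and> a = 0
           else g = cell_code K h t i j)
        else g = cell_code K h t i j \<and> initial_ok M x Q h i j a)
     else if z = V ^ (K + 4) then g = cell_code K h t i j \<and> (t = T \<and> Suc i = K \<and> j = h \<longrightarrow> a = 2)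
     else if 0 < j \<and> j < 2 * h then
       (\<exists>l<K + 4. g = cell_code K h (t - 1) (if l \<le> K then l else i) (if l \<le> K then h else j - 1 + (l - Suc K)) \<and>
          a \<noteq> z div V ^ l mod V) \<or>
       g = cell_code K h t i j \<and> a = next_content M i (digits V (K + 4) z) h j
     else g = cell_code K h t i j)"

text \<open>By the size of \<open>h\<close>, the words fit to the right of position \<open>h\<close>
  among the positions up to \<open>2 * h\<close>, and no influence from the borders reaches
  \<open>h\<close> within \<open>T\<close> steps. As \<open>T\<close> is positive, the acceptance
  constraint does not fall on time 0.\<close>

locale verifier_run =
  fixes M :: tm and V :: nat and x :: "bool list" and Q T h :: nat and R :: "bool list \<Rightarrow> bool"
  assumes wf: "wf_tm M" and tapes: "2 \<le> num_tapes M"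
    and V: "num_symbols M \<le> V" "num_states M \<le> V"
    and T: "0 < T" and h: "T + length x + Q < h"
    and run: "\<And>w. length w \<le> Q \<Longrightarrow> outputs_within M T [x, w] [R w]"
begin

abbreviation "K \<equiv> num_tapes M"
abbreviation "code \<equiv> cell_code K h"
definition "cells = Suc T * Suc K * Suc (2 * h)"
abbreviation cfg :: "bool list \<Rightarrow> nat \<Rightarrow> config" where "cfg w t \<equiv> (step M ^^ t) (initial_config M [x, w])"

lemma V3: "3 \<le> V" using wf V by (auto simp: wf_tm_def)

lemma code_less: "t \<le> T \<Longrightarrow> i \<le> K \<Longrightarrow> j \<le> 2 * h \<Longrightarrow> code t i j < cells"
  unfolding cell_code_def cells_def by (rule triple_code_less)

lemma cfg_ok: "config_ok M (cfg w t)"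
proof (induction t)
  case 0
  show ?case using config_ok_initial[OF wf, of "[x, w]"] tapes by simp
next
  case (Suc t)
  then show ?case using config_ok_step[OF wf] by simp
qed

lemma content_less: "contents (cfg w t) h i j < V"
proof (cases "i < length (snd (cfg w t))")
  case True
  then have "tape_ok M (snd (cfg w t) ! i)" using cfg_ok[of t w] unfolding config_ok_def by simp
  from tape_ok_cell[OF this, of h j] show ?thesis using True V by (simp add: contents_def)
next
  case False
  then show ?thesis using cfg_ok[of t w] V by (simp add: contents_def config_ok_def)
qed

lemma content_Suc:
  assumes "i \<le> K" "0 < j"
  shows "contents (cfg w (Suc t)) h i j = next_content M i (view K h (contents (cfg w t) h) i j) h j"
proof -
  obtain q ts where c: "cfg w t = (q, ts)" by (cases "cfg w t")
  have "config_ok M (q, ts)" using cfg_ok[of t w] c by simp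
  then show ?thesis using next_content_step[OF wf, of ts q i j h] assms tape_ok_scanned
    by (auto simp: c config_ok_def)
qed

lemma content_initial:
  assumes "i \<le> K"
  shows "contents (initial_config M [x, w]) h i j =
    (if i = K then start_state M
     else if i = 0 then (if h \<le> j \<and> j < h + length x then bit_symbol (x ! (j - h)) else 0)
     else if i = 1 then (if h \<le> j \<and> j < h + length w then bit_symbol (w ! (j - h)) else 0)
     else 0)"
proof -
  have "i < K \<Longrightarrow> (map input_tape [x, w] @ replicate (K - length [x, w]) (input_tape [])) ! i =
     input_tape (if i = 0 then x else if i = 1 then w else [])"
    using tapes by (auto simp: nth_append nth_Cons')
  then show ?thesis using assms tapes
    by (auto simp: contents_def initial_config_def tape_cell_input simp del: input_tape.simps)
qed

lemma accepted_iff: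
  assumes "length w \<le> Q" shows "contents (cfg w T) h (K - 1) h = 2 \<longleftrightarrow> R w"
proof -
  obtain q ts where c: "cfg w T = (q, ts)" by (cases "cfg w T")
  have len: "length ts = K" using cfg_ok[of T w] c by (simp add: config_ok_def)
  have "tape_word (last ts) = [bit_symbol (R w)]"
    using run[OF assms] c by (simp add: outputs_within_def)
  moreover obtain l s r where l: "last ts = (l, s, r)" by (cases "last ts")
  ultimately have "s = bit_symbol (R w)" by (auto split: if_splits)
  moreover have "ts ! (K - 1) = last ts" using len tapes by (subst last_conv_nth) auto
  ultimately have "contents (cfg w T) h (K - 1) h = bit_symbol (R w)"
    using len tapes l by (simp add: contents_def c)
  then show ?thesis by (simp add: bit_symbol_eq_2)
qed

definition satisfied :: "(nat \<Rightarrow> nat) \<Rightarrow> nat \<Rightarrow> nat \<Rightarrow> nat \<Rightarrow> nat \<Rightarrow> bool" where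
  "satisfied val t i j z \<longleftrightarrow> (\<exists>g<cells. constraint M V x Q T h z i t j g (val g))"

definition solution :: "(nat \<Rightarrow> nat) \<Rightarrow> bool" where
  "solution val \<longleftrightarrow> (\<forall>g<cells. val g < V) \<and>
     (\<forall>t\<le>T. \<forall>i\<le>K. \<forall>j\<le>2 * h. \<forall>z\<le>V ^ (K + 4). satisfied val t i j z)"

lemma pow_ge: "1 < V ^ (K + 4)"
  using V3 by (intro one_less_power) auto

lemma accepting_imp_solution:
  assumes w: "length w \<le> Q" "R w"
  shows "solution (\<lambda>g. case triple_of K (2 * h) g of (t, i, j) \<Rightarrow> contents (cfg w t) h i j)"
proof -
  let ?val = "\<lambda>g. case triple_of K (2 * h) g of (t, i, j) \<Rightarrow> contents (cfg w t) h i j"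
  have val: "?val (code t i j) = contents (cfg w t) h i j" if "i \<le> K" "j \<le> 2 * h" for t i j
    using triple_of_code[OF that] by (simp add: cell_code_def)
  have "satisfied ?val t i j z" if b: "t \<le> T" "i \<le> K" "j \<le> 2 * h" "z \<le> V ^ (K + 4)" for t i j z
  proof -
    let ?g = "code t i j"
    have g: "?g < cells" by (rule code_less[OF b(1-3)])
    have vg: "?val ?g = contents (cfg w t) h i j" by (rule val[OF b(2,3)])
    show ?thesis
    proof (cases "t = 0")
      case t: True
      show ?thesis
      proof (cases "z = 1")
        case z: True
        show ?thesis
        proof (cases "i = 1 \<and> h < j \<and> contents (cfg w t) h i j \<noteq> 0")
          case False
          then show ?thesis unfolding satisfied_def
            by (intro exI[of _ ?g]) (use t z g vg in \<open>auto simp: constraint_def Let_def\<close>)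
        next
          case True
          \<comment> \<open>Position \<open>j\<close> lies in the certificate and
            \<open>h < j\<close>, so \<open>j - 1\<close> lies in it too.\<close>
          then have "contents (cfg w 0) h 1 (j - 1) \<noteq> 0"
            using t b tapes by (auto simp: content_initial bit_symbol_def split: if_splits)
          then show ?thesis unfolding satisfied_def
            by (intro exI[of _ "code 0 1 (j - 1)"])
              (use t z True code_less[of 0 1 "j - 1"] val[of 1 "j - 1" 0] b tapes in \<open>auto simp: constraint_def Let_def\<close>)
        qed
      next
        case z: False
        have "initial_ok M x Q h i j (contents (cfg w t) h i j)"
          using b(2) w(1) t by (auto simp: initial_ok_def content_initial get_def bit_symbol_def)
        then show ?thesis unfolding satisfied_def
          by (intro exI[of _ ?g]) (use t z g vg in \<open>auto simp: constraint_def Let_def\<close>)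
      qed
    next
      case t: False
      then obtain t' where t': "t = Suc t'" by (cases t) auto
      consider "z = V ^ (K + 4)" | "z \<noteq> V ^ (K + 4)" "\<not> (0 < j \<and> j < 2 * h)"
        | "z \<noteq> V ^ (K + 4)" "0 < j" "j < 2 * h" by blast
      then show ?thesis
      proof cases
        case 1
        have "t = T \<and> Suc i = K \<and> j = h \<longrightarrow> contents (cfg w t) h i j = 2"
        proof (intro impI, elim conjE)
          assume "t = T" "Suc i = K" "j = h"
          moreover from this have "i = K - 1" by simp
          ultimately show "contents (cfg w t) h i j = 2" using accepted_iff[OF w(1)] w(2) by simp
        qed
        then show ?thesis unfolding satisfied_def
          by (intro exI[of _ ?g]) (use t 1 g vg in \<open>auto simp: constraint_def Let_def\<close>)
      next
        case 2
        \<comment> \<open>At the borders the constraint admits every value of the cell.\<close>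
        then show ?thesis unfolding satisfied_def
          by (intro exI[of _ ?g]) (use t g in \<open>auto simp: constraint_def Let_def\<close>)
      next
        case 3
        let ?v = "view K h (contents (cfg w t') h) i j"
        show ?thesis
        \<comment> \<open>If \<open>z\<close> codes the actual view, the next content satisfies the
          clause; otherwise a cell in which the two views differ does.\<close>
        proof (cases "digits V (K + 4) z = ?v")
          case True
          then have "contents (cfg w t) h i j = next_content M i (digits V (K + 4) z) h j"
            using content_Suc[OF b(2) 3(2)] t' by simp
          then show ?thesis unfolding satisfied_def
            by (intro exI[of _ ?g]) (use t 3 g vg in \<open>auto simp: constraint_def Let_def\<close>)
        next
          case False
          then obtain l where l: "l < K + 4" "digits V (K + 4) z ! l \<noteq> ?v ! l"
            by (auto simp: view_def digits_def list_eq_iff_nth_eq simp del: upt_Suc)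
          let ?i = "if l \<le> K then l else i" and ?j = "if l \<le> K then h else j - 1 + (l - Suc K)"
          have ij: "?i \<le> K" "?j \<le> 2 * h" using l(1) b 3 by auto
          have "?v ! l = contents (cfg w t') h ?i ?j" "digits V (K + 4) z ! l = z div V ^ l mod V"
            using l(1) by (auto simp: view_def digits_def simp del: upt_Suc)
          then have ne: "?val (code (t - 1) ?i ?j) \<noteq> z div V ^ l mod V"
            using val[OF ij, of t'] l(2) t' by simp
          have lt: "code (t - 1) ?i ?j < cells" using code_less[OF _ ij] b(1) by simp
          have "constraint M V x Q T h z i t j (code (t - 1) ?i ?j) (?val (code (t - 1) ?i ?j))"
            using t 3 l(1) ne unfolding constraint_def Let_def by auto
          then show ?thesis unfolding satisfied_def using lt by blast
        qed
      qed
    qed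
  qed
  then show ?thesis unfolding solution_def
    using content_less by (auto simp: split: prod.splits)
qed

text \<open>The certificate is read off tape 1 at time 0. Border cells are not determined, so
  agreement with the run is shown for positions from \<open>t\<close> to \<open>2 * h - t\<close>, a
  window that shrinks by one on either side in each step and still contains \<open>h\<close> at time
  \<open>T\<close>.\<close>

lemma solution_imp_accepting:
  assumes sol: "solution val" shows "\<exists>w. length w \<le> Q \<and> R w"
proof -
  let ?f = "\<lambda>t i j. val (code t i j)"
  have sat: "\<exists>g. constraint M V x Q T h z i t j g (val g)"
    if "t \<le> T" "i \<le> K" "j \<le> 2 * h" "z \<le> V ^ (K + 4)" for t i j z
    using sol that unfolding solution_def satisfied_def by blast
  have init: "initial_ok M x Q h i j (?f 0 i j)" if "i \<le> K" "j \<le> 2 * h" for i j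
    using sat[OF _ that, of 0 0] by (auto simp: constraint_def Let_def)
  have mono: "?f 0 1 (j - 1) \<noteq> 0 \<or> ?f 0 1 j = 0" if "h < j" "j \<le> 2 * h" for j
    using sat[of 0 1 j 1] that tapes pow_ge by (auto simp: constraint_def Let_def)
  \<comment> \<open>The length of the certificate: the offset of the first blank, or
    \<open>Q\<close> if there is none before.\<close>
  define e where "e = (LEAST k. k = Q \<or> ?f 0 1 (h + k) = 0)"
  have e: "e = Q \<or> ?f 0 1 (h + e) = 0" "e \<le> Q" and less_e: "\<And>k. k < e \<Longrightarrow> ?f 0 1 (h + k) \<noteq> 0 \<and> k < Q"
    unfolding e_def
    using LeastI[of "\<lambda>k. k = Q \<or> ?f 0 1 (h + k) = 0" Q] Least_le[of "\<lambda>k. k = Q \<or> ?f 0 1 (h + k) = 0" Q]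
      not_less_Least[of _ "\<lambda>k. k = Q \<or> ?f 0 1 (h + k) = 0"] by (auto dest: less_le_trans)
  define w where "w = map (\<lambda>k. ?f 0 1 (h + k) = 2) [0..<e]"
  have lw: "length w \<le> Q" "length w = e" using e by (auto simp: w_def)
  have one: "1 \<noteq> K" "1 \<le> K" using tapes by auto
  have in_w: "?f 0 1 (h + k) = bit_symbol (w ! k)" if "k < e" for k
  proof -
    have "?f 0 1 (h + k) < 3" using init[of 1 "h + k"] less_e[OF that] h one by (simp add: initial_ok_def)
    then have "?f 0 1 (h + k) = 1 \<or> ?f 0 1 (h + k) = 2" using less_e[OF that] by linarith
    then show ?thesis using that by (auto simp: w_def bit_symbol_def)
  qed
  \<comment> \<open>If the window is full, \<open>initial_ok\<close> gives blanks beyond it;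
    otherwise the constraints with \<open>z = 1\<close> pass the first blank on to the
    right.\<close>
  have after_w: "?f 0 1 (h + k) = 0" if "e \<le> k" "k \<le> h" for k
  proof (cases "e = Q")
    case True
    then show ?thesis using init[of 1 "h + k"] that one by (simp add: initial_ok_def)
  next
    case False
    show ?thesis using that
    proof (induction k rule: dec_induct)
      case base
      then show ?case using False e by simp
    next
      case (step k)
      then show ?case using mono[of "h + Suc k"] by simp
    qed
  qed
  have init_eq: "?f 0 i j = contents (cfg w 0) h i j" if i: "i \<le> K" and j: "j \<le> 2 * h" for i j
  proof (cases "i = 1")
    case True
    consider "j < h" | k where "j = h + k" "k < e" | k where "j = h + k" "e \<le> k"
      by (metis le_Suc_ex linorder_not_le)
    then show ?thesis
    proof cases
      case 1
      then show ?thesis using init[OF i j] True one by (simp add: content_initial initial_ok_def)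
    next
      case 2
      then show ?thesis using in_w True one lw by (simp add: content_initial)
    next
      case 3
      then show ?thesis using after_w[of k] j True one lw by (simp add: content_initial)
    qed
  next
    case False
    then show ?thesis using init[OF i j] i
      by (auto simp: content_initial initial_ok_def get_def bit_symbol_def split: if_splits)
  qed
  have "\<forall>i j. i \<le> K \<longrightarrow> t \<le> j \<longrightarrow> j + t \<le> 2 * h \<longrightarrow> ?f t i j = contents (cfg w t) h i j" if "t \<le> T" for t
    using that
  proof (induction t)
    case 0
    then show ?case using init_eq by simp
  next
    case (Suc t)
    show ?case
    proof (intro allI impI)
      fix i j assume i: "i \<le> K" and j: "Suc t \<le> j" "j + Suc t \<le> 2 * h"
      let ?v = "view K h (contents (cfg w t) h) i j"
      have "set ?v \<subseteq> {..<V}" using content_less by (auto simp: view_def)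
      moreover have "length ?v = K + 4" by (simp add: view_def)
      ultimately obtain z where z: "z < V ^ (K + 4)" "digits V (K + 4) z = ?v"
        using digits_surj[of ?v V] by metis
      have view: "?f t (if l \<le> K then l else i) (if l \<le> K then h else j - 1 + (l - Suc K)) = z div V ^ l mod V"
        if l: "l < K + 4" for l
      proof -
        let ?i = "if l \<le> K then l else i" and ?j = "if l \<le> K then h else j - 1 + (l - Suc K)"
        have "z div V ^ l mod V = digits V (K + 4) z ! l" using l by (simp add: digits_def del: upt_Suc)
        also have "\<dots> = contents (cfg w t) h ?i ?j" unfolding z(2) using l by (simp add: view_def del: upt_Suc)
        also have "\<dots> = ?f t ?i ?j"
        proof -
          have "?i \<le> K" "t \<le> ?j" "?j + t \<le> 2 * h" using i j l h Suc.prems by (auto split: if_splits)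
          then show ?thesis using Suc by (metis Suc_leD)
        qed
        finally show ?thesis by simp
      qed
      obtain g where "constraint M V x Q T h z i (Suc t) j g (val g)"
        using sat[of "Suc t" i j z] Suc.prems i j z by auto
      then have "?f (Suc t) i j = next_content M i ?v h j"
      proof -
        \<comment> \<open>In the clause of the view that really occurs no cell differs, so only the
          alternative about the next content can hold.\<close>
        have "\<not> (\<exists>l<K + 4. g = code (Suc t - 1) (if l \<le> K then l else i) (if l \<le> K then h else j - 1 + (l - Suc K)) \<and>
          val g \<noteq> z div V ^ l mod V)" using view by (metis diff_Suc_1)
        moreover have "0 < j" "j < 2 * h" using j by auto
        ultimately show ?thesis
          using z \<open>constraint M V x Q T h z i (Suc t) j g (val g)\<close> unfolding constraint_def Let_def
          by (metis less_irrefl nat.distinct(1))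
      qed
      then show "?f (Suc t) i j = contents (cfg w (Suc t)) h i j"
        using content_Suc[OF i, of j] j by simp
    qed
  qed
  then have "?f T (K - 1) h = contents (cfg w T) h (K - 1) h" using h by auto
  moreover have "?f T (K - 1) h = 2"
    using sat[of T "K - 1" h "V ^ (K + 4)"] T tapes by (auto simp: constraint_def Let_def)
  ultimately show ?thesis using accepted_iff[OF lw(1)] lw(1) by auto
qed

end

section \<open>Computing the reduction\<close>

lemma length_binary: "i < length (binary k) \<longleftrightarrow> 2 ^ i \<le> k"
proof (induction k arbitrary: i rule: binary.induct)
  case (1 k)
  show ?case
  proof (cases "k = 0")
    case False
    then have b: "binary k = odd k # binary (k div 2)" by (subst binary.simps) simp
    show ?thesis
    proof (cases i)
      case (Suc i')
      have "i' < length (binary (k div 2)) \<longleftrightarrow> 2 ^ i' \<le> k div 2" using 1[OF False] .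
      then show ?thesis using Suc b by (simp add: less_eq_div_iff_mult_less_eq mult.commute)
    qed (use False b in simp)
  qed (simp add: binary.simps)
qed

lemma nth_binary: "i < length (binary k) \<Longrightarrow> binary k ! i \<longleftrightarrow> odd (k div 2 ^ i)"
proof (induction k arbitrary: i rule: binary.induct)
  case (1 k)
  have False: "k \<noteq> 0"
  proof
    assume "k = 0"
    then have "binary k = []" by (subst binary.simps) simp
    then show False using 1(2) by simp
  qed
  then have b: "binary k = odd k # binary (k div 2)" by (subst binary.simps) simp
  show ?case
  proof (cases i)
    case (Suc i')
    have "binary (k div 2) ! i' \<longleftrightarrow> odd (k div 2 div 2 ^ i')"
      by (rule 1(1)[OF False]) (use 1(2) Suc b in simp)
    moreover have "k div 2 ^ i = k div 2 div 2 ^ i'" by (simp only: Suc power_Suc div_mult2_eq)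
    ultimately show ?thesis using Suc b by simp
  qed (use b in simp)
qed

text \<open>The length is the number of powers of two up to \<open>k\<close>. Naming the power by a
  bounded \<open>z\<close> avoids computing it, and \<open>i < 2 ^ i\<close> bounds the
  exponents.\<close>

lemma length_binary_eq_sum: "length (binary k) = (\<Sum>i<k. of_bool (\<exists>z<Suc k. z = 2 ^ i))"
proof -
  have "i < k \<and> (\<exists>z<Suc k. z = 2 ^ i) \<longleftrightarrow> i < length (binary k)" for i
    using less_le_trans[OF less_exp[of i]] by (auto simp: length_binary less_Suc_eq_le)
  then have "{i. i < k \<and> (\<exists>z<Suc k. z = 2 ^ i)} = {..<length (binary k)}" by auto
  then show ?thesis by (simp add: sum_of_bool_eq Int_def)
qed

lemma arith_length_binary:
  assumes "arith c f" shows "arith c (\<lambda>a. length (binary (f a)))"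
  unfolding length_binary_eq_sum
  by (rule decid_eq_pow2 arith_rules | rule weaken_rules | rule assms)+

text \<open>A divisor larger than \<open>k\<close> gives the even quotient 0, so it suffices to
  search for the power among the numbers up to \<open>k\<close>.\<close>

lemma odd_div_pow2: "odd (k div 2 ^ i) \<longleftrightarrow> (\<exists>z<Suc k. z = 2 ^ i \<and> odd (k div z))" for k :: nat
  by (cases "2 ^ i \<le> k") auto

lemma decid_odd_div_pow2:
  assumes "arith c f" "arith c g" shows "decid c (\<lambda>a. odd (f a div 2 ^ g a))"
  unfolding odd_div_pow2
  by (rule decid_eq_pow2 arith_rules | rule weaken_rules | rule assms)+

lemma instance_position_cases:
  fixes n i :: nat
  obtains (1) "i < n" | (2) "i = n" | (3) j where "i = Suc n + j" "j < n * n"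
    | (4) j where "i = Suc n + n * n + j"
proof (cases "i < Suc n + n * n")
  case True
  then show thesis using that(1,2) that(3)[of "i - Suc n"] by linarith
next
  case False
  then show thesis using that(4)[of "i - (Suc n + n * n)"] by linarith
qed

text \<open>Output words are computed bit by bit from the position, and this puts the encoding into
  that form.\<close>

lemma encode_instance_eq_map:
  assumes "verts G = {0..<n}"
  shows "encode_instance G k =
    map (\<lambda>i. if i < n then True else if i = n then False
         else if i < Suc n + n * n then {(i - Suc n) div n, (i - Suc n) mod n} \<in> edges G
         else odd (k div 2 ^ (i - (Suc n + n * n)))) [0..<Suc n + n * n + length (binary k)]"
  (is "?l = ?r")
proof (rule nth_equalityI)
  have len: "length ?l = Suc n + n * n + length (binary k)"
    using assms by (simp add: encode_instance_def)
  then show "length ?l = length ?r" by simp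
  fix i assume i: "i < length ?l"
  show "?l ! i = ?r ! i"
  proof (cases i n rule: instance_position_cases)
    case (3 j)
    then have "0 < n" by (cases n) auto
    then have "j div n < n" "j mod n < n" using 3 by (auto simp: less_mult_imp_div_less)
    then have "?l ! i \<longleftrightarrow> {j div n, j mod n} \<in> edges G"
      using 3 assms by (simp add: encode_instance_def nth_append product_nth)
    moreover have "?r ! i \<longleftrightarrow> {j div n, j mod n} \<in> edges G" using 3 by (simp del: upt_Suc)
    ultimately show ?thesis by simp
  next
    case (4 j)
    then have j: "j < length (binary k)" using i len by simp
    have "?l ! i \<longleftrightarrow> binary k ! j" using 4 assms by (simp add: encode_instance_def nth_append)
    moreover have "?r ! i \<longleftrightarrow> odd (k div 2 ^ j)" using 4 j by (simp del: upt_Suc)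
    ultimately show ?thesis using nth_binary[OF j] by simp
  qed (use assms i len in \<open>auto simp: encode_instance_def nth_append simp del: upt_Suc\<close>)
qed

lemma decid_link:
  assumes "arith c C" "arith c N" "arith c v" "arith c w"
    and mem: "\<And>f g. arith c f \<Longrightarrow> arith c g \<Longrightarrow> decid c (\<lambda>a. mem a (f a) (g a))"
  shows "decid c (\<lambda>a. link (C a) (N a) m (mem a) (triple_of (N a) m (v a)) (triple_of (N a) m (w a)))"
  unfolding link_def triple_of_def prod.case
  by (rule arith_rules | rule mem | rule assms(1-4))+

lemma decid_csp_hit:
  assumes "arith c n" "arith c f" "arith c g"
    and mem: "\<And>f g u. arith c f \<Longrightarrow> arith c g \<Longrightarrow> arith c u \<Longrightarrow> decid c (\<lambda>a. mem a (f a) (g a) (u a))"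
  shows "decid c (\<lambda>a. csp_hit (n a) V (mem a) (f a) (g a))"
  unfolding csp_hit_def
  by (rule arith_rules | rule mem | rule assms(1-3))+

text \<open>State, symbols and tape are constants here, so the transition is looked up when the
  expression is built; only \<open>h\<close> and \<open>j\<close> depend on the input.\<close>

lemma arith_next_content:
  assumes "arith c h" "arith c j" shows "arith c (\<lambda>a. next_content M i vw (h a) (j a))"
proof -
  obtain q' as where tr: "transition M (vw ! num_tapes M) (take (num_tapes M) vw) = (q', as)" by fastforce
  obtain s d where sd: "as ! i = (s, d)" by fastforce
  show ?thesis unfolding next_content_def Let_def tr prod.case sd
    by (rule arith_rules | rule assms)+
qed

lemma decid_initial_ok:
  assumes "is_word c w" "arith c Q" "arith c h" "arith c j" "arith c u"
  shows "decid c (\<lambda>a. initial_ok M (w a) (Q a) (h a) i (j a) (u a))"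
  unfolding initial_ok_def
  by (rule arith_rules | rule assms)+

lemma decid_constraint_const:
  assumes "is_word c w" "arith c Q" "arith c T" "arith c h" "arith c t" "arith c j" "arith c g" "arith c u"
  shows "decid c (\<lambda>a. constraint M V (w a) (Q a) (T a) (h a) z i (t a) (j a) (g a) (u a))"
  unfolding constraint_def Let_def cell_code_def triple_code_def prod.case
  by (rule decid_ex_const | rule arith_rules | rule arith_next_content decid_initial_ok | rule assms)+

lemma decid_case_const_total:
  assumes "arith c f" "\<And>a. f a < n" "\<And>i. decid c (P i)"
  shows "decid c (\<lambda>a. P (f a) a)"
  using decid_case_const[of c f n P] assms by simp

text \<open>\<open>z\<close> and \<open>i\<close> stay below constants. Distinguishing their values
  turns the view coded by \<open>z\<close>, and the transition it determines, into
  constants.\<close>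

lemma decid_constraint:
  assumes "is_word c w" "arith c Q" "arith c T" "arith c h" "arith c t" "arith c j" "arith c g" "arith c u"
    and "arith c z" "\<And>a. z a < Z" "arith c i" "\<And>a. i a < I"
  shows "decid c (\<lambda>a. constraint M V (w a) (Q a) (T a) (h a) (z a) (i a) (t a) (j a) (g a) (u a))"
proof -
  have "decid c (\<lambda>a. constraint M V (w a) (Q a) (T a) (h a) z' (i a) (t a) (j a) (g a) (u a))" for z'
    by (rule decid_case_const_total[OF assms(11,12),
        where P = "\<lambda>i' a. constraint M V (w a) (Q a) (T a) (h a) z' i' (t a) (j a) (g a) (u a)"])
      (rule decid_constraint_const[OF assms(1-8)])
  then show ?thesis
    by (rule decid_case_const_total[OF assms(9,10),
        where P = "\<lambda>z' a. constraint M V (w a) (Q a) (T a) (h a) z' (i a) (t a) (j a) (g a) (u a)"])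
qed

lemma outputs_within_mono:
  assumes "outputs_within M t ws v" "t \<le> t'" shows "outputs_within M t' ws v"
proof -
  obtain q ts where c: "(step M ^^ t) (initial_config M ws) = (q, ts)" by fastforce
  then have "q = halt_state M" using assms(1) by (simp add: outputs_within_def)
  moreover have "(step M ^^ t') (initial_config M ws) = (step M ^^ (t' - t)) (q, ts)"
    using assms(2) c by (metis comp_apply funpow_add le_add_diff_inverse2)
  ultimately show ?thesis using assms(1) c step_halted[of q M] by (simp add: outputs_within_def)
qed

section \<open>The reduction for a fixed verifier\<close>

locale reduction =
  fixes M :: tm and q b :: "nat poly" and m :: nat and R :: "bool list \<Rightarrow> bool list \<Rightarrow> bool"
  assumes wf: "wf_tm M" and tapes: "2 \<le> num_tapes M" and m: "3 \<le> m"
    and run: "\<And>x w. outputs_within M (poly b (length x + length w)) [x, w] [R x w]"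
begin

definition "V = max (num_symbols M) (num_states M)"
text \<open>Number of constraints for each cell: the codes of all views and one more, the index used
  for acceptance.\<close>

definition "Z = Suc (V ^ ((num_tapes M) + 4))"

definition Q :: "bool list \<Rightarrow> nat" where "Q x = poly q (length x)"
definition T :: "bool list \<Rightarrow> nat" where "T x = Suc (poly b (length x + Q x))"
definition h :: "bool list \<Rightarrow> nat" where "h x = Suc (T x + length x + Q x)"
definition n :: "bool list \<Rightarrow> nat" where "n x = Suc (T x) * Suc (num_tapes M) * Suc (2 * h x)"
text \<open>A clause number splits into the number of a cell and the index of one of its
  \<open>Z\<close> constraints.\<close>

definition mem :: "bool list \<Rightarrow> nat \<Rightarrow> nat \<Rightarrow> nat \<Rightarrow> bool" where
  "mem x c = (case triple_of (num_tapes M) (2 * h x) (c div Z) of (t, i, j) \<Rightarrow>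
     constraint M V x (Q x) (T x) (h x) (c mod Z) i t j)"
definition C :: "bool list \<Rightarrow> nat" where "C x = n x + n x * Z"
definition N :: "bool list \<Rightarrow> nat" where "N x = n x * V"
definition k :: "bool list \<Rightarrow> nat" where "k x = Suc (C x) + C x * m + n x"
definition size :: "bool list \<Rightarrow> nat" where "size x = Suc (C x) * Suc (N x) * Suc m"
definition hit :: "bool list \<Rightarrow> nat \<Rightarrow> nat \<Rightarrow> bool" where "hit x = csp_hit (n x) V (mem x)"
definition H :: "bool list \<Rightarrow> nat graph" where "H x = nat_hit_graph (C x) (N x) m (hit x)"

lemma verifier_run: "verifier_run M V x (Q x) (T x) (h x) (R x)"
proof
  fix w :: "bool list" assume "length w \<le> Q x"
  then have "poly b (length x + length w) \<le> T x"
    unfolding T_def by (intro le_SucI poly_nat_mono) simp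
  then show "outputs_within M (T x) [x, w] [R x w]" using run outputs_within_mono by blast
qed (use wf tapes in \<open>auto simp: V_def T_def h_def\<close>)

lemma csp_correct:
  "(\<exists>val. (\<forall>g<n x. val g < V) \<and> (\<forall>c<n x * Z. \<exists>g<n x. mem x c g (val g))) \<longleftrightarrow>
   (\<exists>w. length w \<le> Q x \<and> R x w)"
proof -
  interpret verifier_run M V x "Q x" "T x" "h x" "R x" by (rule verifier_run)
  have cells: "cells = n x" by (simp add: cells_def n_def)
  have "(\<forall>c<n x * Z. \<exists>g<n x. mem x c g (val g)) \<longleftrightarrow>
    (\<forall>t\<le>T x. \<forall>i\<le>(num_tapes M). \<forall>j\<le>2 * h x. \<forall>z\<le>V ^ ((num_tapes M) + 4). satisfied val t i j z)" for val
  proof (intro iffI allI impI)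
    fix t i j z assume all: "\<forall>c<n x * Z. \<exists>g<n x. mem x c g (val g)"
      and b: "t \<le> T x" "i \<le> (num_tapes M)" "j \<le> 2 * h x" "z \<le> V ^ ((num_tapes M) + 4)"
    let ?c = "triple_code (num_tapes M) (2 * h x) (t, i, j)"
    have "?c < n x" unfolding n_def using b by (intro triple_code_less)
    then have "Suc ?c * Z \<le> n x * Z" by (intro mult_le_mono1) simp
    moreover have zZ: "z < Z" using b by (simp add: Z_def)
    ultimately have "?c * Z + z < n x * Z" by simp
    moreover have "(?c * Z + z) div Z = ?c" "(?c * Z + z) mod Z = z" using zZ by simp_all
    ultimately show "satisfied val t i j z"
      using all triple_of_code[OF b(2,3)] unfolding mem_def satisfied_def cells by fastforce
  next
    fix c assume all: "\<forall>t\<le>T x. \<forall>i\<le>(num_tapes M). \<forall>j\<le>2 * h x. \<forall>z\<le>V ^ ((num_tapes M) + 4). satisfied val t i j z" and c: "c < n x * Z"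
    have "c div Z < n x" using c by (simp add: less_mult_imp_div_less)
    then have "triple_of (num_tapes M) (2 * h x) (c div Z) \<in> {..T x} \<times> {..K} \<times> {..2 * h x}"
      unfolding n_def by (rule triple_of_range)
    moreover have "c mod Z \<le> V ^ ((num_tapes M) + 4)" unfolding less_Suc_eq_le[symmetric] Z_def by simp
    ultimately show "\<exists>g<n x. mem x c g (val g)"
      using all unfolding mem_def satisfied_def cells by (auto split: prod.splits)
  qed
  then have "(\<exists>val. (\<forall>g<n x. val g < V) \<and> (\<forall>c<n x * Z. \<exists>g<n x. mem x c g (val g))) \<longleftrightarrow> (\<exists>val. solution val)"
    unfolding solution_def cells by simp
  then show ?thesis using accepting_imp_solution solution_imp_accepting by blast
qed

lemma V_pos: "0 < V"
  using wf by (auto simp: V_def wf_tm_def)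

lemma n_pos: "0 < n x"
  by (simp add: n_def)

lemma graph_correct:
  assumes "p \<le> m"
  shows "nat_graph (H x)" "enat p \<le> girth (H x)"
    "(\<exists>S. connected_feedback_vertex_set (H x) S \<and> card S \<le> k x) \<longleftrightarrow> (\<exists>w. length w \<le> Q x \<and> R x w)"
proof -
  have C: "1 \<le> C x" using n_pos[of x] by (simp add: C_def)
  note * = nat_hit_graph_correct[OF m assms C]
  show "nat_graph (H x)" "enat p \<le> girth (H x)" unfolding H_def by (rule *)+
  show "(\<exists>S. connected_feedback_vertex_set (H x) S \<and> card S \<le> k x) \<longleftrightarrow> (\<exists>w. length w \<le> Q x \<and> R x w)"
    unfolding H_def k_def *(3) unfolding N_def C_def hit_def csp_hit_iff[OF V_pos] by (rule csp_correct)
qed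

lemma verts_H: "verts (H x) = {0..<size x}"
  by (simp add: H_def nat_hit_graph_def Let_def size_def)

lemma edge_H: "{v, w} \<in> edges (H x) \<longleftrightarrow> v < size x \<and> w < size x \<and>
    (link (C x) (N x) m (hit x) (triple_of (N x) m v) (triple_of (N x) m w) \<or>
     link (C x) (N x) m (hit x) (triple_of (N x) m w) (triple_of (N x) m v))"
  unfolding H_def nat_hit_graph_def Let_def size_def[symmetric] by (auto simp: doubleton_eq_iff)

lemma arith_parameters:
  assumes "is_word c w"
  shows "arith c (\<lambda>a. Q (w a))" "arith c (\<lambda>a. T (w a))" "arith c (\<lambda>a. h (w a))" "arith c (\<lambda>a. n (w a))"
    "arith c (\<lambda>a. C (w a))" "arith c (\<lambda>a. N (w a))" "arith c (\<lambda>a. k (w a))" "arith c (\<lambda>a. size (w a))"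
  unfolding size_def k_def N_def C_def n_def h_def T_def Q_def
  by (rule arith_rules | rule assms)+

lemma decid_mem:
  assumes "is_word c w" "arith c f" "arith c g" "arith c u"
  shows "decid c (\<lambda>a. mem (w a) (f a) (g a) (u a))"
  unfolding mem_def triple_of_def prod.case
  by (rule decid_constraint[where Z = Z and I = "Suc (num_tapes M)"])
    ((rule arith_rules arith_parameters assms)+ | simp add: Z_def)+

lemma decid_edge:
  assumes w: "is_word c w" and "arith c f" "arith c g"
  shows "decid c (\<lambda>a. {f a, g a} \<in> edges (H (w a)))"
  unfolding edge_H hit_def
  by (rule arith_rules | rule decid_link decid_csp_hit decid_mem arith_parameters | rule assms | assumption)+

lemma poly_time_computable_reduction:
  "poly_time_computable 1 (\<lambda>ws. encode_instance (H (ws ! 0)) (k (ws ! 0)))"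
proof (rule poly_time_computable_arith)
  fix ws :: "bool list list"
  show "encode_instance (H (ws ! 0)) (k (ws ! 0)) =
    map ((\<lambda>ws i. let x = ws ! 0; s = size x in if i < s then True else if i = s then False
         else if i < Suc s + s * s then {(i - Suc s) div s, (i - Suc s) mod s} \<in> edges (H x)
         else odd (k x div 2 ^ (i - (Suc s + s * s)))) ws)
      [0..<Suc (size (ws ! 0)) + size (ws ! 0) * size (ws ! 0) + length (binary (k (ws ! 0)))]"
    unfolding Let_def by (rule encode_instance_eq_map[OF verts_H])
next
  have w: "is_word (words_ctx 1) (\<lambda>ws. ws ! 0)" by (rule is_word_words_ctx) simp
  show "arith (words_ctx 1) (\<lambda>ws. Suc (size (ws ! 0)) + size (ws ! 0) * size (ws ! 0) + length (binary (k (ws ! 0))))"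
    by (rule arith_add arith_Suc arith_mult arith_length_binary arith_parameters w)+
  have w': "is_word (ext (words_ctx 1)) (\<lambda>z. fst z ! 0)" by (rule is_word_weaken[OF w])
  show "decid (ext (words_ctx 1)) (\<lambda>z. let x = fst z ! 0; s = size x in if snd z < s then True else if snd z = s then False
         else if snd z < Suc s + s * s then {(snd z - Suc s) div s, (snd z - Suc s) mod s} \<in> edges (H x)
         else odd (k x div 2 ^ (snd z - (Suc s + s * s))))"
    unfolding Let_def
    by (rule decid_odd_div_pow2 decid_edge arith_parameters w' | rule arith_rules)+
qed

end

lemma cfvs_problem_NP_hard:
  assumes "3 \<le> p" shows "NP_hard (connected_fvs_problem (\<lambda>G. enat p \<le> girth G))"
  unfolding NP_hard_def
proof (intro allI impI)
  fix L assume "in_NP L"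
  then obtain R q where dec: "poly_time_decidable 2 (\<lambda>ws. R (ws ! 0) (ws ! 1))"
    and L: "\<And>x. x \<in> L \<longleftrightarrow> (\<exists>w. length w \<le> poly q (length x) \<and> R x w)"
    unfolding in_NP_def by blast
  obtain M b where M: "wf_tm M" "2 \<le> num_tapes M"
    and run: "\<And>ws. length ws = 2 \<Longrightarrow> outputs_within M (poly b (sum_list (map length ws))) ws [R (ws ! 0) (ws ! 1)]"
    using dec unfolding poly_time_decidable_def poly_time_computable_def by blast
  have "outputs_within M (poly b (length x + length w)) [x, w] [R x w]" for x w
    using run[of "[x, w]"] by simp
  \<comment> \<open>Paths with \<open>p\<close> vertices suffice for girth at least
    \<open>p\<close>, so \<open>m\<close> is taken to be \<open>p\<close>.\<close>
  then interpret reduction M q b p R using M assms by unfold_locales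
  have "x \<in> L \<longleftrightarrow> encode_instance (H x) (k x) \<in> connected_fvs_problem (\<lambda>G. enat p \<le> girth G)" for x
  proof -
    note g = graph_correct[OF order_refl, of x]
    \<comment> \<open>Membership speaks of some graph and number with this encoding; injectivity of
      the encoding identifies them with \<open>H x\<close> and \<open>k x\<close>.\<close>
    have "encode_instance (H x) (k x) \<in> connected_fvs_problem (\<lambda>G. enat p \<le> girth G) \<longleftrightarrow>
      (\<exists>S. connected_feedback_vertex_set (H x) S \<and> card S \<le> k x)"
      unfolding connected_fvs_problem_def using g(1,2) encode_instance_inject by fastforce
    then show ?thesis using L g(3) by (simp add: Q_def)
  qed
  then show "poly_reducible L (connected_fvs_problem (\<lambda>G. enat p \<le> girth G))"
    unfolding poly_reducible_def using poly_time_computable_reduction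
    by (intro exI[of _ "\<lambda>x. encode_instance (H x) (k x)"]) simp
qed

section \<open>Forests\<close>

definition ranking :: "'a graph \<Rightarrow> ('a \<Rightarrow> nat) \<Rightarrow> bool" where
  "ranking G d \<longleftrightarrow> (\<forall>v x y. {v, x} \<in> edges G \<longrightarrow> {v, y} \<in> edges G \<longrightarrow> d x \<le> d v \<longrightarrow> d y \<le> d v \<longrightarrow> x = y)"

lemma ranking_imp_forest: "ranking G d \<Longrightarrow> forest G"
  unfolding forest_def ranking_def by (blast intro: ranked_cycle_False[of G _ d])

text \<open>All neighbours of the first vertex of a longest path lie on that path. One of two
  different neighbours has index at least 2 and closes a cycle with the initial segment.\<close>

lemma two_neighbours_imp_cycle:
  assumes G: "simple_graph G" and ne: "verts G \<noteq> {}"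
    and two: "\<And>v. v \<in> verts G \<Longrightarrow> \<exists>x y. x \<noteq> y \<and> {v, x} \<in> edges G \<and> {v, y} \<in> edges G"
  shows "\<exists>vs. is_cycle G vs"
proof -
  define path where "path vs \<longleftrightarrow> vs \<noteq> [] \<and> distinct vs \<and> set vs \<subseteq> verts G \<and>
    (\<forall>i. Suc i < length vs \<longrightarrow> {vs ! i, vs ! Suc i} \<in> edges G)" for vs
  have fin: "finite (verts G)" using G by (simp add: simple_graph_def)
  obtain v0 where "v0 \<in> verts G" using ne by blast
  then have p0: "path [v0]" by (simp add: path_def)
  have bnd: "length vs \<le> card (verts G)" if "path vs" for vs
    using that fin by (metis card_mono distinct_card path_def)
  define vs where "vs = arg_max length path"
  have vs: "path vs" and longest: "\<And>us. path us \<Longrightarrow> length us \<le> length vs"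
    unfolding vs_def using arg_max_nat_lemma[of path "[v0]" length "Suc (card (verts G))"] p0 bnd
    by (auto simp: less_Suc_eq_le)
  let ?v = "vs ! 0"
  have len: "0 < length vs" using vs by (simp add: path_def)
  then have v: "?v \<in> verts G" using vs unfolding path_def by auto
  have noloop: "x \<noteq> y" "x \<in> verts G" "y \<in> verts G" if "{x, y} \<in> edges G" for x y
    using G that unfolding simple_graph_def by (auto dest!: bspec)
  have in_vs: "x \<in> set vs" if x: "{?v, x} \<in> edges G" for x
  proof (rule ccontr)
    assume "x \<notin> set vs"
    moreover have "{(x # vs) ! i, (x # vs) ! Suc i} \<in> edges G" if "Suc i < length (x # vs)" for i
      using that x vs by (cases i) (auto simp: path_def insert_commute)
    ultimately have "path (x # vs)" using vs noloop[OF x] unfolding path_def by auto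
    then show False using longest by fastforce
  qed
  obtain x y where xy: "x \<noteq> y" "{?v, x} \<in> edges G" "{?v, y} \<in> edges G" using two[OF v] by blast
  obtain i j where ij: "i < length vs" "x = vs ! i" "j < length vs" "y = vs ! j"
    using in_vs[OF xy(2)] in_vs[OF xy(3)] by (auto simp: in_set_conv_nth)
  have "i \<noteq> 0" "j \<noteq> 0" "i \<noteq> j" using ij xy(1) noloop(1)[OF xy(2)] noloop(1)[OF xy(3)] by metis+
  then obtain l where l: "l < length vs" "2 \<le> l" "{?v, vs ! l} \<in> edges G"
    using ij xy by (metis One_nat_def Suc_leI le_neq_implies_less nat_neq_iff not_gr_zero numeral_2_eq_2)
  have len_l: "length (take (Suc l) vs) = Suc l" using l by simp
  have "is_cycle G (take (Suc l) vs)"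
    unfolding is_cycle_def len_l
  proof (intro conjI allI impI)
    show "3 \<le> Suc l" using l by simp
    show "distinct (take (Suc l) vs)" using vs by (simp add: path_def)
    fix i assume i: "i < Suc l"
    show "{take (Suc l) vs ! i, take (Suc l) vs ! (Suc i mod Suc l)} \<in> edges G"
    proof (cases "i = l")
      case True
      then show ?thesis using l by (simp add: insert_commute)
    next
      case False
      then have "i < l" using i by simp
      then show ?thesis using l vs by (simp add: path_def)
    qed
  qed
  then show ?thesis by blast
qed

lemma simple_graph_induced: "simple_graph G \<Longrightarrow> S \<subseteq> verts G \<Longrightarrow> simple_graph (induced_subgraph G S)"
  by (auto simp: simple_graph_def induced_subgraph_def intro: finite_subset)

text \<open>Some vertex has at most one neighbour; the rest is ranked by induction. Ranking this
  vertex above all others keeps it from counting among the neighbours of no larger rank of any other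
  vertex.\<close>

lemma forest_imp_ranking:
  "simple_graph G \<Longrightarrow> forest G \<Longrightarrow> \<exists>d. ranking G d"
proof (induction "card (verts G)" arbitrary: G rule: less_induct)
  case less
  show ?case
  proof (cases "verts G = {}")
    case True
    then have "edges G = {}" using less.prems(1) unfolding simple_graph_def by (metis card.empty ex_in_conv subset_empty zero_neq_numeral)
    then show ?thesis by (auto simp: ranking_def)
  next
    case False
    then obtain v where v: "v \<in> verts G"
      and one: "\<And>x y. {v, x} \<in> edges G \<Longrightarrow> {v, y} \<in> edges G \<Longrightarrow> x = y"
      using two_neighbours_imp_cycle[OF less.prems(1)] less.prems(2) unfolding forest_def by metis
    let ?G = "delete_verts G {v}"
    have fin: "finite (verts G)" using less.prems by (simp add: simple_graph_def)
    have "card (verts ?G) < card (verts G)"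
      unfolding delete_verts_def induced_subgraph_def fst_conv by (rule psubset_card_mono[OF fin]) (use v in auto)
    moreover have "simple_graph ?G" unfolding delete_verts_def
      by (rule simple_graph_induced[OF less.prems(1)]) blast
    moreover have "forest ?G" using less.prems(2) unfolding forest_def delete_verts_def
      by (blast dest: is_cycle_induced_subgraph)
    ultimately obtain d where d: "ranking ?G d" using less.hyps by blast
    define B where "B = Suc (Max (insert 0 (d ` verts G)))"
    have B: "d x < B" if "x \<in> verts G" for x
      using fin that by (simp add: B_def less_Suc_eq_le)
    have sub: "x \<in> verts G" "y \<in> verts G" "x \<noteq> y" if "{x, y} \<in> edges G" for x y
      using less.prems(1) that unfolding simple_graph_def by (auto dest!: bspec)
    have "ranking G (d(v := B))"
      unfolding ranking_def
    proof (intro allI impI)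
      fix u x y assume e: "{u, x} \<in> edges G" "{u, y} \<in> edges G"
        and r: "(d(v := B)) x \<le> (d(v := B)) u" "(d(v := B)) y \<le> (d(v := B)) u"
      show "x = y"
      proof (cases "u = v")
        case True
        then show ?thesis using one e by blast
      next
        case False
        then have "x \<noteq> v" "y \<noteq> v" using r B[of u] sub[OF e(1)] by (auto split: if_splits)
        then have "{u, x} \<in> edges ?G" "{u, y} \<in> edges ?G"
          using e sub[OF e(1)] sub[OF e(2)] False by (auto simp: delete_verts_def induced_subgraph_def)
        then show ?thesis using d r False \<open>x \<noteq> v\<close> \<open>y \<noteq> v\<close> unfolding ranking_def by (metis fun_upd_other)
      qed
    qed
    then show ?thesis by blast
  qed
qed

section \<open>Decoding instances\<close>

definition bits_value :: "bool list \<Rightarrow> nat" where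
  "bits_value bs = (\<Sum>i<length bs. of_bool (bs ! i) * 2 ^ i)"

lemma bits_value_simps: "bits_value [] = 0" "bits_value (b # bs) = of_bool b + 2 * bits_value bs"
proof -
  have "(\<Sum>i<length bs. of_bool (bs ! i) * 2 ^ Suc i) = 2 * bits_value bs"
    unfolding bits_value_def by (simp only: sum_distrib_left power_Suc mult_ac)
  then show "bits_value (b # bs) = of_bool b + 2 * bits_value bs"
    unfolding bits_value_def list.size add_Suc_right add_0_right sum.lessThan_Suc_shift by simp
qed (simp add: bits_value_def)

lemma binary_0: "binary 0 = []"
  by (subst binary.simps) simp

lemma binary_bits_value: "bs = [] \<or> last bs \<Longrightarrow> binary (bits_value bs) = bs"
proof (induction bs)
  case (Cons b bs)
  then have IH: "binary (bits_value bs) = bs" by (cases bs) auto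
  have "bits_value (b # bs) \<noteq> 0"
  proof (cases bs)
    case Nil
    then show ?thesis using Cons by (simp add: bits_value_simps)
  next
    case (Cons c cs)
    then have "bits_value bs \<noteq> 0" using IH binary_0 by (metis list.distinct(1))
    then show ?thesis by (simp add: bits_value_simps)
  qed
  then show ?case using IH by (subst binary.simps) (simp add: bits_value_simps)
qed (simp add: bits_value_simps binary.simps)

lemma last_binary: "binary k \<noteq> [] \<Longrightarrow> last (binary k)"
proof (induction k rule: binary.induct)
  case (1 k)
  have k: "k \<noteq> 0" using 1(2) binary_0 by metis
  then have b: "binary k = odd k # binary (k div 2)" by (subst binary.simps) simp
  show ?case
  proof (cases "binary (k div 2) = []")
    case True
    then have "k div 2 = 0" by (subst (asm) binary.simps) (simp split: if_splits)
    then have "k = 1" using k by linarith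
    then show ?thesis using b True by simp
  next
    case False
    then show ?thesis using 1(1)[OF k] b by simp
  qed
qed

definition matrix_bit :: "bool list \<Rightarrow> nat \<Rightarrow> nat \<Rightarrow> nat \<Rightarrow> bool" where
  "matrix_bit x n i j \<longleftrightarrow> get x (Suc n + i * n + j)"

definition well_formed :: "bool list \<Rightarrow> nat \<Rightarrow> bool" where
  "well_formed x n \<longleftrightarrow> Suc n + n * n \<le> length x \<and> (\<forall>i<n. get x i) \<and> \<not> get x n \<and>
     (\<forall>i<n. \<not> matrix_bit x n i i) \<and> (\<forall>i<n. \<forall>j<n. matrix_bit x n i j \<longrightarrow> matrix_bit x n j i) \<and>
     (length x = Suc n + n * n \<or> get x (length x - 1))"

definition matrix_graph :: "bool list \<Rightarrow> nat \<Rightarrow> nat graph" where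
  "matrix_graph x n = ({0..<n}, {{i, j} | i j. i < n \<and> j < n \<and> matrix_bit x n i j})"

text \<open>Its value can be exponential in the length of \<open>x\<close>, so no expression
  evaluates it; it is only compared with.\<close>

definition budget :: "bool list \<Rightarrow> nat \<Rightarrow> nat" where
  "budget x n = (\<Sum>i<length x - (Suc n + n * n). of_bool (get x (Suc n + n * n + i)) * 2 ^ i)"

lemma edges_matrix_graph:
  "well_formed x n \<Longrightarrow> {i, j} \<in> edges (matrix_graph x n) \<longleftrightarrow> i < n \<and> j < n \<and> matrix_bit x n i j"
  unfolding matrix_graph_def well_formed_def by (auto simp: doubleton_eq_iff)

lemma nat_graph_matrix_graph:
  assumes "well_formed x n" shows "nat_graph (matrix_graph x n)"
proof -
  have "card {i, j} = 2" if "i < n" "matrix_bit x n i j" for i j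
    using that assms by (cases "i = j") (auto simp: well_formed_def)
  then show ?thesis by (auto simp: nat_graph_def simple_graph_def matrix_graph_def)
qed

lemma encode_matrix_graph:
  assumes wf: "well_formed x n"
  shows "encode_instance (matrix_graph x n) (budget x n) = x"
proof -
  let ?m = "Suc n + n * n"
  let ?kb = "drop ?m x"
  have m: "?m \<le> length x" using wf by (simp add: well_formed_def)
  have kb: "budget x n = bits_value ?kb"
    unfolding budget_def bits_value_def by (rule sum.cong) (auto simp: get_def)
  have "?kb = [] \<or> last ?kb"
  proof (cases "length x = ?m")
    case False
    then have "get x (length x - 1)" "?m < length x" using wf m by (auto simp: well_formed_def)
    moreover from this(2) have "x \<noteq> []" "last ?kb = last x" by auto
    ultimately show ?thesis by (simp add: get_def last_conv_nth)
  qed simp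
  then have bin: "binary (budget x n) = ?kb" unfolding kb by (rule binary_bits_value)
  have v: "verts (matrix_graph x n) = {0..<n}" by (simp add: matrix_graph_def)
  have "encode_instance (matrix_graph x n) (budget x n) ! i = x ! i" if i: "i < length x" for i
  proof -
    have enc: "encode_instance (matrix_graph x n) (budget x n) =
      replicate n True @ [False] @ map (\<lambda>(i, j). {i, j} \<in> edges (matrix_graph x n)) (List.product [0..<n] [0..<n]) @ ?kb"
      unfolding encode_instance_def Let_def v bin by simp
    show ?thesis
    proof (cases i n rule: instance_position_cases)
      case 1
      then show ?thesis using wf enc by (simp add: nth_append well_formed_def get_def)
    next
      case 2
      then show ?thesis using wf i enc by (simp add: nth_append well_formed_def get_def)
    next
      case (3 j)
      then have "0 < n" by (cases n) auto
      then have d: "j div n < n" "j mod n < n" using 3 by (auto simp: less_mult_imp_div_less)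
      have "Suc n + j div n * n + j mod n = i" using 3 by simp
      then have "matrix_bit x n (j div n) (j mod n) \<longleftrightarrow> x ! i" using i by (simp add: matrix_bit_def get_def)
      then show ?thesis using 3 d enc
        by (simp add: nth_append product_nth edges_matrix_graph[OF wf])
    next
      case (4 j)
      then show ?thesis using i m enc by (simp add: nth_append)
    qed
  qed
  moreover have "length (encode_instance (matrix_graph x n) (budget x n)) = length x"
    unfolding encode_instance_def Let_def v bin using m by simp
  ultimately show ?thesis by (intro nth_equalityI) auto
qed

lemma well_formed_encode_instance:
  assumes G: "nat_graph G" "verts G = {0..<n}"
  shows "well_formed (encode_instance G k) n"
proof -
  let ?x = "encode_instance G k"
  have x: "?x = replicate n True @ [False] @ map (\<lambda>(i, j). {i, j} \<in> edges G) (List.product [0..<n] [0..<n]) @ binary k"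
    unfolding encode_instance_def Let_def G(2) by simp
  have bit: "matrix_bit ?x n i j \<longleftrightarrow> {i, j} \<in> edges G" if "i < n" "j < n" for i j
  proof -
    have "Suc i * n \<le> n * n" using that by (intro mult_le_mono1) simp
    then have "i * n + j < n * n" using that by simp
    moreover have "(i * n + j) div n = i" "(i * n + j) mod n = j" using that by simp_all
    ultimately show ?thesis using that unfolding matrix_bit_def get_def x
      by (simp add: nth_append product_nth)
  qed
  have "length ?x = Suc n + n * n \<or> get ?x (length ?x - 1)"
  proof (cases "binary k = []")
    case True
    then show ?thesis unfolding x by simp
  next
    case False
    then have "last ?x" using last_binary unfolding x by simp
    moreover have "?x \<noteq> []" unfolding x by simp
    ultimately show ?thesis by (auto simp: get_def last_conv_nth)
  qed
  moreover have "{i, i} \<notin> edges G" for i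
    using G(1) by (auto simp: nat_graph_def simple_graph_def)
  moreover have "get ?x i" if "i < n" for i using that unfolding x by (simp add: get_def nth_append)
  moreover have "\<not> get ?x n" unfolding x by (simp add: get_def nth_append)
  moreover have "Suc n + n * n \<le> length ?x" unfolding x by simp
  ultimately show ?thesis unfolding well_formed_def using bit by (simp add: insert_commute)
qed

lemma connected_fvs_problem_iff:
  "x \<in> connected_fvs_problem P \<longleftrightarrow> (\<exists>n<Suc (length x). well_formed x n \<and> P (matrix_graph x n) \<and>
     (\<exists>S. connected_feedback_vertex_set (matrix_graph x n) S \<and> card S \<le> budget x n))"
proof
  assume "x \<in> connected_fvs_problem P"
  then obtain G k where x: "x = encode_instance G k" and G: "nat_graph G" "P G"
    "\<exists>S. connected_feedback_vertex_set G S \<and> card S \<le> k"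
    by (auto simp: connected_fvs_problem_def)
  obtain n where n: "verts G = {0..<n}" using G by (auto simp: nat_graph_def)
  have wf: "well_formed x n" unfolding x by (rule well_formed_encode_instance[OF G(1) n])
  have "matrix_graph x n = G \<and> budget x n = k"
    using encode_instance_inject[OF nat_graph_matrix_graph[OF wf] G(1)] encode_matrix_graph[OF wf] x by simp
  moreover have "n < Suc (length x)" using wf by (simp add: well_formed_def)
  ultimately show "\<exists>n<Suc (length x). well_formed x n \<and> P (matrix_graph x n) \<and>
     (\<exists>S. connected_feedback_vertex_set (matrix_graph x n) S \<and> card S \<le> budget x n)"
    using wf G by blast
next
  assume "\<exists>n<Suc (length x). well_formed x n \<and> P (matrix_graph x n) \<and>
     (\<exists>S. connected_feedback_vertex_set (matrix_graph x n) S \<and> card S \<le> budget x n)"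
  then obtain n where n: "well_formed x n" "P (matrix_graph x n)"
    "\<exists>S. connected_feedback_vertex_set (matrix_graph x n) S \<and> card S \<le> budget x n" by blast
  show "x \<in> connected_fvs_problem P"
    unfolding connected_fvs_problem_def
    using n nat_graph_matrix_graph[OF n(1)] encode_matrix_graph[OF n(1), symmetric] by blast
qed

section \<open>Certificates\<close>

text \<open>
  A certificate consists of the characteristic vector of a set of vertices and of two \<open>n \<times> n\<close> matrices.
  The number of ones in a row is the rank of a vertex. The first ranking witnesses that the graph
  without the set is a forest, the second one that the set is connected.
\<close>

definition row_sum :: "bool list \<Rightarrow> nat \<Rightarrow> nat \<Rightarrow> nat \<Rightarrow> nat" where
  "row_sum w n s v = (\<Sum>u<n. of_bool (get w (s + v * n + u)))"

definition forest_certificate :: "bool list \<Rightarrow> bool list \<Rightarrow> nat \<Rightarrow> bool" where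
  "forest_certificate x w n \<longleftrightarrow> (\<forall>v<n. \<forall>a<n. \<forall>b<n. \<not> get w v \<and> \<not> get w a \<and> \<not> get w b \<and>
     matrix_bit x n v a \<and> matrix_bit x n v b \<and>
     row_sum w n n a \<le> row_sum w n n v \<and> row_sum w n n b \<le> row_sum w n n v \<longrightarrow> a = b)"

text \<open>The bound \<open>Suc n\<close> provides a root even for the graph without vertices. The
  root need not be required to lie in the set: if the set is nonempty, a member of least rank can
  only be the root.\<close>

definition connected_certificate :: "bool list \<Rightarrow> bool list \<Rightarrow> nat \<Rightarrow> bool" where
  "connected_certificate x w n \<longleftrightarrow> (\<exists>r<Suc n. \<forall>v<n. get w v \<and> v \<noteq> r \<longrightarrow>
     (\<exists>u<n. get w u \<and> matrix_bit x n u v \<and> row_sum w n (n + n * n) u < row_sum w n (n + n * n) v))"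

definition count_le_budget :: "bool list \<Rightarrow> bool list \<Rightarrow> nat \<Rightarrow> bool" where
  "count_le_budget x w n \<longleftrightarrow> (\<Sum>v<n. of_bool (get w v)) \<le> budget x n"

lemma certificate_sound:
  assumes wf: "well_formed x n" and "forest_certificate x w n" "connected_certificate x w n" "count_le_budget x w n"
  shows "\<exists>S. connected_feedback_vertex_set (matrix_graph x n) S \<and> card S \<le> budget x n"
proof -
  let ?G = "matrix_graph x n"
  define S where "S = {v. v < n \<and> get w v}"
  have V: "verts ?G = {0..<n}" by (simp add: matrix_graph_def)
  note e = edges_matrix_graph[OF wf]
  have "ranking (delete_verts ?G S) (row_sum w n n)"
    unfolding ranking_def
  proof (intro allI impI)
    fix v a b assume "{v, a} \<in> edges (delete_verts ?G S)" "{v, b} \<in> edges (delete_verts ?G S)"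
      and r: "row_sum w n n a \<le> row_sum w n n v" "row_sum w n n b \<le> row_sum w n n v"
    then have "matrix_bit x n v a" "matrix_bit x n v b" "v < n" "a < n" "b < n" "v \<notin> S" "a \<notin> S" "b \<notin> S"
      by (auto simp: delete_verts_def induced_subgraph_def e V)
    then show "a = b" using assms(2) r unfolding forest_certificate_def S_def by blast
  qed
  then have "forest (delete_verts ?G S)" by (rule ranking_imp_forest)
  moreover have "connected_graph (induced_subgraph ?G S)"
  proof -
    let ?R = "{(x, y). {x, y} \<in> edges (induced_subgraph ?G S)}"
    let ?d = "row_sum w n (n + n * n)"
    obtain r where r: "\<And>v. v < n \<Longrightarrow> get w v \<Longrightarrow> v \<noteq> r \<Longrightarrow>
      \<exists>u<n. get w u \<and> matrix_bit x n u v \<and> ?d u < ?d v"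
      using assms(3) unfolding connected_certificate_def by blast
    have reach: "(r, v) \<in> ?R\<^sup>*" if "v \<in> S" for v
      using that
    proof (induction "?d v" arbitrary: v rule: less_induct)
      case less
      show ?case
      proof (cases "v = r")
        case False
        then obtain u where u: "u \<in> S" "matrix_bit x n u v" "?d u < ?d v"
          using r[of v] less.prems by (auto simp: S_def)
        then have "(u, v) \<in> ?R" using less.prems by (auto simp: induced_subgraph_def e S_def)
        then show ?thesis using less.hyps[OF u(3,1)] by (rule rtrancl_into_rtrancl[rotated])
      qed simp
    qed
    have "sym ?R" by (auto simp: sym_def insert_commute)
    then have sym: "sym (?R\<^sup>*)" by (rule sym_rtrancl)
    show ?thesis unfolding connected_graph_def
    proof (intro ballI)
      fix a b assume "a \<in> verts (induced_subgraph ?G S)" "b \<in> verts (induced_subgraph ?G S)"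
      then have "a \<in> S" "b \<in> S" by (auto simp: induced_subgraph_def)
      from symD[OF sym reach[OF this(1)]] reach[OF this(2)] show "(a, b) \<in> ?R\<^sup>*" by (rule rtrancl_trans)
    qed
  qed
  moreover have "S \<subseteq> verts ?G" by (auto simp: V S_def)
  moreover have "card S \<le> budget x n"
  proof -
    have "(\<Sum>v<n. of_bool (get w v)) = card S" by (simp add: S_def sum_of_bool_eq Int_def)
    then show ?thesis using assms(4) by (simp add: count_le_budget_def)
  qed
  ultimately show ?thesis
    unfolding cfvs_defs by blast
qed

text \<open>Turns arbitrary ranks into ranks of the same order that are at most \<open>n\<close>,
  small enough to be the number of ones in a row of a matrix.\<close>

lemma count_less_le_iff:
  fixes d :: "nat \<Rightarrow> nat"
  assumes "a < n" "b < n"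
  shows "card {u. u < n \<and> d u < d a} \<le> card {u. u < n \<and> d u < d b} \<longleftrightarrow> d a \<le> d b"
proof
  assume "d a \<le> d b"
  then show "card {u. u < n \<and> d u < d a} \<le> card {u. u < n \<and> d u < d b}" by (intro card_mono) auto
next
  assume le: "card {u. u < n \<and> d u < d a} \<le> card {u. u < n \<and> d u < d b}"
  show "d a \<le> d b"
  proof (rule ccontr)
    assume "\<not> d a \<le> d b"
    then have "card {u. u < n \<and> d u < d b} < card {u. u < n \<and> d u < d a}"
      using assms by (intro psubset_card_mono) (auto intro!: psubsetI dest: less_trans)
    then show False using le by simp
  qed
qed

text \<open>The second ranking is the distance from the root within the set, since the last step of
  a shortest walk starts one closer to the root. Row \<open>v\<close> of each matrix marks the
  vertices of smaller rank than \<open>v\<close>.\<close>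

lemma certificate_complete:
  assumes wf: "well_formed x n" and S: "connected_feedback_vertex_set (matrix_graph x n) S" "card S \<le> budget x n"
  shows "\<exists>w. length w \<le> n + 2 * (n * n) \<and> forest_certificate x w n \<and> connected_certificate x w n \<and> count_le_budget x w n"
proof -
  let ?G = "matrix_graph x n"
  have V: "verts ?G = {0..<n}" by (simp add: matrix_graph_def)
  note e = edges_matrix_graph[OF wf]
  have SV: "S \<subseteq> {0..<n}" using S(1) V by (auto simp: cfvs_defs)
  have "simple_graph ?G" using nat_graph_matrix_graph[OF wf] by (simp add: nat_graph_def)
  then have "simple_graph (delete_verts ?G S)" unfolding delete_verts_def by (rule simple_graph_induced) blast
  then obtain d where d: "ranking (delete_verts ?G S) d"
    using forest_imp_ranking S(1) unfolding cfvs_defs by blast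
  let ?R = "{(x, y). {x, y} \<in> edges (induced_subgraph ?G S)}"
  obtain r where r: "r \<le> n" "S \<noteq> {} \<longrightarrow> r \<in> S" using SV by (cases "S = {}") force+
  define d' where "d' v = (LEAST k. (r, v) \<in> ?R ^^ k)" for v
  have pred: "\<exists>u\<in>S. matrix_bit x n u v \<and> d' u < d' v" if v: "v \<in> S" "v \<noteq> r" for v
  proof -
    have "(r, v) \<in> ?R\<^sup>*" using S(1) r v
      by (auto simp: connected_feedback_vertex_set_def connected_graph_def induced_subgraph_def)
    then obtain k where "(r, v) \<in> ?R ^^ k" by (metis rtrancl_imp_relpow)
    then have k: "(r, v) \<in> ?R ^^ d' v" unfolding d'_def by (rule LeastI)
    obtain k' where k': "d' v = Suc k'" using k v(2) by (cases "d' v") auto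
    then obtain u where u: "(r, u) \<in> ?R ^^ k'" "(u, v) \<in> ?R" using k by auto
    have "d' u \<le> k'" unfolding d'_def using u(1) by (rule Least_le)
    moreover have "u \<in> S" "matrix_bit x n u v" using u(2) by (auto simp: induced_subgraph_def e)
    ultimately show ?thesis using k' by auto
  qed
  define w where "w = map (\<lambda>i. if i < n then i \<in> S
    else if i < n + n * n then d ((i - n) mod n) < d ((i - n) div n)
    else d' ((i - (n + n * n)) mod n) < d' ((i - (n + n * n)) div n)) [0..<n + 2 * (n * n)]"
  have wS: "get w v \<longleftrightarrow> v \<in> S" if "v < n" for v using that by (auto simp: w_def get_def)
  have idx: "v * n + u < n * n" "(v * n + u) div n = v" "(v * n + u) mod n = u" if "v < n" "u < n" for u v
  proof -
    have "Suc v * n \<le> n * n" using that by (intro mult_le_mono1) simp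
    then show "v * n + u < n * n" using that by simp
  qed (use that in simp_all)
  have "get w (n + v * n + u) \<longleftrightarrow> d u < d v" if "v < n" "u < n" for u v
    using idx[OF that] by (simp add: w_def get_def add.assoc del: upt_Suc)
  then have r1: "row_sum w n n v = card {u. u < n \<and> d u < d v}" if "v < n" for v
    using that by (simp add: row_sum_def sum_of_bool_eq Int_def cong: conj_cong)
  have "get w (n + n * n + v * n + u) \<longleftrightarrow> d' u < d' v" if "v < n" "u < n" for u v
    using idx[OF that] by (simp add: w_def get_def add.assoc del: upt_Suc)
  then have r2: "row_sum w n (n + n * n) v = card {u. u < n \<and> d' u < d' v}" if "v < n" for v
    using that by (simp add: row_sum_def sum_of_bool_eq Int_def cong: conj_cong)
  have "forest_certificate x w n"
    unfolding forest_certificate_def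
  proof (intro allI impI, elim conjE)
    fix v a b assume b: "v < n" "a < n" "b < n" "\<not> get w v" "\<not> get w a" "\<not> get w b"
      "matrix_bit x n v a" "matrix_bit x n v b"
      and r: "row_sum w n n a \<le> row_sum w n n v" "row_sum w n n b \<le> row_sum w n n v"
    have "{v, a} \<in> edges (delete_verts ?G S)" "{v, b} \<in> edges (delete_verts ?G S)"
      using b wS by (auto simp: delete_verts_def induced_subgraph_def e V)
    moreover have "d a \<le> d v" "d b \<le> d v" using r b r1 count_less_le_iff by auto
    ultimately show "a = b" using d unfolding ranking_def by blast
  qed
  moreover have "connected_certificate x w n"
    unfolding connected_certificate_def
  proof (rule exI[of _ r], intro conjI allI impI)
    show "r < Suc n" using r by simp
    fix v assume v: "v < n" "get w v \<and> v \<noteq> r"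
    then obtain u where u: "u \<in> S" "matrix_bit x n u v" "d' u < d' v" using pred[of v] wS by auto
    moreover have "u < n" using u SV by auto
    moreover have "row_sum w n (n + n * n) u < row_sum w n (n + n * n) v"
      using count_less_le_iff[OF v(1) \<open>u < n\<close>, of d'] r2 v(1) \<open>u < n\<close> u(3) by (simp add: not_le[symmetric])
    ultimately show "\<exists>u<n. get w u \<and> matrix_bit x n u v \<and> row_sum w n (n + n * n) u < row_sum w n (n + n * n) v"
      using wS by blast
  qed
  moreover have "count_le_budget x w n"
  proof -
    have "(\<Sum>v<n. of_bool (get w v)) = card {v. v < n \<and> get w v}" by (simp add: sum_of_bool_eq Int_def)
    also have "{v. v < n \<and> get w v} = S" using wS SV by auto
    finally show ?thesis using S(2) by (simp add: count_le_budget_def)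
  qed
  moreover have "length w \<le> n + 2 * (n * n)" by (simp add: w_def)
  ultimately show ?thesis by blast
qed

section \<open>Verifying certificates\<close>

text \<open>The digits of \<open>z\<close> to base \<open>n\<close> are the vertices of a candidate
  cycle. As \<open>p\<close> is fixed, \<open>n ^ l\<close> is polynomial and the quantifiers over
  lengths and positions unfold.\<close>

definition girth_check :: "nat \<Rightarrow> bool list \<Rightarrow> nat \<Rightarrow> bool" where
  "girth_check p x n \<longleftrightarrow> (\<forall>l<p. 3 \<le> l \<longrightarrow> \<not> (\<exists>z<n ^ l.
     (\<forall>i<l. \<forall>j<l. i \<noteq> j \<longrightarrow> z div n ^ i mod n \<noteq> z div n ^ j mod n) \<and>
     (\<forall>i<l. matrix_bit x n (z div n ^ i mod n) (z div n ^ (Suc i mod l) mod n))))"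

lemma girth_check_iff:
  assumes wf: "well_formed x n" shows "girth_check p x n \<longleftrightarrow> enat p \<le> girth (matrix_graph x n)"
proof -
  let ?G = "matrix_graph x n"
  have V: "verts ?G = {0..<n}" by (simp add: matrix_graph_def)
  note e = edges_matrix_graph[OF wf]
  have nth: "digits n l z ! i = z div n ^ i mod n" if "i < l" for l z i using that by (simp add: digits_def)
  have cyc: "is_cycle ?G (digits n l z) \<longleftrightarrow>
     (\<forall>i<l. \<forall>j<l. i \<noteq> j \<longrightarrow> z div n ^ i mod n \<noteq> z div n ^ j mod n) \<and>
     (\<forall>i<l. matrix_bit x n (z div n ^ i mod n) (z div n ^ (Suc i mod l) mod n))"
    if "3 \<le> l" "z < n ^ l" for l z
  proof -
    have n: "0 < n" using that by (cases n) (auto simp: power_0_left split: if_splits)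
    have len: "length (digits n l z) = l" by (simp add: digits_def)
    have m: "Suc i mod l < l" for i using that by (intro mod_less_divisor) linarith
    show ?thesis unfolding is_cycle_def len distinct_conv_nth using that n by (simp add: nth m e)
  qed
  show ?thesis unfolding girth_ge_iff
  proof
    assume chk: "girth_check p x n"
    show "\<forall>vs. is_cycle ?G vs \<longrightarrow> p \<le> length vs"
    proof (intro allI impI, rule ccontr)
      fix vs assume c: "is_cycle ?G vs" and less: "\<not> p \<le> length vs"
      have "set vs \<subseteq> {..<n}"
        using cycle_subset_verts[OF _ c] nat_graph_matrix_graph[OF wf] V by (auto simp: nat_graph_def)
      then obtain z where z: "z < n ^ length vs" "digits n (length vs) z = vs" using digits_surj by blast
      moreover have "3 \<le> length vs" using c by (simp add: is_cycle_def)
      ultimately show False using chk less c cyc[of "length vs" z] unfolding girth_check_def by (metis not_le)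
    qed
  next
    assume all: "\<forall>vs. is_cycle ?G vs \<longrightarrow> p \<le> length vs"
    show "girth_check p x n" unfolding girth_check_def
    proof (intro allI impI notI, elim exE conjE)
      fix l z assume "l < p" "3 \<le> l" "z < n ^ l"
        "\<forall>i<l. \<forall>j<l. i \<noteq> j \<longrightarrow> z div n ^ i mod n \<noteq> z div n ^ j mod n"
        "\<forall>i<l. matrix_bit x n (z div n ^ i mod n) (z div n ^ (Suc i mod l) mod n)"
      then have "is_cycle ?G (digits n l z)" using cyc by blast
      then show False using all \<open>l < p\<close> by (auto simp: digits_def)
    qed
  qed
qed

text \<open>Either a single set bit already weighs at least \<open>s\<close>, or all set bits weigh
  less than \<open>s\<close> and each weight can be found as some \<open>z < s\<close>. No number
  exponential in the input length has to be computed.\<close>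

lemma le_binary_sum_iff:
  "s \<le> (\<Sum>i<l. of_bool (P i) * 2 ^ i) \<longleftrightarrow> (\<exists>i<l. P i \<and> \<not> (\<exists>z<s. z = 2 ^ i)) \<or>
     s \<le> (\<Sum>i<l. \<Sum>z<s. of_bool (P i \<and> z = 2 ^ i) * z)" for s :: nat
proof (cases "\<exists>i<l. P i \<and> \<not> (\<exists>z<s. z = 2 ^ i)")
  case True
  then obtain i where i: "i < l" "P i" "s \<le> 2 ^ i" by (auto simp: not_less)
  have "of_bool (P i) * 2 ^ i \<le> (\<Sum>i<l. of_bool (P i) * (2 :: nat) ^ i)"
    using i(1) by (intro member_le_sum) auto
  then show ?thesis using True i by simp
next
  case False
  have "(\<Sum>z<s. of_bool (P i \<and> z = 2 ^ i) * z) = of_bool (P i) * 2 ^ i" if "i < l" for i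
  proof (cases "P i")
    case True
    then have "2 ^ i < s" using False that by blast
    moreover have "of_bool (P i \<and> z = 2 ^ i) * z = (if z = 2 ^ i then z else 0)" for z :: nat using True by simp
    ultimately show ?thesis using True by (simp add: sum.delta)
  qed simp
  then have "(\<Sum>i<l. \<Sum>z<s. of_bool (P i \<and> z = 2 ^ i) * z) = (\<Sum>i<l. of_bool (P i) * 2 ^ i)"
    by (intro sum.cong) auto
  then show ?thesis using False by argo
qed

lemma decid_matrix_bit:
  assumes "is_word c x" "arith c n" "arith c f" "arith c g"
  shows "decid c (\<lambda>a. matrix_bit (x a) (n a) (f a) (g a))"
  unfolding matrix_bit_def by (rule arith_rules | rule assms)+

lemma arith_row_sum:
  assumes "is_word c w" "arith c n" "arith c s" "arith c v"
  shows "arith c (\<lambda>a. row_sum (w a) (n a) (s a) (v a))"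
  unfolding row_sum_def by (rule arith_rules | rule weaken_rules | rule assms)+

lemma decid_well_formed:
  assumes "is_word c x" "arith c n" shows "decid c (\<lambda>a. well_formed (x a) (n a))"
  unfolding well_formed_def
  by (rule arith_rules | rule decid_matrix_bit | rule weaken_rules | rule assms)+

lemma decid_forest_certificate:
  assumes "is_word c x" "is_word c w" "arith c n" shows "decid c (\<lambda>a. forest_certificate (x a) (w a) (n a))"
  unfolding forest_certificate_def
  by (rule arith_rules | rule decid_matrix_bit arith_row_sum | rule weaken_rules | rule assms)+

lemma decid_connected_certificate:
  assumes "is_word c x" "is_word c w" "arith c n" shows "decid c (\<lambda>a. connected_certificate (x a) (w a) (n a))"
  unfolding connected_certificate_def
  by (rule arith_rules | rule decid_matrix_bit arith_row_sum | rule weaken_rules | rule assms)+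

lemma decid_count_le_budget:
  assumes "is_word c x" "is_word c w" "arith c n" shows "decid c (\<lambda>a. count_le_budget (x a) (w a) (n a))"
  unfolding count_le_budget_def budget_def le_binary_sum_iff
  by (rule decid_eq_pow2 | rule arith_rules | rule weaken_rules | rule assms)+

lemma decid_girth_check:
  assumes "is_word c x" "arith c n" shows "decid c (\<lambda>a. girth_check p (x a) (n a))"
  unfolding girth_check_def
  by (rule decid_all_const | rule arith_rules | rule decid_matrix_bit | rule weaken_rules | rule assms)+

lemma cfvs_problem_in_NP: "in_NP (connected_fvs_problem (\<lambda>G. enat p \<le> girth G))"
proof -
  define R where "R x w \<longleftrightarrow> (\<exists>n<Suc (length x). well_formed x n \<and> girth_check p x n \<and>
    forest_certificate x w n \<and> connected_certificate x w n \<and> count_le_budget x w n)" for x w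
  have w: "is_word (words_ctx 2) (\<lambda>ws. ws ! 0)" "is_word (words_ctx 2) (\<lambda>ws. ws ! 1)"
    by (rule is_word_words_ctx; simp)+
  have "decid (words_ctx 2) (\<lambda>ws. R (ws ! 0) (ws ! 1))"
    unfolding R_def
    by (rule decid_well_formed decid_girth_check decid_forest_certificate decid_connected_certificate
        decid_count_le_budget | rule arith_rules | rule weaken_rules | rule w)+
  then have "poly_time_decidable 2 (\<lambda>ws. R (ws ! 0) (ws ! 1))" by (rule poly_time_decidable_decid)
  \<comment> \<open>The polynomial is the certificate length \<open>n + 2 * (n * n)\<close> with the
    length of \<open>x\<close> as a bound for \<open>n\<close>.\<close>
  moreover have "x \<in> connected_fvs_problem (\<lambda>G. enat p \<le> girth G) \<longleftrightarrow>
    (\<exists>w. length w \<le> poly [:0, 1, 2:] (length x) \<and> R x w)" for x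
  proof
    assume "x \<in> connected_fvs_problem (\<lambda>G. enat p \<le> girth G)"
    then obtain n S where n: "n < Suc (length x)" "well_formed x n" "enat p \<le> girth (matrix_graph x n)"
      "connected_feedback_vertex_set (matrix_graph x n) S" "card S \<le> budget x n"
      unfolding connected_fvs_problem_iff by blast
    obtain w where w: "length w \<le> n + 2 * (n * n)" "forest_certificate x w n" "connected_certificate x w n"
      "count_le_budget x w n" using certificate_complete[OF n(2,4,5)] by blast
    have "R x w" unfolding R_def using n w girth_check_iff[OF n(2)] by blast
    moreover have "length w \<le> poly [:0, 1, 2:] (length x)"
    proof -
      have "n * n \<le> length x * length x" using n(1) by (intro mult_le_mono) auto
      then show ?thesis using w(1) n(1) by (simp add: algebra_simps)
    qed
    ultimately show "\<exists>w. length w \<le> poly [:0, 1, 2:] (length x) \<and> R x w" by blast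
  next
    assume "\<exists>w. length w \<le> poly [:0, 1, 2:] (length x) \<and> R x w"
    then show "x \<in> connected_fvs_problem (\<lambda>G. enat p \<le> girth G)"
      unfolding R_def connected_fvs_problem_iff using certificate_sound girth_check_iff by blast
  qed
  ultimately show ?thesis unfolding in_NP_def by blast
qed

theorem theorem6:
  fixes p :: nat
  assumes "3 \<le> p"
  shows "NP_complete (connected_fvs_problem (\<lambda>G. enat p \<le> girth G))"
  using cfvs_problem_in_NP cfvs_problem_NP_hard[OF assms] by (simp add: NP_complete_def)

end
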